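(* Let $X=(X_t,t\ge 0)$ be a spectrally positive Lévy process (started at $X_0=0$) adapted to a right-continuous and complete filtration $(\mathscr{F}_t,t\ge 0)$. Assume that the sample paths of $X$ have unbounded variation. Given a parameter $\gamma>0$ and a point $z\ge 0$, there exists a unique pair of stochastic processes $Z=(Z_t,t\ge 0)$ and $C=(C_t,t\ge 0)$ satisfying $$Z_t=z+X_{C_t}+\gamma\int_0^t \mathrm{I}(Z_s=0)\,ds,\qquad\text{where}\qquad C_t=\int_0^t \mathrm{I}(Z_s>0)\,ds,$$ for every $t\ge 0$. For this unique pair $(Z,C)$, the process $C$ is an $(\mathscr{F}_t)$-time change and $Z$ is adapted to the time-changed filtration $(\widehat{\mathscr{F}}_t,t\ge 0)$ given by $\widehat{\mathscr{F}}_t=\mathscr{F}_{C_t}$. Furthermore, $Z$ is a sticky Lévy process based on $X$.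
   Context: A spectrally positive Lévy process (SPLP) is a real-valued Lévy process with càdlàg paths that has no negative jumps. "Unbounded variation" means that the sample paths have unbounded variation on any (non-degenerate) interval; equivalently, there is a Gaussian component or $\sum_{s\le t}|X_s-X_{s-}|=\infty$ almost surely for some $t>0$. $\mathrm{I}$ denotes the indicator function. An $(\mathscr{F}_t)$-time change is a process $C$ with non-decreasing right-continuous paths such that each $C_t$ is an $(\mathscr{F}_s)_{s\ge0}$-stopping time. Let $X^0$ stand for $X$ killed upon reaching zero. An extension of $X^0$ is a càdlàg strong Markov process $Z$ with values in $[0,\infty)$ such that $X$ and $Z$ (started from the same point $z$; for $X$ this means considering $z+X$) have the same law if killed upon reaching $0$. A sticky Lévy process based on $X$ (Lévy process with sticky boundary at $0$ based on $X$) is an extension $Z$ of $X^0$ for which $0$ is regular and instantaneous and which spends positive time at zero; that is, if $Z_0=0$ then almost surely $$0=\inf\{t>0:Z_t=0\}=\inf\{t>0:Z_t\ne 0\}\quad\text{and}\quad \int_0^\infty \mathrm{I}(Z_s=0)\,ds>0.$$ Here the Markov process $Z$ is understood as the family, indexed by the starting point $z\ge0$, of solutions of the equation $Z_t=z+X_{C_t}+\gamma\int_0^t \mathrm{I}(Z_s=0)\,ds$ with $C_t=\int_0^t \mathrm{I}(Z_s>0)\,ds$, $t\ge 0$, with $\gamma$ and the law of $X$ fixed. *)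

theory Defs
  imports "HOL-Probability.Probability"
begin

text \<open>
  Processes are functions \<open>Y t \<omega>\<close> of a real time \<open>t\<close>; only their values at times \<open>t \<ge> 0\<close> matter.
  Filtrations and stopping times are those of \<open>HOL-Probability.Stopping_Time\<close> with time set
  \<open>[0, \<infinity>]\<close>, i.e. \<^typ>\<open>ennreal\<close>: stopping times may be infinite, and \<open>F \<infinity>\<close> is any
  sub-\<open>\<sigma>\<close>-algebra containing all \<open>F t\<close>.
\<close>

definition cadlag :: "(real \<Rightarrow> real) \<Rightarrow> bool" where
  "cadlag f \<longleftrightarrow>
    (\<forall>t\<ge>0. continuous (at_right t) f) \<and> (\<forall>t>0. \<exists>l. (f \<longlongrightarrow> l) (at_left t))"

definition no_negative_jumps :: "(real \<Rightarrow> real) \<Rightarrow> bool" where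
  "no_negative_jumps f \<longleftrightarrow> (\<forall>t>0. \<forall>l. (f \<longlongrightarrow> l) (at_left t) \<longrightarrow> l \<le> f t)"

definition bounded_variation_on :: "real \<Rightarrow> real \<Rightarrow> (real \<Rightarrow> real) \<Rightarrow> bool" where
  "bounded_variation_on a b f \<longleftrightarrow>
    (\<exists>K. \<forall>n. \<forall>p :: nat \<Rightarrow> real. mono_on {..n} p \<and> p ` {..n} \<subseteq> {a..b} \<longrightarrow>
      (\<Sum>i<n. \<bar>f (p (Suc i)) - f (p i)\<bar>) \<le> K)"

definition usual_filtration :: "'a measure \<Rightarrow> (ennreal \<Rightarrow> 'a measure) \<Rightarrow> bool" where
  "usual_filtration M F \<longleftrightarrow>
    filtration (space M) F \<and> (\<forall>t. subalgebra M (F t)) \<and>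
    (\<forall>t<\<infinity>. sets (F t) = (\<Inter>s\<in>{t<..}. sets (F s))) \<and>
    complete_measure M \<and> null_sets M \<subseteq> sets (F 0)"

definition adapted :: "(ennreal \<Rightarrow> 'a measure) \<Rightarrow> (real \<Rightarrow> 'a \<Rightarrow> real) \<Rightarrow> bool" where
  "adapted F Y \<longleftrightarrow> (\<forall>t\<ge>0. Y t \<in> borel_measurable (F (ennreal t)))"

definition time_change ::
  "'a measure \<Rightarrow> (ennreal \<Rightarrow> 'a measure) \<Rightarrow> (real \<Rightarrow> 'a \<Rightarrow> real) \<Rightarrow> bool" where
  "time_change M F C \<longleftrightarrow>
    (AE \<omega> in M. (\<forall>t\<ge>0. 0 \<le> C t \<omega> \<and> continuous (at_right t) (\<lambda>s. C s \<omega>)) \<and>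
      mono_on {0..} (\<lambda>s. C s \<omega>)) \<and>
    (\<forall>t\<ge>0. stopping_time F (\<lambda>\<omega>. ennreal (C t \<omega>)))"

text \<open>The \<open>\<sigma>\<close>-algebra generated by the process up to time \<open>t\<close> and the null sets, and the
  right-continuous filtration obtained from it. The index \<open>\<infinity>\<close> is inserted so that the
  intersection is not empty at \<open>t = \<infinity>\<close>.\<close>

definition past_sets :: "'b measure \<Rightarrow> (real \<Rightarrow> 'b \<Rightarrow> real) \<Rightarrow> ennreal \<Rightarrow> 'b set set" where
  "past_sets P Y t = sigma_sets (space P)
    ({Y u -` B \<inter> space P |u B. 0 \<le> u \<and> ennreal u \<le> t \<and> B \<in> sets borel} \<union> null_sets P)"

definition natural_filtration ::
  "'b measure \<Rightarrow> (real \<Rightarrow> 'b \<Rightarrow> real) \<Rightarrow> ennreal \<Rightarrow> 'b measure" where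
  "natural_filtration P Y t = sigma (space P) (\<Inter>s\<in>insert \<infinity> {t<..}. past_sets P Y s)"

definition levy_process :: "'a measure \<Rightarrow> (real \<Rightarrow> 'a \<Rightarrow> real) \<Rightarrow> bool" where
  "levy_process M X \<longleftrightarrow>
    prob_space M \<and>
    (\<forall>t\<ge>0. X t \<in> borel_measurable M) \<and>
    (AE \<omega> in M. X 0 \<omega> = 0) \<and>
    (AE \<omega> in M. cadlag (\<lambda>t. X t \<omega>)) \<and>
    (\<forall>n. \<forall>p :: nat \<Rightarrow> real. 0 \<le> p 0 \<and> mono_on {..n} p \<longrightarrow>
      prob_space.indep_vars M (\<lambda>_. borel) (\<lambda>i \<omega>. X (p (Suc i)) \<omega> - X (p i) \<omega>) {..<n}) \<and>
    (\<forall>s\<ge>0. \<forall>t\<ge>0. distr M borel (\<lambda>\<omega>. X (s + t) \<omega> - X s \<omega>) = distr M borel (X t))"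

definition spectrally_positive_levy_process ::
  "'a measure \<Rightarrow> (real \<Rightarrow> 'a \<Rightarrow> real) \<Rightarrow> bool" where
  "spectrally_positive_levy_process M X \<longleftrightarrow>
    levy_process M X \<and> (AE \<omega> in M. no_negative_jumps (\<lambda>t. X t \<omega>))"

definition unbounded_variation :: "'a measure \<Rightarrow> (real \<Rightarrow> 'a \<Rightarrow> real) \<Rightarrow> bool" where
  "unbounded_variation M X \<longleftrightarrow>
    (AE \<omega> in M. \<forall>a b. 0 \<le> a \<and> a < b \<longrightarrow> \<not> bounded_variation_on a b (\<lambda>t. X t \<omega>))"

text \<open>Integrability of the indicators is required explicitly: \<^const>\<open>integral\<close> is \<open>0\<close> by
  convention when the integral does not exist.\<close>

definition solves_path ::
  "(real \<Rightarrow> real) \<Rightarrow> real \<Rightarrow> real \<Rightarrow> (real \<Rightarrow> real) \<Rightarrow> (real \<Rightarrow> real) \<Rightarrow> bool" where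
  "solves_path x \<gamma> z f c \<longleftrightarrow> (\<forall>t\<ge>0.
    (\<lambda>s. indicat_real {0} (f s)) integrable_on {0..t} \<and>
    (\<lambda>s. indicat_real {0<..} (f s)) integrable_on {0..t} \<and>
    f t = z + x (c t) + \<gamma> * integral {0..t} (\<lambda>s. indicat_real {0} (f s)) \<and>
    c t = integral {0..t} (\<lambda>s. indicat_real {0<..} (f s)))"

definition sticky_solution ::
  "'a measure \<Rightarrow> (real \<Rightarrow> 'a \<Rightarrow> real) \<Rightarrow> real \<Rightarrow> real \<Rightarrow>
    (real \<Rightarrow> 'a \<Rightarrow> real) \<Rightarrow> (real \<Rightarrow> 'a \<Rightarrow> real) \<Rightarrow> bool" where
  "sticky_solution M X \<gamma> z Z C \<longleftrightarrow>
    (\<forall>t\<ge>0. Z t \<in> borel_measurable M \<and> C t \<in> borel_measurable M) \<and>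
    (AE \<omega> in M. solves_path (\<lambda>t. X t \<omega>) \<gamma> z (\<lambda>t. Z t \<omega>) (\<lambda>t. C t \<omega>))"

definition indistinguishable ::
  "'a measure \<Rightarrow> (real \<Rightarrow> 'a \<Rightarrow> real) \<Rightarrow> (real \<Rightarrow> 'a \<Rightarrow> real) \<Rightarrow> bool" where
  "indistinguishable M Y Y' \<longleftrightarrow> (AE \<omega> in M. \<forall>t\<ge>0. Y t \<omega> = Y' t \<omega>)"

definition path_space :: "(real \<Rightarrow> 'c::topological_space) measure" where
  "path_space = (\<Pi>\<^sub>M t\<in>{0..}. borel)"

definition law :: "'b measure \<Rightarrow> (real \<Rightarrow> 'b \<Rightarrow> 'c::topological_space) \<Rightarrow> (real \<Rightarrow> 'c) measure" where
  "law P Y = distr P path_space (\<lambda>\<omega>. \<lambda>t\<in>{0..}. Y t \<omega>)"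

definition same_law ::
  "'a measure \<Rightarrow> (real \<Rightarrow> 'a \<Rightarrow> 'c::topological_space) \<Rightarrow>
    'b measure \<Rightarrow> (real \<Rightarrow> 'b \<Rightarrow> 'c) \<Rightarrow> bool" where
  "same_law M Y P Y' \<longleftrightarrow>
    (\<forall>t\<ge>0. Y t \<in> borel_measurable M) \<and> (\<forall>t\<ge>0. Y' t \<in> borel_measurable P) \<and>
    law M Y = law P Y'"

text \<open>The killed process is sent to the cemetery state \<^term>\<open>\<infinity> :: ereal\<close> upon reaching zero.\<close>

definition reaching_time :: "(real \<Rightarrow> 'b \<Rightarrow> real) \<Rightarrow> 'b \<Rightarrow> ennreal" where
  "reaching_time Y \<omega> = Inf (ennreal ` {t. 0 \<le> t \<and> Y t \<omega> = 0})"

definition killed :: "(real \<Rightarrow> 'b \<Rightarrow> real) \<Rightarrow> real \<Rightarrow> 'b \<Rightarrow> ereal" where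
  "killed Y t \<omega> = (if ennreal t < reaching_time Y \<omega> then ereal (Y t \<omega>) else \<infinity>)"

text \<open>
  A Markov process is a family: for each starting point \<open>z \<ge> 0\<close>, a probability space \<open>P z\<close> and a
  process \<open>Z z\<close> on it starting at \<open>z\<close>. The strong Markov property says that, given the past up to
  a stopping time \<open>T\<close> and on \<open>T < \<infinity>\<close>, the process after time \<open>T\<close> has the law of the member of the
  family started at the position at time \<open>T\<close>.
\<close>

definition strong_markov_process ::
  "(real \<Rightarrow> 'b measure) \<Rightarrow> (real \<Rightarrow> real \<Rightarrow> 'b \<Rightarrow> real) \<Rightarrow> bool" where
  "strong_markov_process P Z \<longleftrightarrow>
    (\<forall>z\<ge>0. prob_space (P z) \<and> (\<forall>t\<ge>0. Z z t \<in> borel_measurable (P z)) \<and>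
      (AE \<omega> in P z. Z z 0 \<omega> = z)) \<and>
    (\<lambda>z. law (P z) (Z z)) \<in> restrict_space borel {0..} \<rightarrow>\<^sub>M prob_algebra path_space \<and>
    (\<forall>z\<ge>0. \<forall>T. stopping_time (natural_filtration (P z) (Z z)) T \<longrightarrow>
      (\<forall>B\<in>sets path_space. AE \<omega> in P z. T \<omega> < \<infinity> \<longrightarrow>
        real_cond_exp (P z)
          (filtration.pre_sigma (space (P z)) (natural_filtration (P z) (Z z)) T)
          (indicator {\<omega>\<in>space (P z). T \<omega> < \<infinity> \<and>
            (\<lambda>t\<in>{0..}. Z z (enn2real (T \<omega>) + t) \<omega>) \<in> B}) \<omega>
        = (let y = Z z (enn2real (T \<omega>)) \<omega> in measure (law (P y) (Z y)) B)))"

definition extension_of_killed ::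
  "'a measure \<Rightarrow> (real \<Rightarrow> 'a \<Rightarrow> real) \<Rightarrow>
    (real \<Rightarrow> 'b measure) \<Rightarrow> (real \<Rightarrow> real \<Rightarrow> 'b \<Rightarrow> real) \<Rightarrow> bool" where
  "extension_of_killed M X P Z \<longleftrightarrow>
    strong_markov_process P Z \<and>
    (\<forall>z\<ge>0. AE \<omega> in P z. cadlag (\<lambda>t. Z z t \<omega>) \<and> (\<forall>t\<ge>0. 0 \<le> Z z t \<omega>)) \<and>
    (\<forall>z\<ge>0. same_law M (killed (\<lambda>t \<omega>. z + X t \<omega>)) (P z) (killed (Z z)))"

definition sticky_levy_process ::
  "'a measure \<Rightarrow> (real \<Rightarrow> 'a \<Rightarrow> real) \<Rightarrow>
    (real \<Rightarrow> 'b measure) \<Rightarrow> (real \<Rightarrow> real \<Rightarrow> 'b \<Rightarrow> real) \<Rightarrow> bool" where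
  "sticky_levy_process M X P Z \<longleftrightarrow>
    extension_of_killed M X P Z \<and>
    (AE \<omega> in P 0.
      Inf (ennreal ` {t. 0 < t \<and> Z 0 t \<omega> = 0}) = 0 \<and>
      Inf (ennreal ` {t. 0 < t \<and> Z 0 t \<omega> \<noteq> 0}) = 0 \<and>
      (\<integral>\<^sup>+s\<in>{0..}. indicator {0} (Z 0 s \<omega>) \<partial>lborel) > 0)"

end

theory Submission
  imports Defs
begin

text \<open>
  Write \<open>L u = sup {(- z - X s)\<^sup>+ | s \<le> u}\<close>. Then \<open>z + X + L\<close> is the reflected path, the clock \<open>C\<close> is
  forced to be the inverse of \<open>\<tau> u = u + L u / \<gamma>\<close>, and \<open>Z = (z + X + L) \<circ> C\<close>. This pair solves the
  equation as soon as the reflected path spends no time at zero, which holds because, for every slope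
  \<open>c\<close>, the path \<open>X s + c s\<close> falls below its starting value at once: otherwise the disjoint stays above
  equally spaced passage levels would be too many, unless \<open>X s + c s\<close> never goes down, which
  unbounded variation excludes. Hence \<open>L\<close> has infinite upper derivative at almost every zero of the
  reflected path, and a monotone function has this on a null set only.

  For the strong Markov property, the clock at a stopping time of \<open>Z\<close> is an optional time of \<open>X\<close>; the
  flow property of the deterministic solution map then reduces the claim to the strong Markov property
  of \<open>X\<close>.
\<close>

section \<open>Paths and their running infimum\<close>

text \<open>The indicators make the equation discontinuous in \<open>Z\<close>, so contraction
  arguments do not apply. What replaces them: every solution is nonnegative, and \<gamma> times its
  time at zero is the minimal push that keeps it so. Absence of negative jumps enters twice here: a
  solution cannot jump over zero, and the running infimum is continuous, so that \<tau> is a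
  continuous increasing bijection of the half-line.

  The solution must be evaluated at random times, from random starting points and on the whole
  product space of paths, where few functionals are measurable. Hence \<open>depth\<close>,
  \<open>clock\<close> and \<open>sticky\<close> use countably many coordinates or limits of such
  expressions and make sense for every function; on good paths they are the running supremum of
  \<open>- x\<close>, the inverse of \<tau> and the time-changed reflected path.

  The law of the killed process needs a fact of its own: the infimum might attain the level -z only
  as a left limit, followed by a positive jump, and then \<open>z + X\<close> would not have reached
  zero although its infimum has. Almost surely this does not happen, which also makes the killed
  processes measurable functions of the infimum and the present value.\<close>

definition step_above :: "nat \<Rightarrow> real \<Rightarrow> real" where
  "step_above n s = (of_int \<lfloor>real (Suc n) * s\<rfloor> + 1) / real (Suc n)"

lemma step_above_bounds: "s < step_above n s" "step_above n s \<le> s + 1 / real (Suc n)"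
proof -
  have "real (Suc n) * s < of_int \<lfloor>real (Suc n) * s\<rfloor> + 1" by linarith
  then show "s < step_above n s"
    unfolding step_above_def by (simp add: pos_less_divide_eq mult.commute)
  have "of_int \<lfloor>real (Suc n) * s\<rfloor> + 1 \<le> real (Suc n) * (s + 1 / real (Suc n))"
    by (simp add: distrib_left)
  then show "step_above n s \<le> s + 1 / real (Suc n)"
    unfolding step_above_def by (simp add: pos_divide_le_eq mult.commute)
qed

text \<open>The grid point is strictly above \<open>s\<close> even if \<open>s\<close> lies on the
  grid itself, so the sequence stays in the punctured right neighbourhood and right continuity alone
  gives convergence along it. Since the grid is countable, evaluating a process at such a time is a
  countable case distinction.\<close>

lemma step_above_at_right: "filterlim (\<lambda>n. step_above n s) (at_right s) sequentially"
proof -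
  have "(\<lambda>n. s + 1 / real (Suc n)) \<longlonglongrightarrow> s + 0"
    using tendsto_add[OF tendsto_const[of s] LIMSEQ_inverse_real_of_nat]
    by (simp only: inverse_eq_divide)
  then have lim: "(\<lambda>n. s + 1 / real (Suc n)) \<longlonglongrightarrow> s" by simp
  have "(\<lambda>n. step_above n s) \<longlonglongrightarrow> s"
    by (rule tendsto_sandwich[OF _ _ tendsto_const lim])
      (auto intro!: always_eventually less_imp_le step_above_bounds simp del: of_nat_Suc)
  moreover have "step_above n s \<noteq> s" for n
    using step_above_bounds(1)[of s n] by simp
  ultimately show ?thesis
    unfolding filterlim_at by (auto simp: step_above_bounds)
qed

lemma right_continuous_step_above:
  assumes "continuous (at_right s) f"
  shows "(\<lambda>n. f (step_above n s)) \<longlonglongrightarrow> (f s :: real)"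
  using filterlim_compose[OF assms[unfolded continuous_within] step_above_at_right] .

lemma measurable_at_step_above:
  fixes Y :: "real \<Rightarrow> 'a \<Rightarrow> real"
  assumes Y: "\<And>s. 0 \<le> s \<Longrightarrow> Y s \<in> borel_measurable G"
    and \<sigma>: "\<sigma> \<in> borel_measurable G" "\<And>\<omega>. \<omega> \<in> space G \<Longrightarrow> 0 \<le> \<sigma> \<omega>"
  shows "(\<lambda>\<omega>. Y (step_above n (\<sigma> \<omega>)) \<omega>) \<in> borel_measurable G"
proof -
  note [measurable] = \<sigma>(1)
  let ?k = "\<lambda>\<omega>. nat \<lfloor>real (Suc n) * \<sigma> \<omega>\<rfloor>"
  have "(\<lambda>\<omega>. Y ((real (?k \<omega>) + 1) / real (Suc n)) \<omega>) \<in> borel_measurable G"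
  proof (rule measurable_compose_countable[where f = "\<lambda>k. Y ((real k + 1) / real (Suc n))"])
    show "Y ((real k + 1) / real (Suc n)) \<in> borel_measurable G" for k
      by (rule Y) simp
    show "?k \<in> G \<rightarrow>\<^sub>M count_space UNIV" by measurable
  qed
  moreover have "(real (?k \<omega>) + 1) / real (Suc n) = step_above n (\<sigma> \<omega>)" if "\<omega> \<in> space G" for \<omega>
    using \<sigma>(2)[OF that] by (simp add: step_above_def)
  ultimately show ?thesis
    by (subst (1) measurable_cong[where g = "\<lambda>\<omega>. Y ((real (?k \<omega>) + 1) / real (Suc n)) \<omega>"]) auto
qed

text \<open>\<open>G\<close> is left arbitrary because the lemma serves the ambient
  \<sigma>-algebra, a product with Lebesgue measure and single stages of filtrations. In the last
  case the process has to be stopped beforehand, since \<open>step_above\<close> looks slightly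
  ahead of \<sigma>.\<close>

lemma measurable_right_continuous_at:
  fixes Y :: "real \<Rightarrow> 'a \<Rightarrow> real"
  assumes Y: "\<And>s. 0 \<le> s \<Longrightarrow> Y s \<in> borel_measurable G"
    and rc: "\<And>s \<omega>. \<omega> \<in> space G \<Longrightarrow> 0 \<le> s \<Longrightarrow> continuous (at_right s) (\<lambda>s. Y s \<omega>)"
    and \<sigma>: "\<sigma> \<in> borel_measurable G" "\<And>\<omega>. \<omega> \<in> space G \<Longrightarrow> 0 \<le> \<sigma> \<omega>"
  shows "(\<lambda>\<omega>. Y (\<sigma> \<omega>) \<omega>) \<in> borel_measurable G"
proof (rule borel_measurable_LIMSEQ_real)
  show "(\<lambda>n. Y (step_above n (\<sigma> \<omega>)) \<omega>) \<longlonglongrightarrow> Y (\<sigma> \<omega>) \<omega>" if "\<omega> \<in> space G" for \<omega>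
    using right_continuous_step_above[OF rc[OF that \<sigma>(2)[OF that]]] .
  show "(\<lambda>\<omega>. Y (step_above n (\<sigma> \<omega>)) \<omega>) \<in> borel_measurable G" for n
    by (rule measurable_at_step_above) (use Y \<sigma> in auto)
qed

lemma tendsto_shift_right:
  fixes f :: "real \<Rightarrow> real"
  assumes "(f \<longlongrightarrow> l) (at_right (v + t))"
  shows "((\<lambda>s. f (v + s)) \<longlongrightarrow> l) (at_right t)"
proof -
  have "((\<lambda>s. v + s) \<longlongrightarrow> v + t) (at_right t)" by (intro tendsto_intros)
  moreover have "\<forall>\<^sub>F s in at_right t. v + s \<in> {v + t<..} \<and> v + s \<noteq> v + t"
    by (simp add: eventually_at_filter)
  ultimately have "filterlim (\<lambda>s. v + s) (at_right (v + t)) (at_right t)"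
    by (simp add: filterlim_at)
  then show ?thesis by (rule filterlim_compose[OF assms])
qed

lemma tendsto_shift_left:
  fixes f :: "real \<Rightarrow> real"
  assumes "(f \<longlongrightarrow> l) (at_left (v + t))"
  shows "((\<lambda>s. f (v + s)) \<longlongrightarrow> l) (at_left t)"
proof -
  have "((\<lambda>s. v + s) \<longlongrightarrow> v + t) (at_left t)" by (intro tendsto_intros)
  moreover have "\<forall>\<^sub>F s in at_left t. v + s \<in> {..<v + t} \<and> v + s \<noteq> v + t"
    by (simp add: eventually_at_filter)
  ultimately have "filterlim (\<lambda>s. v + s) (at_left (v + t)) (at_left t)"
    by (simp add: filterlim_at)
  then show ?thesis by (rule filterlim_compose[OF assms])
qed

definition good_path :: "(real \<Rightarrow> real) \<Rightarrow> bool" where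
  "good_path x \<longleftrightarrow> x 0 = 0 \<and> cadlag x \<and> no_negative_jumps x"

text \<open>The running supremum of \<open>- x\<close>, taken over rational times so that it depends
  on countably many coordinates. The default 0 agrees with the value at time 0 of a path that starts
  at 0, and the detour through \<open>ereal\<close> gives a meaning to the supremum for arbitrary
  functions.\<close>

definition depth :: "(real \<Rightarrow> real) \<Rightarrow> real \<Rightarrow> real" where
  "depth x u = real_of_ereal (SUP q\<in>\<rat>. if 0 \<le> q \<and> q \<le> u then ereal (- x q) else 0)"

text \<open>The inverse of u + max 0 (depth x u - y) / \<gamma>, again as a supremum over rationals.
  The test \<open>q \<le> t\<close> bounds the set for every function \<open>x\<close>, so that the
  supremum is measurable on the whole path space.\<close>

definition clock :: "real \<Rightarrow> real \<Rightarrow> (real \<Rightarrow> real) \<Rightarrow> real \<Rightarrow> real" where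
  "clock \<gamma> y x t =
    (SUP q\<in>\<rat>. if 0 \<le> q \<and> q \<le> t \<and> q + max 0 (depth x q - y) / \<gamma> \<le> t then q else 0)"

text \<open>Evaluating a path at a path-dependent time is not a measurable operation on the product
  space. The limit along the grid from the right is, and on right-continuous paths it equals
  \<open>x (clock \<gamma> y x t)\<close>.\<close>

definition sticky :: "real \<Rightarrow> real \<Rightarrow> (real \<Rightarrow> real) \<Rightarrow> real \<Rightarrow> real" where
  "sticky \<gamma> y x t = y + lim (\<lambda>n. x (step_above n (clock \<gamma> y x t)))
    + max 0 (depth x (clock \<gamma> y x t) - y)"

context
  fixes x :: "real \<Rightarrow> real"
  assumes good: "good_path x"
begin

lemma good_path_0: "x 0 = 0"
  using good by (simp add: good_path_def)

lemma good_path_right_continuous: "0 \<le> s \<Longrightarrow> continuous (at_right s) x"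
  using good by (simp add: good_path_def cadlag_def)

lemma good_path_right:
  assumes "0 \<le> s" "0 < e"
  obtains b where "s < b" "\<And>r. s < r \<Longrightarrow> r < b \<Longrightarrow> \<bar>x r - x s\<bar> < e"
proof -
  have "(x \<longlongrightarrow> x s) (at_right s)"
    using good_path_right_continuous[OF assms(1)] by (simp add: continuous_within)
  then have "\<forall>\<^sub>F r in at_right s. dist (x r) (x s) < e"
    using assms(2) by (rule tendstoD)
  then show ?thesis
    using that unfolding eventually_at_right_field dist_real_def by blast
qed

lemma good_path_left_limit:
  assumes "0 < s"
  obtains l where "l \<le> x s" "(x \<longlongrightarrow> l) (at_left s)"
  using good assms unfolding good_path_def cadlag_def no_negative_jumps_def by blast

lemma good_path_left_limitE:
  assumes "0 < s"
  obtains l where "l \<le> x s"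
    "\<forall>e>0. \<exists>b. 0 \<le> b \<and> b < s \<and> (\<forall>r. b < r \<and> r < s \<longrightarrow> \<bar>x r - l\<bar> < e)"
proof -
  obtain l where l: "l \<le> x s" "(x \<longlongrightarrow> l) (at_left s)"
    using good_path_left_limit[OF assms] .
  have "\<exists>b. 0 \<le> b \<and> b < s \<and> (\<forall>r. b < r \<and> r < s \<longrightarrow> \<bar>x r - l\<bar> < e)" if "0 < e" for e
  proof -
    have "\<forall>\<^sub>F r in at_left s. dist (x r) l < e"
      using l(2) that by (rule tendstoD)
    then obtain b where b: "b < s" "\<And>r. b < r \<Longrightarrow> r < s \<Longrightarrow> dist (x r) l < e"
      unfolding eventually_at_left_field by blast
    show ?thesis
      by (rule exI[of _ "max 0 b"]) (use b assms in \<open>simp add: dist_real_def\<close>)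
  qed
  then show ?thesis using that[OF l(1)] by simp
qed

lemma good_path_left:
  assumes "0 < s" "0 < e"
  obtains b where "0 \<le> b" "b < s" "\<And>r. b < r \<Longrightarrow> r < s \<Longrightarrow> x r < x s + e"
proof -
  obtain l where l: "l \<le> x s"
    "\<forall>e>0. \<exists>b. 0 \<le> b \<and> b < s \<and> (\<forall>r. b < r \<and> r < s \<longrightarrow> \<bar>x r - l\<bar> < e)"
    using good_path_left_limitE[OF assms(1)] .
  from l(2) assms(2) obtain b where "0 \<le> b" "b < s" "\<forall>r. b < r \<and> r < s \<longrightarrow> \<bar>x r - l\<bar> < e"
    by blast
  moreover have "x r < x s + e" if "b < r" "r < s" for r
  proof -
    have "\<bar>x r - l\<bar> < e" using calculation that by blast
    with l(1) show ?thesis by linarith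
  qed
  ultimately show ?thesis using that by blast
qed

text \<open>Near each point the path stays within 1 of its value on the right and within 1 of its
  left limit on the left; bisection glues these local bounds. The point is the finiteness of the
  supremum in \<open>depth\<close>.\<close>

lemma good_path_bounded:
  assumes "0 \<le> u"
  shows "\<exists>K. \<forall>s\<in>{0..u}. \<bar>x s\<bar> \<le> K"
proof -
  define P where "P a b \<longleftrightarrow> (\<exists>K. \<forall>s\<in>{a..b} \<inter> {0..}. \<bar>x s\<bar> \<le> K)" for a b
  have "P 0 u"
  proof (rule Bolzano[OF assms])
    fix a b c assume P: "P a b" "P b c"
    then obtain K1 K2 where "\<forall>s\<in>{a..b} \<inter> {0..}. \<bar>x s\<bar> \<le> K1" "\<forall>s\<in>{b..c} \<inter> {0..}. \<bar>x s\<bar> \<le> K2"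
      unfolding P_def by blast
    then have "\<bar>x s\<bar> \<le> max K1 K2" if "s \<in> {a..c} \<inter> {0..}" for s
      using that by (cases "s \<le> b") (auto simp: le_max_iff_disj)
    then show "P a c" unfolding P_def by blast
  next
    fix s assume s: "0 \<le> s" "s \<le> u"
    obtain b where b: "s < b" "\<And>r. s < r \<Longrightarrow> r < b \<Longrightarrow> \<bar>x r - x s\<bar> < 1"
      using good_path_right[of s 1] s by auto
    have "\<exists>a l. a < s \<and> (\<forall>r. a < r \<longrightarrow> r < s \<longrightarrow> 0 \<le> r \<longrightarrow> \<bar>x r - l\<bar> < 1)"
    proof (cases "s = 0")
      case True then show ?thesis by (intro exI[of _ "-1"]) auto
    next
      case False
      with s have "0 < s" by simp
      then obtain l where "l \<le> x s"
        "\<forall>e>0. \<exists>b. 0 \<le> b \<and> b < s \<and> (\<forall>r. b < r \<and> r < s \<longrightarrow> \<bar>x r - l\<bar> < e)"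
        by (rule good_path_left_limitE)
      then have "\<exists>b. 0 \<le> b \<and> b < s \<and> (\<forall>r. b < r \<and> r < s \<longrightarrow> \<bar>x r - l\<bar> < 1)"
        using zero_less_one by metis
      then show ?thesis by metis
    qed
    then obtain a l where a: "a < s" "\<And>r. a < r \<Longrightarrow> r < s \<Longrightarrow> 0 \<le> r \<Longrightarrow> \<bar>x r - l\<bar> < 1"
      by blast
    have "P a' b'" if "a' \<le> s" "s \<le> b'" "b' - a' < min (b - s) (s - a)" for a' b'
      unfolding P_def
    proof (intro exI ballI)
      fix r assume r: "r \<in> {a'..b'} \<inter> {0..}"
      consider "r < s" | "r = s" | "r > s" by linarith
      then show "\<bar>x r\<bar> \<le> max \<bar>x s\<bar> \<bar>l\<bar> + 1"
      proof cases
        case 1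
        then have "\<bar>x r - l\<bar> < 1" using a(2)[of r] that r by simp
        then show ?thesis by linarith
      next
        case 3
        then have "\<bar>x r - x s\<bar> < 1" using b(2)[of r] that r by simp
        then show ?thesis by linarith
      qed auto
    qed
    moreover have "0 < min (b - s) (s - a)" using a b by simp
    ultimately show "\<exists>d>0. \<forall>a b. a \<le> s \<and> s \<le> b \<and> b - a < d \<longrightarrow> P a b" by blast
  qed
  then show ?thesis unfolding P_def by auto
qed


lemma ereal_depth:
  assumes "0 \<le> u"
  shows "(SUP q\<in>\<rat>. if 0 \<le> q \<and> q \<le> u then ereal (- x q) else 0) = ereal (depth x u)"
proof -
  let ?S = "SUP q\<in>\<rat>. if 0 \<le> q \<and> q \<le> u then ereal (- x q) else 0"
  obtain K where K: "\<And>s. s \<in> {0..u} \<Longrightarrow> \<bar>x s\<bar> \<le> K"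
    using good_path_bounded[OF assms] by blast
  have "0 \<le> K" using K[of 0] assms by simp
  then have "?S \<le> ereal K"
    using K by (intro SUP_least) (auto simp: abs_le_iff)
  moreover have "ereal (- x 0) \<le> ?S"
    by (intro SUP_upper2[of 0]) (use assms in auto)
  ultimately have "\<bar>?S\<bar> \<noteq> \<infinity>" by auto
  then show ?thesis by (simp add: depth_def ereal_real)
qed

lemma depth_least:
  assumes "0 \<le> u" "\<And>s. s \<in> \<rat> \<Longrightarrow> 0 \<le> s \<Longrightarrow> s \<le> u \<Longrightarrow> - x s \<le> K"
  shows "depth x u \<le> K"
proof -
  have "0 \<le> K" using assms(2)[of 0] assms(1) by (simp add: good_path_0)
  have "ereal (depth x u) \<le> ereal K"
    unfolding ereal_depth[OF assms(1), symmetric]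
    using assms(2) \<open>0 \<le> K\<close> by (intro SUP_least) auto
  then show ?thesis by simp
qed

lemma depth_upper_Rats:
  assumes "s \<in> \<rat>" "0 \<le> s" "s \<le> u"
  shows "- x s \<le> depth x u"
proof -
  have "ereal (- x s) \<le> ereal (depth x u)"
    unfolding ereal_depth[OF order_trans[OF assms(2,3)], symmetric]
    by (intro SUP_upper2[OF assms(1)]) (use assms in auto)
  then show ?thesis by simp
qed

text \<open>From rational to all times. For s < u right continuity supplies a rational time just
  after \<open>s\<close>. For s = u only times before \<open>s\<close> are available, and there the
  path is at most \<open>x s + e\<close> because it has no negative jump.\<close>

lemma depth_upper:
  assumes "0 \<le> s" "s \<le> u"
  shows "- x s \<le> depth x u"
proof (rule ccontr)
  assume *: "\<not> ?thesis"
  show False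
  proof (cases "s < u")
    case True
    obtain b where b: "s < b" "\<And>r. s < r \<Longrightarrow> r < b \<Longrightarrow> \<bar>x r - x s\<bar> < - x s - depth x u"
      using good_path_right[OF assms(1), of "- x s - depth x u"] * by auto
    obtain r where r: "r \<in> \<rat>" "s < r" "r < min b u"
      using Rats_dense_in_real[of s "min b u"] b True by auto
    have "- x r \<le> depth x u" using r assms by (intro depth_upper_Rats) auto
    with b(2)[of r] r show False by auto
  next
    case False
    show False
    proof (cases "s = 0")
      case True
      with depth_upper_Rats[of 0 u] * assms show False by auto
    next
      case s: False
      obtain b where b: "0 \<le> b" "b < s"
        "\<And>r. b < r \<Longrightarrow> r < s \<Longrightarrow> x r < x s + (- x s - depth x u)"
        using good_path_left[of s "- x s - depth x u"] * assms s by auto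
      obtain r where r: "r \<in> \<rat>" "b < r" "r < s"
        using Rats_dense_in_real[of b s] b by auto
      have "- x r \<le> depth x u" using r assms b by (intro depth_upper_Rats) auto
      with b(3)[of r] r show False by auto
    qed
  qed
qed

lemma depth_nonneg: "0 \<le> u \<Longrightarrow> 0 \<le> depth x u"
  using depth_upper[of 0 u] by (simp add: good_path_0)

lemma depth_mono:
  assumes "0 \<le> u" "u \<le> v" shows "depth x u \<le> depth x v"
  using assms by (intro depth_least) (auto intro: depth_upper)

lemma depth_0: "depth x 0 = 0"
proof (rule antisym)
  show "depth x 0 \<le> 0"
    by (rule depth_least) (auto simp: good_path_0 dest: antisym)
qed (simp add: depth_nonneg)

lemma depth_right:
  assumes "0 \<le> u" "0 < e"
  obtains b where "u < b" "depth x b \<le> depth x u + e"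
proof -
  obtain b where b: "u < b" "\<And>r. u < r \<Longrightarrow> r < b \<Longrightarrow> \<bar>x r - x u\<bar> < e"
    using good_path_right[OF assms] by blast
  have "- x r \<le> depth x u + e" if "0 \<le> r" "r \<le> (u + b) / 2" for r
  proof (cases "r \<le> u")
    case True
    then show ?thesis using depth_upper[OF that(1) True] assms by simp
  next
    case False
    then have "\<bar>x r - x u\<bar> < e" using that b by (intro b(2)) auto
    moreover have "- x u \<le> depth x u" using assms depth_upper by simp
    ultimately show ?thesis by linarith
  qed
  then have "depth x ((u + b) / 2) \<le> depth x u + e"
    using assms b by (intro depth_least) auto
  then show ?thesis using b by (intro that[of "(u + b) / 2"]) auto
qed

text \<open>Here a negative jump would do harm. A nearly optimal time either lies strictly before
  \<open>u\<close>, or it is \<open>u\<close> itself, and then times just before \<open>u\<close>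
  are nearly as good since the left limit is at most \<open>x u\<close>.\<close>

lemma depth_left:
  assumes "0 < u" "0 < e"
  obtains b where "0 \<le> b" "b < u" "depth x u \<le> depth x b + e"
proof -
  obtain q where q: "0 \<le> q" "q \<le> u" "depth x u - e / 2 < - x q"
    using depth_least[of u "depth x u - e / 2"] assms by (force simp: not_le)
  show ?thesis
  proof (cases "q < u")
    case True
    then show ?thesis
      using q assms depth_upper[of q q] by (intro that[of q]) auto
  next
    case False
    obtain b where b: "0 \<le> b" "b < u" "\<And>r. b < r \<Longrightarrow> r < u \<Longrightarrow> x r < x u + e / 2"
      using good_path_left[OF assms(1), of "e / 2"] assms by auto
    let ?r = "(b + u) / 2"
    have "x ?r < x u + e / 2" using b by (intro b(3)) auto
    moreover have "- x ?r \<le> depth x ?r" using b by (intro depth_upper) auto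
    moreover have "depth x u - e / 2 < - x u" using False q by simp
    ultimately have "depth x u \<le> depth x ?r + e" by linarith
    then show ?thesis using b by (intro that[of ?r]) auto
  qed
qed

lemma depth_continuous: "continuous_on {0..} (depth x)"
  unfolding continuous_on_iff
proof (intro ballI allI impI)
  fix u e :: real assume u: "u \<in> {0..}" and e: "0 < e"
  obtain b where b: "u < b" "depth x b \<le> depth x u + e / 2"
    using depth_right[of u "e / 2"] u e by auto
  obtain a where a: "a < u" "\<And>v. a < v \<Longrightarrow> 0 \<le> v \<Longrightarrow> depth x u \<le> depth x v + e / 2"
  proof (cases "u = 0")
    case True
    then show ?thesis using e by (intro that[of "-1"]) (auto simp: depth_0 depth_nonneg)
  next
    case False
    then obtain a where "0 \<le> a" "a < u" "depth x u \<le> depth x a + e / 2"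
      using depth_left[of u "e / 2"] u e by auto
    then show ?thesis
      using depth_mono[of a] by (intro that[of a]) (auto intro: order_trans)
  qed
  show "\<exists>d>0. \<forall>v\<in>{0..}. dist v u < d \<longrightarrow> dist (depth x v) (depth x u) < e"
  proof (intro exI[of _ "min (b - u) (u - a)"] conjI ballI impI)
    show "0 < min (b - u) (u - a)" using a b by simp
    fix v assume v: "v \<in> {0..}" "dist v u < min (b - u) (u - a)"
    then have "a < v" "v < b" by (auto simp: dist_real_def abs_less_iff)
    then have "depth x u \<le> depth x v + e / 2" "depth x v \<le> depth x b"
      using a(2)[of v] v depth_mono[of v b] by auto
    then show "dist (depth x v) (depth x u) < e"
      using b(2) e unfolding dist_real_def by linarith
  qed
qed

text \<open>Where the path is strictly above its running infimum, right continuity keeps it there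
  for a while. So the infimum can start to move only at times at which the path sits on it.\<close>

lemma depth_const_right:
  assumes "0 \<le> u" "- x u < depth x u"
  obtains b where "u < b" "depth x b = depth x u"
proof -
  obtain b where b: "u < b" "\<And>r. u < r \<Longrightarrow> r < b \<Longrightarrow> \<bar>x r - x u\<bar> < depth x u + x u"
    using good_path_right[of u "depth x u + x u"] assms by auto
  have "- x r \<le> depth x u" if "0 \<le> r" "r \<le> (u + b) / 2" for r
  proof (cases "r \<le> u")
    case True
    then show ?thesis using depth_upper[OF that(1) True] by simp
  next
    case False
    then have "\<bar>x r - x u\<bar> < depth x u + x u" using that b by (intro b(2)) auto
    then show ?thesis by linarith
  qed
  then have "depth x ((u + b) / 2) \<le> depth x u"
    using assms b by (intro depth_least) auto
  moreover have "depth x u \<le> depth x ((u + b) / 2)"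
    using assms b by (intro depth_mono) auto
  ultimately show ?thesis using b by (intro that[of "(u + b) / 2"]) auto
qed

lemma good_path_shift:
  assumes "0 \<le> v"
  shows "good_path (\<lambda>s. x (v + s) - x v)"
  unfolding good_path_def cadlag_def no_negative_jumps_def
proof (intro conjI allI impI)
  fix t :: real assume t: "0 \<le> t"
  have "(x \<longlongrightarrow> x (v + t)) (at_right (v + t))"
    using good_path_right_continuous[of "v + t"] assms t by (simp add: continuous_within)
  then show "continuous (at_right t) (\<lambda>s. x (v + s) - x v)"
    unfolding continuous_within
    by (intro tendsto_diff tendsto_const tendsto_shift_right)
next
  fix t :: real assume t: "0 < t"
  obtain l where l: "l \<le> x (v + t)" "(x \<longlongrightarrow> l) (at_left (v + t))"
    using good_path_left_limit[of "v + t"] assms t by auto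
  have *: "((\<lambda>s. x (v + s)) \<longlongrightarrow> l) (at_left t)"
    using l(2) by (rule tendsto_shift_left)
  then have "((\<lambda>s. x (v + s) - x v) \<longlongrightarrow> l - x v) (at_left t)"
    by (intro tendsto_diff tendsto_const)
  then show "\<exists>l. ((\<lambda>s. x (v + s) - x v) \<longlongrightarrow> l) (at_left t)" by blast
  fix l' assume "((\<lambda>s. x (v + s) - x v) \<longlongrightarrow> l') (at_left t)"
  then have "l' = l - x v"
    using \<open>((\<lambda>s. x (v + s) - x v) \<longlongrightarrow> l - x v) (at_left t)\<close>
    by (intro tendsto_unique) (auto simp: trivial_limit_at_left_real)
  with l(1) show "l' \<le> x (v + t) - x v" by simp
qed simp

end

text \<open>The supremum of \<open>- x\<close> over [0, v + u] splits at \<open>v\<close>. This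
  identity drives both the flow property of the solution and the gap between successive passage
  times.\<close>

lemma depth_shift:
  assumes good: "good_path x" and "0 \<le> v" "0 \<le> u"
  shows "depth x (v + u) = max (depth x v) (depth (\<lambda>s. x (v + s) - x v) u - x v)"
    (is "_ = max _ (depth ?x' u - _)")
proof (rule antisym)
  have x': "good_path ?x'" using assms(2) by (rule good_path_shift[OF good])
  show "depth x (v + u) \<le> max (depth x v) (depth ?x' u - x v)"
  proof (rule depth_least[OF good])
    fix s assume s: "0 \<le> s" "s \<le> v + u"
    show "- x s \<le> max (depth x v) (depth ?x' u - x v)"
    proof (cases "s \<le> v")
      case True
      then show ?thesis using depth_upper[OF good s(1) True] by simp
    next
      case False
      then show ?thesis
        using depth_upper[OF x', of "s - v" u] assms s by simp
    qed
  qed (use assms in simp)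
  have "depth ?x' u \<le> depth x (v + u) + x v"
  proof (rule depth_least[OF x' assms(3)])
    fix s assume "0 \<le> s" "s \<le> u"
    then have "- x (v + s) \<le> depth x (v + u)"
      using assms by (intro depth_upper) auto
    then show "- (x (v + s) - x v) \<le> depth x (v + u) + x v" by simp
  qed
  moreover have "depth x v \<le> depth x (v + u)" using assms by (intro depth_mono[OF good]) auto
  ultimately show "max (depth x v) (depth ?x' u - x v) \<le> depth x (v + u)" by simp
qed

section \<open>The explicit solution along a path\<close>

locale sticky_path =
  fixes x :: "real \<Rightarrow> real" and \<gamma> y :: real
  assumes good: "good_path x" and \<gamma>: "0 < \<gamma>" and y: "0 \<le> y"
begin

abbreviation "C \<equiv> clock \<gamma> y x"
abbreviation "Z \<equiv> sticky \<gamma> y x"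

definition push :: "real \<Rightarrow> real" where
  "push u = max 0 (depth x u - y)"

definition reflected :: "real \<Rightarrow> real" where
  "reflected u = y + x u + push u"

definition \<tau> :: "real \<Rightarrow> real" where
  "\<tau> u = u + push u / \<gamma>"

lemma push_mono: "0 \<le> u \<Longrightarrow> u \<le> v \<Longrightarrow> push u \<le> push v"
  using depth_mono[OF good, of u v] by (auto simp: push_def max_def)

lemma push_continuous: "continuous_on {0..} push"
  unfolding push_def by (intro continuous_intros depth_continuous[OF good])

lemma \<tau>_0: "\<tau> 0 = 0"
  using y by (simp add: \<tau>_def push_def depth_0[OF good])

lemma \<tau>_diff: "0 \<le> u \<Longrightarrow> u \<le> v \<Longrightarrow> v - u \<le> \<tau> v - \<tau> u"
  using push_mono[of u v] \<gamma> by (simp add: \<tau>_def divide_right_mono)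

lemma \<tau>_less: "0 \<le> u \<Longrightarrow> u < v \<Longrightarrow> \<tau> u < \<tau> v"
  using \<tau>_diff[of u v] by simp

lemma \<tau>_le_iff: "0 \<le> u \<Longrightarrow> 0 \<le> v \<Longrightarrow> \<tau> u \<le> \<tau> v \<longleftrightarrow> u \<le> v"
  using \<tau>_less[of u v] \<tau>_less[of v u] by (cases u v rule: linorder_cases) auto

lemma \<tau>_ge: "0 \<le> u \<Longrightarrow> u \<le> \<tau> u"
  using \<tau>_diff[of 0 u] by (simp add: \<tau>_0)

lemma \<tau>_continuous: "continuous_on {0..} \<tau>"
  unfolding \<tau>_def using \<gamma> by (intro continuous_intros push_continuous) auto

text \<open>As \<tau> is strictly increasing and dominates the identity, the rationals passing the
  test in \<open>clock\<close> are those in [0, u], and their supremum is \<open>u\<close> by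
  density. From here on the path arguments use the clock only as the inverse of \<tau>.\<close>

lemma clock_eqI:
  assumes "0 \<le> u" "\<tau> u = t"
  shows "C t = u"
proof -
  let ?f = "\<lambda>q. if 0 \<le> q \<and> q \<le> t \<and> q + max 0 (depth x q - y) / \<gamma> \<le> t then q else 0"
  have *: "?f q = (if 0 \<le> q \<and> q \<le> u then q else 0)" for q
  proof -
    have "0 \<le> q \<and> q \<le> t \<and> \<tau> q \<le> t \<longleftrightarrow> 0 \<le> q \<and> q \<le> u"
      using assms \<tau>_le_iff[of q u] \<tau>_ge[of q] by auto
    then show ?thesis by (simp add: \<tau>_def push_def)
  qed
  have "C t = (SUP q\<in>\<rat>. if 0 \<le> q \<and> q \<le> u then q else 0)"
    unfolding clock_def * ..
  also have "\<dots> = u"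
  proof (rule cSup_eq_non_empty)
    fix v assume v: "\<And>q. q \<in> (\<lambda>q. if 0 \<le> q \<and> q \<le> u then q else 0) ` \<rat> \<Longrightarrow> q \<le> v"
    show "u \<le> v"
    proof (rule ccontr)
      assume "\<not> u \<le> v"
      moreover have "0 \<le> v" using v[of 0] by (force simp: image_iff)
      ultimately obtain q where q: "q \<in> \<rat>" "v < q" "q < u"
        using Rats_dense_in_real[of v u] by auto
      have "q \<le> v" by (rule v) (use q \<open>0 \<le> v\<close> in \<open>auto simp: image_iff intro!: bexI[of _ q]\<close>)
      with q show False by simp
    qed
  qed (use assms in auto)
  finally show ?thesis .
qed

lemma \<tau>_surj:
  assumes "0 \<le> t"
  obtains u where "0 \<le> u" "u \<le> t" "\<tau> u = t"
proof -
  have "\<exists>u. 0 \<le> u \<and> u \<le> t \<and> \<tau> u = t"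
    using assms \<tau>_ge[OF assms]
    by (intro IVT') (auto simp: \<tau>_0 intro: continuous_on_subset[OF \<tau>_continuous])
  then show ?thesis using that by blast
qed

lemma clock_bounds: "0 \<le> t \<Longrightarrow> 0 \<le> C t" "0 \<le> t \<Longrightarrow> C t \<le> t"
  and \<tau>_clock: "0 \<le> t \<Longrightarrow> \<tau> (C t) = t"
  using \<tau>_surj clock_eqI by metis+

lemma clock_\<tau>: "0 \<le> u \<Longrightarrow> C (\<tau> u) = u"
  by (rule clock_eqI) auto

lemma clock_le_iff: "0 \<le> t \<Longrightarrow> 0 \<le> u \<Longrightarrow> C t \<le> u \<longleftrightarrow> t \<le> \<tau> u"
  using \<tau>_le_iff[of "C t" u] \<tau>_clock[of t] clock_bounds[of t] by simp

lemma clock_less_iff: "0 \<le> t \<Longrightarrow> 0 \<le> u \<Longrightarrow> C t < u \<longleftrightarrow> t < \<tau> u"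
  using \<tau>_le_iff[of u "C t"] \<tau>_clock[of t] clock_bounds[of t] by (simp add: not_le[symmetric])

lemma clock_mono: "0 \<le> s \<Longrightarrow> s \<le> t \<Longrightarrow> C s \<le> C t"
  using clock_le_iff[of s "C t"] \<tau>_clock[of t] clock_bounds[of t] by simp

lemma clock_less: "0 \<le> s \<Longrightarrow> s < t \<Longrightarrow> C s < C t"
  using clock_less_iff[of s "C t"] \<tau>_clock[of t] clock_bounds[of t] by simp

lemma clock_diff: "0 \<le> s \<Longrightarrow> s \<le> t \<Longrightarrow> C t - C s \<le> t - s"
  using \<tau>_diff[of "C s" "C t"] \<tau>_clock clock_bounds clock_mono by simp

lemma clock_continuous: "continuous_on {0..} C"
proof -
  have "1-lipschitz_on {0..} C"
  proof (rule lipschitz_onI)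
    show "dist (C s) (C t) \<le> 1 * dist s t" if "s \<in> {0..}" "t \<in> {0..}" for s t
      using clock_diff[of s t] clock_diff[of t s] clock_mono[of s t] clock_mono[of t s] that
      by (cases "s \<le> t") (auto simp: dist_real_def abs_if)
  qed simp
  then show ?thesis by (rule lipschitz_on_continuous_on)
qed

lemma clock_0: "C 0 = 0"
  by (rule clock_eqI) (auto simp: \<tau>_0)

lemma clock_pos: "0 < t \<Longrightarrow> 0 < C t"
  using clock_less[of 0 t] by (simp add: clock_0)

text \<open>A rewriting of \<open>\<tau> (C t) = t\<close>: the push accumulated at time
  \<open>C t\<close> is \<gamma> times the remaining time \<open>t - C t\<close>. The equation then
  holds as soon as this remainder is the time spent at zero.\<close>

lemma push_clock: "0 \<le> t \<Longrightarrow> push (C t) = \<gamma> * (t - C t)"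
  using \<tau>_clock[of t] \<gamma> by (simp add: \<tau>_def field_simps)

lemma sticky_eq: "0 \<le> t \<Longrightarrow> Z t = reflected (C t)"
  using limI[OF right_continuous_step_above[OF good_path_right_continuous[OF good clock_bounds(1)]]]
  by (simp add: sticky_def reflected_def push_def)

lemma sticky_eq': "0 \<le> t \<Longrightarrow> Z t = y + x (C t) + \<gamma> * (t - C t)"
  using push_clock[of t] by (simp add: sticky_eq reflected_def)

lemma reflected_nonneg: "0 \<le> u \<Longrightarrow> 0 \<le> reflected u"
  using depth_upper[OF good, of u u] by (simp add: reflected_def push_def)

lemma sticky_nonneg: "0 \<le> t \<Longrightarrow> 0 \<le> Z t"
  by (simp add: sticky_eq reflected_nonneg clock_bounds)

lemma reflected_right_continuous:
  assumes "0 \<le> u" shows "continuous (at_right u) reflected"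
proof -
  have "continuous (at u within {0..}) push"
    using push_continuous assms by (simp add: continuous_on_eq_continuous_within)
  then have "continuous (at_right u) push"
    by (rule continuous_within_subset) (use assms in auto)
  then show ?thesis
    unfolding reflected_def
    by (intro continuous_intros good_path_right_continuous[OF good assms])
qed

text \<open>Strict monotonicity, not only continuity, is what counts: one-sided neighbourhoods of
  \<open>t\<close> are mapped into one-sided neighbourhoods of \<open>C t\<close>, so the one-sided
  limits of the reflected path carry over to \<open>Z\<close>.\<close>

lemma clock_at_right:
  assumes "0 \<le> t" shows "filterlim C (at_right (C t)) (at_right t)"
proof -
  have "continuous (at t within {0..}) C"
    using clock_continuous assms by (simp add: continuous_on_eq_continuous_within)
  then have "continuous (at_right t) C"
    by (rule continuous_within_subset) (use assms in auto)
  then have "(C \<longlongrightarrow> C t) (at_right t)" by (simp add: continuous_within)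
  moreover have "\<forall>\<^sub>F s in at_right t. C s \<in> {C t<..} \<and> C s \<noteq> C t"
    using eventually_at_right_less[of t]
  proof eventually_elim
    case (elim s)
    then show ?case using clock_less[OF assms, of s] by simp
  qed
  ultimately show ?thesis by (simp add: filterlim_at)
qed

lemma clock_at_left:
  assumes "0 < t" shows "filterlim C (at_left (C t)) (at_left t)"
proof -
  have "isCont C t"
    using continuous_on_interior[OF clock_continuous, of t] assms by simp
  then have "(C \<longlongrightarrow> C t) (at_left t)"
    by (simp add: continuous_at filterlim_at_split)
  moreover have "\<forall>\<^sub>F s in at_left t. C s \<in> {..<C t} \<and> C s \<noteq> C t"
    unfolding eventually_at_left_field
  proof (intro exI[of _ 0] conjI allI impI)
    fix s assume "0 < s" "s < t"
    then have "C s < C t" by (intro clock_less) auto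
    then show "C s \<in> {..<C t}" "C s \<noteq> C t" by auto
  qed (fact assms)
  ultimately show ?thesis by (simp add: filterlim_at)
qed

lemma sticky_right_continuous:
  assumes "0 \<le> t" shows "continuous (at_right t) Z"
proof -
  have "((\<lambda>s. reflected (C s)) \<longlongrightarrow> reflected (C t)) (at_right t)"
    using reflected_right_continuous[OF clock_bounds(1)[OF assms]] clock_at_right[OF assms]
    unfolding continuous_within by (rule filterlim_compose)
  moreover have "\<forall>\<^sub>F s in at_right t. reflected (C s) = Z s"
    using assms by (auto simp: eventually_at_filter sticky_eq intro: always_eventually)
  ultimately have "(Z \<longlongrightarrow> reflected (C t)) (at_right t)"
    using tendsto_cong by fast
  then show ?thesis using assms by (simp add: continuous_within sticky_eq)
qed

lemma cadlag_sticky: "cadlag Z"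
  unfolding cadlag_def
proof (intro conjI allI impI sticky_right_continuous)
  fix t :: real assume t: "0 < t"
  obtain l where l: "(x \<longlongrightarrow> l) (at_left (C t))"
    using good_path_left_limit[OF good clock_pos[OF t]] .
  have "isCont push (C t)"
    using continuous_on_interior[OF push_continuous, of "C t"] clock_pos[OF t] by simp
  then have "(push \<longlongrightarrow> push (C t)) (at_left (C t))"
    by (simp add: continuous_at filterlim_at_split)
  with l have "(reflected \<longlongrightarrow> y + l + push (C t)) (at_left (C t))"
    unfolding reflected_def by (intro tendsto_intros)
  then have "((\<lambda>s. reflected (C s)) \<longlongrightarrow> y + l + push (C t)) (at_left t)"
    using clock_at_left[OF t] by (rule filterlim_compose)
  moreover have "\<forall>\<^sub>F s in at_left t. reflected (C s) = Z s"
    unfolding eventually_at_left_field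
    by (rule exI[of _ 0]) (use t in \<open>auto simp: sticky_eq\<close>)
  ultimately have "(Z \<longlongrightarrow> y + l + push (C t)) (at_left t)"
    using tendsto_cong by fast
  then show "\<exists>l. (Z \<longlongrightarrow> l) (at_left t)" by blast
qed

end

text \<open>The solution restarts itself: after time \<open>T\<close> it is the solution driven by
  the increments of \<open>x\<close> after \<open>C T\<close> (not after \<open>T\<close>), started
  at \<open>Z T\<close>. This turns the strong Markov property of \<open>Z\<close> into one of
  \<open>X\<close>, because the past enters only through \<open>Z T\<close>.\<close>

lemma sticky_flow:
  assumes "good_path x" "0 < \<gamma>" "0 \<le> y" "0 \<le> T" "0 \<le> t"
  shows "sticky \<gamma> y x (T + t) =
    sticky \<gamma> (sticky \<gamma> y x T) (\<lambda>s. x (clock \<gamma> y x T + s) - x (clock \<gamma> y x T)) t"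
proof -
  interpret sticky_path x \<gamma> y by unfold_locales (use assms in auto)
  define v where "v = C T"
  define x' where "x' s = x (v + s) - x v" for s
  have v: "0 \<le> v" using assms by (simp add: v_def clock_bounds)
  define z where "z = Z T"
  interpret S: sticky_path x' \<gamma> z
    by unfold_locales (use good_path_shift[OF good v] \<gamma> sticky_nonneg[OF assms(4)] in
      \<open>simp_all add: x'_def[abs_def] z_def\<close>)
  have z: "z = y + x v + push v" using assms by (simp add: sticky_eq z_def v_def reflected_def)
  \<comment> \<open>With d the depth of the shifted path, max 0 (max (depth x v) (d - x v) - y) is
    the larger of \<open>push v\<close> and d - x v - y, that is \<open>push v\<close> plus the
    positive part of d - z. So the push is additive, and with it \<tau>.\<close>
  have push: "push (v + u) = push v + S.push u" if "0 \<le> u" for u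
    using depth_shift[OF good v that, folded x'_def]
    unfolding S.push_def unfolding z push_def by (auto simp: max_def)
  have \<tau>: "\<tau> (v + u) = T + S.\<tau> u" if "0 \<le> u" for u
    using \<tau>_clock[OF assms(4)] push[OF that]
    by (simp add: \<tau>_def S.\<tau>_def v_def add_divide_distrib)
  have C: "C (T + t) = v + S.C t"
    using \<tau>[OF S.clock_bounds(1)[OF assms(5)]] S.\<tau>_clock[OF assms(5)] S.clock_bounds(1)[OF assms(5)] v
    by (intro clock_eqI) auto
  have "Z (T + t) = y + x (v + S.C t) + push (v + S.C t)"
    using assms by (simp add: sticky_eq reflected_def C)
  also have "\<dots> = z + x' (S.C t) + S.push (S.C t)"
    using push[OF S.clock_bounds(1)[OF assms(5)]] by (simp add: z x'_def)
  also have "\<dots> = S.Z t"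
    using assms by (simp add: S.sticky_eq S.reflected_def)
  finally show ?thesis by (simp add: x'_def[abs_def] v_def z_def)
qed

lemma borel_measurable_right_continuous:
  fixes f :: "real \<Rightarrow> real"
  assumes "\<And>t. 0 \<le> t \<Longrightarrow> continuous (at_right t) f"
  shows "(\<lambda>u. f (max 0 u)) \<in> borel_measurable borel"
  by (rule measurable_right_continuous_at[where Y = "\<lambda>s _. f s"]) (auto intro: assms)

lemma emeasure_lborel_shift:
  fixes Q :: "real set"
  assumes Q: "Q \<in> sets borel"
  shows "(\<lambda>u. u + a) ` Q \<in> sets borel"
    and "emeasure lborel ((\<lambda>u. u + a) ` Q) = emeasure lborel Q"
proof -
  have "(\<lambda>u. u + a) ` Q = (\<lambda>u. u - a) -` Q \<inter> space borel"
    by (auto simp: image_iff) (metis diff_add_cancel)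
  also have "\<dots> \<in> sets borel" using Q by (intro measurable_sets[OF _ Q]) simp
  finally show *: "(\<lambda>u. u + a) ` Q \<in> sets borel" .
  have "emeasure lborel ((\<lambda>u. u + a) ` Q) = emeasure (distr lborel borel ((+) a)) ((\<lambda>u. u + a) ` Q)"
    by (simp add: lborel_distr_plus)
  also have "\<dots> = emeasure lborel ((+) a -` ((\<lambda>u. u + a) ` Q))"
    using * by (subst emeasure_distr) auto
  also have "(+) a -` ((\<lambda>u. u + a) ` Q) = Q" by (auto simp: add.commute)
  finally show "emeasure lborel ((\<lambda>u. u + a) ` Q) = emeasure lborel Q" .
qed

section \<open>Time spent away from zero\<close>

context sticky_path
begin

lemma reflected_eq_0:
  assumes "0 \<le> u" "reflected u = 0"
  shows "x u = - depth x u"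
  using depth_upper[OF good, of u u] assms by (auto simp: reflected_def push_def max_def split: if_splits)

text \<open>The push can rest to the right of \<open>u\<close> for two reasons: the path is above
  its running infimum, or the infimum has not yet come down to \<open>- y\<close> and the push is
  still 0. An interval of constancy contains a rational, which will leave only countably many
  values.\<close>

lemma push_const_right:
  assumes "0 \<le> u" "0 < reflected u"
  obtains q where "q \<in> \<rat>" "0 \<le> q" "push q = push u"
proof -
  have "\<exists>b>u. push b = push u"
  proof (cases "- x u < depth x u")
    case True
    then obtain b where "u < b" "depth x b = depth x u"
      using depth_const_right[OF good assms(1)] by blast
    then show ?thesis by (auto simp: push_def)
  next
    case False
    then have "depth x u < y"
      using assms depth_upper[OF good, of u u] by (auto simp: reflected_def push_def max_def split: if_splits)
    then obtain b where "u < b" "depth x b \<le> depth x u + (y - depth x u)"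
      using depth_right[OF good assms(1), of "y - depth x u"] by auto
    with \<open>depth x u < y\<close> show ?thesis by (intro exI[of _ b]) (auto simp: push_def)
  qed
  then obtain b where b: "u < b" "push b = push u" by blast
  obtain q where q: "q \<in> \<rat>" "u < q" "q < b" using Rats_dense_in_real[OF b(1)] by blast
  then have "push u \<le> push q" "push q \<le> push b"
    using assms by (auto intro!: push_mono)
  then show ?thesis using that[of q] q b assms by simp
qed

text \<open>Where the reflected path is positive its push is locally constant on the right, so the push
  takes only countably many values there, and on each of its level sets \<open>\<tau>\<close> is a translation.\<close>

lemma emeasure_sticky_pos:
  assumes null: "negligible {u. 0 \<le> u \<and> x u = - depth x u}" and t: "0 \<le> t"
  shows "{s\<in>{0..t}. 0 < Z s} \<in> sets borel" "emeasure lborel {s\<in>{0..t}. 0 < Z s} = ennreal (C t)"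
proof -
  have [measurable]: "(\<lambda>u. Z (max 0 u)) \<in> borel_measurable borel"
    "(\<lambda>u. reflected (max 0 u)) \<in> borel_measurable borel"
    by (auto intro!: borel_measurable_right_continuous sticky_right_continuous
        reflected_right_continuous)
  have [measurable]: "(\<lambda>u. push (max 0 u)) \<in> borel_measurable borel"
    by (intro borel_measurable_continuous_onI continuous_on_compose2[OF push_continuous])
      (auto intro!: continuous_intros)
  define E where "E = {s\<in>{0..t}. 0 < Z s}"
  define V where "V = (\<lambda>q. push q / \<gamma>) ` (\<rat> \<inter> {0..})"
  define Q where "Q a = {u\<in>{0..C t}. 0 < reflected u \<and> push u / \<gamma> = a}" for a
  have "E = {s\<in>{0..t}. 0 < Z (max 0 s)}" by (auto simp: E_def)
  also have "\<dots> \<in> sets borel" by measurable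
  finally show "{s\<in>{0..t}. 0 < Z s} \<in> sets borel" by (simp add: E_def)
  have "Q a = {u\<in>{0..C t}. 0 < reflected (max 0 u) \<and> push (max 0 u) / \<gamma> = a}" for a
    by (auto simp: Q_def)
  also have "\<dots> a \<in> sets borel" for a by measurable
  finally have Q[measurable]: "Q a \<in> sets borel" for a .
  have V: "countable V" by (auto simp: V_def countable_rat)
  have in_V: "push u / \<gamma> \<in> V" if "0 \<le> u" "0 < reflected u" for u
    using push_const_right[OF that] by (metis V_def IntI atLeast_iff image_eqI)
  \<comment> \<open>On \<open>Q a\<close> the map \<tau> is the translation by \<open>a\<close>, so
    the positive times of \<open>Z\<close> are a countable union of translated level sets, disjoint
    because \<tau> is injective. Translations preserve length, and the level sets reassemble to the
    positive set of the reflected path.\<close>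
  have E: "E = (\<Union>a\<in>V. (\<lambda>u. u + a) ` Q a)"
  proof (intro set_eqI iffI)
    fix s assume "s \<in> E"
    then have s: "0 \<le> s" "s \<le> t" "0 < reflected (C s)" by (auto simp: E_def sticky_eq)
    then have "C s \<in> Q (push (C s) / \<gamma>)"
      using clock_bounds clock_mono by (auto simp: Q_def)
    moreover have "s = C s + push (C s) / \<gamma>" using \<tau>_clock[OF s(1)] by (simp add: \<tau>_def)
    ultimately show "s \<in> (\<Union>a\<in>V. (\<lambda>u. u + a) ` Q a)"
      using in_V[OF clock_bounds(1)[OF s(1)] s(3)] by blast
  next
    fix s assume "s \<in> (\<Union>a\<in>V. (\<lambda>u. u + a) ` Q a)"
    then obtain u where u: "0 \<le> u" "u \<le> C t" "0 < reflected u" "s = \<tau> u"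
      by (auto simp: Q_def \<tau>_def)
    then have "s \<le> t" using \<tau>_le_iff[of u "C t"] \<tau>_clock[OF t] by simp
    moreover have "0 \<le> s" using \<tau>_ge[of u] u by simp
    ultimately show "s \<in> E" using u by (simp add: E_def sticky_eq clock_\<tau>)
  qed
  have disj: "disjoint_family_on (\<lambda>a. (\<lambda>u. u + a) ` Q a) V"
    unfolding disjoint_family_on_def
  proof (intro ballI impI, rule ccontr)
    fix a b assume ab: "a \<noteq> b" "(\<lambda>u. u + a) ` Q a \<inter> (\<lambda>u. u + b) ` Q b \<noteq> {}"
    then obtain u v where "u \<in> Q a" "v \<in> Q b" "u + a = v + b" by auto
    then have "0 \<le> u" "0 \<le> v" "\<tau> u = \<tau> v" "a = push u / \<gamma>" "b = push v / \<gamma>"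
      by (auto simp: Q_def \<tau>_def)
    then show False using clock_\<tau> ab by metis
  qed
  have "emeasure lborel E = (\<integral>\<^sup>+a. emeasure lborel ((\<lambda>u. u + a) ` Q a) \<partial>count_space V)"
    unfolding E by (intro emeasure_UN_countable V disj) (simp add: emeasure_lborel_shift)
  also have "\<dots> = (\<integral>\<^sup>+a. emeasure lborel (Q a) \<partial>count_space V)"
    by (simp add: emeasure_lborel_shift)
  also have "\<dots> = emeasure lborel (\<Union>a\<in>V. Q a)"
    by (intro emeasure_UN_countable[symmetric] V) (use Q in \<open>simp, auto simp: disjoint_family_on_def Q_def\<close>)
  also have "(\<Union>a\<in>V. Q a) = {u\<in>{0..C t}. 0 < reflected u}"
    using in_V by (auto simp: Q_def)
  \<comment> \<open>The hypothesis \<open>null\<close> acts here: a zero of the reflected path is a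
    time at which \<open>x\<close> sits on its running infimum, so deleting the zeros from [0, C t]
    does not change the length.\<close>
  also have "emeasure lborel \<dots> = emeasure lborel {0..C t}"
  proof (rule emeasure_eq_AE)
    have "AE u in lebesgue. \<not> (0 \<le> u \<and> x u = - depth x u)"
      using null by (auto simp: negligible_iff_null_sets dest: AE_not_in)
    then have "AE u in lborel. \<not> (0 \<le> u \<and> x u = - depth x u)"
      by (simp add: AE_completion_iff)
    then show "AE u in lborel. u \<in> {u \<in> {0..C t}. 0 < reflected u} \<longleftrightarrow> u \<in> {0..C t}"
      by eventually_elim (use reflected_nonneg reflected_eq_0 in \<open>auto simp: less_le\<close>)
    have "{u\<in>{0..C t}. 0 < reflected u} = {u\<in>{0..C t}. 0 < reflected (max 0 u)}" by auto
    also have "\<dots> \<in> sets lborel" by measurable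
    finally show "{u\<in>{0..C t}. 0 < reflected u} \<in> sets lborel" .
  qed simp
  finally show "emeasure lborel {s\<in>{0..t}. 0 < Z s} = ennreal (C t)"
    using clock_bounds[OF t] by (simp add: E_def)
qed

text \<open>The measure computation gives \<open>C t\<close> for the time in the positive half-line.
  As \<open>Z\<close> is nonnegative, the remaining \<open>t - C t\<close> is the time at zero, and
  \<open>sticky_eq'\<close> becomes the equation.\<close>

lemma sticky_solves:
  assumes null: "negligible {u. 0 \<le> u \<and> x u = - depth x u}"
  shows "solves_path x \<gamma> y Z C"
proof -
  have pos: "((\<lambda>s. indicat_real {0<..} (Z s)) has_integral C t) {0..t}" if t: "0 \<le> t" for t
  proof -
    define E where "E = {s\<in>{0..t}. 0 < Z s}"
    have "((\<lambda>x. 1) has_integral measure lborel E) E"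
      using emeasure_sticky_pos[OF null t] by (intro has_integral_measure_lborel) (auto simp: E_def)
    also have "measure lborel E = C t"
      using emeasure_sticky_pos[OF null t] clock_bounds[OF t] by (simp add: measure_def E_def)
    finally have "((\<lambda>s. if s \<in> E then 1 else 0) has_integral C t) {0..t}"
      by (subst has_integral_restrict) (auto simp: E_def)
    then show ?thesis
      by (rule has_integral_eq[rotated]) (auto simp: E_def indicator_def)
  qed
  have zero: "((\<lambda>s. indicat_real {0} (Z s)) has_integral t - C t) {0..t}" if t: "0 \<le> t" for t
  proof -
    have "((\<lambda>s. 1 :: real) has_integral t) {0..t}"
      using has_integral_const_real[of "1 :: real" 0 t] t by simp
    then have "((\<lambda>s. 1 - indicat_real {0<..} (Z s)) has_integral t - C t) {0..t}"
      by (intro has_integral_diff pos t)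
    then show ?thesis
      by (rule has_integral_eq[rotated]) (use sticky_nonneg in \<open>auto simp: indicator_def less_le\<close>)
  qed
  show ?thesis
    unfolding solves_path_def
  proof (intro allI impI conjI)
    fix t :: real assume t: "0 \<le> t"
    show "(\<lambda>s. indicat_real {0} (Z s)) integrable_on {0..t}"
      "(\<lambda>s. indicat_real {0<..} (Z s)) integrable_on {0..t}"
      using pos[OF t] zero[OF t] by blast+
    show "C t = integral {0..t} (\<lambda>s. indicat_real {0<..} (Z s))"
      using pos[OF t] by (simp add: integral_unique)
    show "Z t = y + x (C t) + \<gamma> * integral {0..t} (\<lambda>s. indicat_real {0} (Z s))"
      using zero[OF t] sticky_eq'[OF t] by (simp add: integral_unique)
  qed
qed

end

text \<open>The conditions concern the open interval only, the two endpoints being negligible. The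
  applications need this freedom: the values of a solution at the ends of an excursion are the ones
  still to be determined.\<close>

lemma integral_indicator_bounds:
  fixes f :: "real \<Rightarrow> real"
  assumes int: "(\<lambda>s. indicat_real B (f s)) integrable_on {0..t}" and st: "0 \<le> s" "s \<le> t"
  defines "I \<equiv> \<lambda>t. integral {0..t} (\<lambda>s. indicat_real B (f s))"
  shows "0 \<le> I t - I s" "I t - I s \<le> t - s"
    and "(\<And>r. s < r \<Longrightarrow> r < t \<Longrightarrow> f r \<notin> B) \<Longrightarrow> I t = I s"
    and "(\<And>r. s < r \<Longrightarrow> r < t \<Longrightarrow> f r \<in> B) \<Longrightarrow> I t - I s = t - s"
proof -
  let ?g = "\<lambda>s. indicat_real B (f s)"
  have int': "?g integrable_on {s..t}"
    by (rule integrable_on_subinterval[OF int]) (use st in auto)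
  have eq: "I t - I s = integral {s..t} ?g"
    using Henstock_Kurzweil_Integration.integral_combine[OF st int] by (simp add: I_def)
  show "0 \<le> I t - I s"
    unfolding eq by (intro integral_nonneg int') auto
  have "integral {s..t} ?g \<le> integral {s..t} (\<lambda>_. 1)"
    by (intro integral_le int') (auto simp: indicator_def)
  also have "\<dots> = t - s" using st by simp
  finally show "I t - I s \<le> t - s" unfolding eq .
  show "I t = I s" if "\<And>r. s < r \<Longrightarrow> r < t \<Longrightarrow> f r \<notin> B"
  proof -
    have "integral {s..t} ?g = integral {s..t} (\<lambda>_. 0)"
      by (rule integral_spike[of "{s, t}"]) (use that in \<open>auto simp: indicator_def less_le\<close>)
    then show ?thesis using eq by simp
  qed
  show "I t - I s = t - s" if "\<And>r. s < r \<Longrightarrow> r < t \<Longrightarrow> f r \<in> B"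
  proof -
    have "integral {s..t} ?g = integral {s..t} (\<lambda>_. 1)"
      by (rule integral_spike[of "{s, t}"]) (use that in \<open>auto simp: indicator_def less_le\<close>)
    then show ?thesis using eq st by simp
  qed
qed

section \<open>Uniqueness along a path\<close>

locale solution_path = sticky_path +
  fixes f c :: "real \<Rightarrow> real"
  assumes solves: "solves_path x \<gamma> y f c"
begin

definition A :: "real \<Rightarrow> real" where
  "A t = integral {0..t} (\<lambda>s. indicat_real {0} (f s))"

lemma f_eq: "0 \<le> t \<Longrightarrow> f t = y + x (c t) + \<gamma> * A t"
  and c_eq: "0 \<le> t \<Longrightarrow> c t = integral {0..t} (\<lambda>s. indicat_real {0<..} (f s))"
  and f_integrable: "0 \<le> t \<Longrightarrow> (\<lambda>s. indicat_real {0} (f s)) integrable_on {0..t}"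
    "0 \<le> t \<Longrightarrow> (\<lambda>s. indicat_real {0<..} (f s)) integrable_on {0..t}"
  using solves unfolding solves_path_def A_def by blast+

lemma A_0: "A 0 = 0" and c_0: "c 0 = 0"
  using c_eq[of 0] by (simp_all add: A_def)

lemma A_diff:
  assumes "0 \<le> s" "s \<le> t"
  shows "0 \<le> A t - A s" "A t - A s \<le> t - s"
    and "(\<And>r. s < r \<Longrightarrow> r < t \<Longrightarrow> f r \<noteq> 0) \<Longrightarrow> A t = A s"
  using integral_indicator_bounds[OF f_integrable(1) assms] assms unfolding A_def by auto

lemma c_diff:
  assumes "0 \<le> s" "s \<le> t"
  shows "0 \<le> c t - c s" "c t - c s \<le> t - s"
    and "(\<And>r. s < r \<Longrightarrow> r < t \<Longrightarrow> f r \<le> 0) \<Longrightarrow> c t = c s"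
    and "(\<And>r. s < r \<Longrightarrow> r < t \<Longrightarrow> 0 < f r) \<Longrightarrow> c t - c s = t - s"
  using integral_indicator_bounds[OF f_integrable(2) assms] assms by (auto simp: c_eq not_less)

lemma c_nonneg: "0 \<le> t \<Longrightarrow> 0 \<le> c t"
  using c_diff(1)[of 0 t] by (simp add: c_0)

lemma A_nonneg: "0 \<le> t \<Longrightarrow> 0 \<le> A t"
  using A_diff(1)[of 0 t] by (simp add: A_0)

lemma f_0: "f 0 = y"
  by (simp add: f_eq A_0 c_0 good_path_0[OF good])

text \<open>A solution cannot jump below zero, since \<^term>\<open>x\<close> has no negative jumps, and both clocks
  stop while it is negative.\<close>

lemma f_nonneg:
  assumes t: "0 \<le> t" shows "0 \<le> f t"
proof (rule ccontr)
  assume neg: "\<not> 0 \<le> f t"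
  define S where "S = {r\<in>{0..t}. 0 \<le> f r}"
  define s where "s = Sup S"
  have S: "0 \<in> S" "S \<subseteq> {0..t}" using t f_0 y by (auto simp: S_def)
  have bdd: "bdd_above S" using S(2) by (meson bdd_above_Icc bdd_above_mono)
  have s: "0 \<le> s" "s \<le> t"
    using S bdd by (auto simp: s_def intro!: cSup_upper cSup_least)
  have above: "f r < 0" if "s < r" "r \<le> t" for r
  proof (rule ccontr)
    assume "\<not> f r < 0"
    then have "r \<in> S" using that s by (simp add: S_def)
    then have "r \<le> s" unfolding s_def using bdd by (rule cSup_upper)
    with that show False by simp
  qed
  show False
  proof (cases "0 \<le> f s")
    case True
    have "f r < 0" if "s < r" "r < t" for r using above[of r] that by simp
    then have "c t = c s" "A t = A s"
      using s by (auto intro!: A_diff(3) c_diff(3) less_imp_le less_imp_neq)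
    then have "f t = f s" using f_eq t s by simp
    with True neg show False by simp
  next
    \<comment> \<open>Here the solution would have crossed zero at \<open>s\<close> through a
      downward jump of \<open>x\<close> at \<open>c s\<close>. Some time has passed on the clock,
      since with \<open>c s = 0\<close> the equation gives f s = y + \<gamma> * A s, which is
      nonnegative.\<close>
    case False
    have "c s \<noteq> 0"
    proof
      assume "c s = 0"
      then have "f s = y + \<gamma> * A s" using f_eq s by (simp add: good_path_0[OF good])
      with False A_nonneg[OF s(1)] y \<gamma> show False by simp
    qed
    with c_nonneg[OF s(1)] have "0 < c s" by simp
    then obtain b where b: "0 \<le> b" "b < c s" "\<And>r. b < r \<Longrightarrow> r < c s \<Longrightarrow> x r < x (c s) + (- f s)"
      using good_path_left[OF good, of "c s" "- f s"] False by auto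
    \<comment> \<open>The distance \<open>c s - b\<close> is chosen because \<open>c\<close> is
      1-Lipschitz: any \<open>r\<close> that close to \<open>s\<close> has \<open>c r\<close> in the
      window (b, c s] to which the bound from \<open>good_path_left\<close> refers. A nonnegative
      value at \<open>r\<close> contradicts that bound.\<close>
    obtain r where r: "r \<in> S" "s - (c s - b) < r"
      using less_cSupD[of S "s - (c s - b)"] S b by (auto simp: s_def)
    have "r \<le> s" using r(1) bdd unfolding s_def by (rule cSup_upper)
    have r0: "0 \<le> r" "0 \<le> f r" using r by (auto simp: S_def)
    have "\<gamma> * A r \<le> \<gamma> * A s"
      using A_diff(1)[OF r0(1) \<open>r \<le> s\<close>] \<gamma> by simp
    then have *: "x (c s) + (- f s) \<le> x (c r)"
      using f_eq[OF s(1)] f_eq[OF r0(1)] r0 by linarith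
    have "c r \<le> c s" "b < c r"
      using c_diff[OF r0(1) \<open>r \<le> s\<close>] r(2) by auto
    moreover have "c r \<noteq> c s" using * False by auto
    ultimately show False using b(3)[of "c r"] * by simp
  qed
qed

text \<open>Nonnegativity pays off here: the two indicators exhaust the time only because the
  solution is never negative.\<close>

lemma c_plus_A:
  assumes t: "0 \<le> t" shows "c t + A t = t"
proof -
  have "c t + A t = integral {0..t} (\<lambda>s. indicat_real {0<..} (f s) + indicat_real {0} (f s))"
    unfolding A_def c_eq[OF t] by (intro Henstock_Kurzweil_Integration.integral_add[symmetric] f_integrable t)
  also have "\<dots> = integral {0..t} (\<lambda>_. 1)"
    by (intro Henstock_Kurzweil_Integration.integral_cong)
      (use f_nonneg in \<open>auto simp: indicator_def less_le\<close>)
  also have "\<dots> = t" using t by simp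
  finally show ?thesis .
qed

lemma c_surj:
  assumes t: "0 \<le> t" and v: "0 \<le> v" "v \<le> c t"
  obtains s where "0 \<le> s" "s \<le> t" "c s = v"
proof -
  have "1-lipschitz_on {0..t} c"
  proof (rule lipschitz_onI)
    show "dist (c r) (c s) \<le> 1 * dist r s" if "r \<in> {0..t}" "s \<in> {0..t}" for r s
      using c_diff(1,2)[of r s] c_diff(1,2)[of s r] that
      by (cases "r \<le> s") (auto simp: dist_real_def abs_if)
  qed simp
  then have "continuous_on {0..t} c" by (rule lipschitz_on_continuous_on)
  then have "\<exists>s. 0 \<le> s \<and> s \<le> t \<and> c s = v"
    using v t by (intro IVT') (auto simp: c_0)
  then show ?thesis using that by blast
qed

text \<open>Skorokhod's argument. Nonnegativity of \<open>f\<close> at all earlier times makes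
  \<gamma> * A t at least the push. Conversely \<open>A\<close> grows only at zeros of
  \<open>f\<close>, and at a zero \<gamma> * A equals - y - x at the clock, which is at most the
  push.\<close>

lemma A_eq_push:
  assumes t: "0 \<le> t" shows "\<gamma> * A t = push (c t)"
proof (rule antisym)
  have "depth x (c t) \<le> y + \<gamma> * A t"
  proof (rule depth_least[OF good c_nonneg[OF t]])
    fix v assume "0 \<le> v" "v \<le> c t"
    then obtain s where s: "0 \<le> s" "s \<le> t" "c s = v" using c_surj[OF t] by blast
    have "\<gamma> * A s \<le> \<gamma> * A t" using A_diff(1)[OF s(1,2)] \<gamma> by simp
    then show "- x v \<le> y + \<gamma> * A t"
      using f_eq[OF s(1)] f_nonneg[OF s(1)] unfolding s(3)[symmetric] by linarith
  qed
  then show "push (c t) \<le> \<gamma> * A t"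
    using A_nonneg[OF t] \<gamma> by (simp add: push_def)
  show "\<gamma> * A t \<le> push (c t)"
  proof (cases "A t = 0")
    case True
    then show ?thesis by (simp add: push_def)
  next
    case False
    define S where "S = {r\<in>{0..t}. f r = 0}"
    define s where "s = Sup S"
    have ne: "S \<noteq> {}"
      using False A_diff(3)[of 0 t] t by (force simp: S_def A_0)
    have sub: "S \<subseteq> {0..t}" by (auto simp: S_def)
    have bdd: "bdd_above S" using sub by (meson bdd_above_Icc bdd_above_mono)
    have "s \<le> t" unfolding s_def using ne sub by (intro cSup_least) auto
    have up: "r \<le> s" if "r \<in> S" for r using that bdd unfolding s_def by (rule cSup_upper)
    with ne sub have "0 \<le> s" by force
    have "f r \<noteq> 0" if "s < r" "r < t" for r
      using up[of r] that \<open>0 \<le> s\<close> by (auto simp: S_def)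
    then have "A t = A s" using \<open>0 \<le> s\<close> \<open>s \<le> t\<close> by (intro A_diff(3))
    \<comment> \<open>The supremum \<open>s\<close> of the zeros need not be a zero itself. A zero
      \<open>r\<close> within e / \<gamma> of it suffices, since \<open>A\<close> is 1-Lipschitz and
      \<gamma> * A therefore changes by at most \<open>e\<close> in between.\<close>
    have "\<gamma> * A s \<le> push (c t) + e" if e: "0 < e" for e
    proof -
      obtain r where r: "r \<in> S" "s - e / \<gamma> < r"
        using less_cSupD[OF ne, of "s - e / \<gamma>"] e \<gamma> by (auto simp: s_def)
      have r0: "0 \<le> r" "r \<le> s" "r \<le> t" "f r = 0" using r up by (auto simp: S_def)
      have "A s - A r \<le> e / \<gamma>" using A_diff(2)[OF r0(1,2)] r(2) by simp
      then have "\<gamma> * (A s - A r) \<le> e" using \<gamma> by (simp add: field_simps)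
      moreover have "\<gamma> * A r = - y - x (c r)" using f_eq[OF r0(1)] r0 by simp
      moreover have "- x (c r) \<le> depth x (c t)"
        using c_nonneg[OF r0(1)] c_diff(1)[OF r0(1,3)] by (intro depth_upper[OF good]) auto
      ultimately show ?thesis by (simp add: push_def algebra_simps)
    qed
    then show ?thesis unfolding \<open>A t = A s\<close> by (rule field_le_epsilon)
  qed
qed

lemma c_unique:
  assumes t: "0 \<le> t" shows "c t = C t"
proof -
  have "push (c t) / \<gamma> = A t" using A_eq_push[OF t] \<gamma> by (simp add: field_simps)
  then have "\<tau> (c t) = t" using c_plus_A[OF t] by (simp add: \<tau>_def)
  then show ?thesis using clock_eqI c_nonneg[OF t] by metis
qed

lemma f_unique: "0 \<le> t \<Longrightarrow> f t = Z t"
  using f_eq[of t] A_eq_push[of t] by (simp add: sticky_eq reflected_def c_unique)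

text \<open>Before the first zero no time is spent at zero, so the clock is the identity and
  \<open>f = y + x\<close>. The infimum of the zeros is a zero, by right continuity of
  \<open>Z\<close>, with which \<open>f\<close> agrees. Hence killing at zero has the same effect on
  \<open>f\<close> and on \<open>y + x\<close>.\<close>

lemma zero_iff:
  assumes t: "0 \<le> t"
  shows "(\<exists>s\<in>{0..t}. f s = 0) \<longleftrightarrow> (\<exists>s\<in>{0..t}. y + x s = 0)"
    and "\<forall>s\<in>{0..t}. f s \<noteq> 0 \<Longrightarrow> f t = y + x t"
proof -
  have eq: "f s = y + x s" if "0 \<le> s" "\<And>r. 0 < r \<Longrightarrow> r < s \<Longrightarrow> f r \<noteq> 0" for s
  proof -
    have "A s = 0" using A_diff(3)[of 0 s] that by (simp add: A_0)
    then show ?thesis using f_eq[OF that(1)] c_plus_A[OF that(1)] by simp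
  qed
  show "f t = y + x t" if "\<forall>s\<in>{0..t}. f s \<noteq> 0"
    using that t by (intro eq) auto
  show "(\<exists>s\<in>{0..t}. f s = 0) \<longleftrightarrow> (\<exists>s\<in>{0..t}. y + x s = 0)"
  proof
    assume "\<exists>s\<in>{0..t}. y + x s = 0"
    then obtain s where s: "s \<in> {0..t}" "y + x s = 0" by blast
    then show "\<exists>s\<in>{0..t}. f s = 0"
      using eq[of s] by (cases "\<exists>r\<in>{0..s}. f r = 0") auto
  next
    assume "\<exists>s\<in>{0..t}. f s = 0"
    then have ne: "{s\<in>{0..t}. f s = 0} \<noteq> {}" by blast
    define S where "S = {s\<in>{0..t}. f s = 0}"
    define r where "r = Inf S"
    have bdd: "bdd_below S" by (auto simp: S_def intro: bdd_belowI[of _ 0])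
    have "0 \<le> r" using ne unfolding r_def S_def by (intro cInf_greatest) auto
    obtain s where s: "s \<in> S" using ne by (auto simp: S_def)
    then have "r \<le> s" using bdd unfolding r_def by (rule cInf_lower)
    with s \<open>0 \<le> r\<close> have r: "0 \<le> r" "r \<le> t" by (auto simp: S_def)
    have before: "f s \<noteq> 0" if "0 \<le> s" "s < r" for s
    proof
      assume "f s = 0"
      then have "s \<in> S" using that r by (simp add: S_def)
      then have "r \<le> s" using bdd unfolding r_def by (rule cInf_lower)
      with that show False by simp
    qed
    have "f r = 0"
    proof (rule ccontr)
      assume "f r \<noteq> 0"
      then have pos: "0 < Z r" using f_nonneg[OF r(1)] f_unique[OF r(1)] by simp
      have "(Z \<longlongrightarrow> Z r) (at_right r)"
        using sticky_right_continuous[OF r(1)] by (simp add: continuous_within)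
      then have "\<forall>\<^sub>F s in at_right r. 0 < Z s" using pos by (rule order_tendstoD)
      then obtain b where b: "r < b" "\<And>s. r < s \<Longrightarrow> s < b \<Longrightarrow> 0 < Z s"
        unfolding eventually_at_right_field by blast
      obtain s where s: "s \<in> S" "s < b"
        using cInf_lessD[of S b] ne b by (auto simp: r_def S_def)
      have "r \<le> s" using s(1) bdd unfolding r_def by (rule cInf_lower)
      moreover have "s \<noteq> r" using s \<open>f r \<noteq> 0\<close> by (auto simp: S_def)
      ultimately have "0 < Z s" using b s by simp
      then show False using s f_unique[of s] by (auto simp: S_def)
    qed
    moreover have "f r = y + x r" using r before by (intro eq) auto
    ultimately show "\<exists>s\<in>{0..t}. y + x s = 0" using r by auto
  qed
qed

end

section \<open>Measurability in the path, the time and the starting point; tools on path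
  space\<close>

lemma measurable_path_component:
  "g \<in> N \<rightarrow>\<^sub>M path_space \<Longrightarrow> 0 \<le> s \<Longrightarrow> (\<lambda>\<omega>. g \<omega> s :: 'b::topological_space) \<in> borel_measurable N"
  unfolding path_space_def by (rule measurable_component_singleton[THEN measurable_compose[rotated]]) auto

lemma measurable_path_spaceI:
  "(\<And>s. 0 \<le> s \<Longrightarrow> f s \<in> borel_measurable N) \<Longrightarrow> (\<lambda>\<omega>. \<lambda>s\<in>{0..}. f s \<omega>) \<in> N \<rightarrow>\<^sub>M path_space"
  unfolding path_space_def by (rule measurable_restrict) auto

lemma space_path_space: "space path_space = extensional {0..}"
  by (simp add: path_space_def space_PiM PiE_def)

lemma borel_measurable_depth:
  assumes g: "g \<in> N \<rightarrow>\<^sub>M path_space" and f: "f \<in> borel_measurable N"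
  shows "(\<lambda>\<omega>. depth (g \<omega>) (f \<omega>)) \<in> borel_measurable N"
proof -
  note [measurable] = f
  have "(\<lambda>\<omega>. if 0 \<le> q \<and> q \<le> f \<omega> then ereal (- g \<omega> q) else 0) \<in> borel_measurable N" for q
  proof (cases "0 \<le> q")
    case True
    then have [measurable]: "(\<lambda>\<omega>. g \<omega> q) \<in> borel_measurable N"
      by (rule measurable_path_component[OF g])
    show ?thesis by measurable
  qed simp
  then have "(\<lambda>\<omega>. SUP q\<in>\<rat>. if 0 \<le> q \<and> q \<le> f \<omega> then ereal (- g \<omega> q) else 0)
      \<in> borel_measurable N"
    by (intro borel_measurable_SUP) (auto simp: countable_rat)
  then show ?thesis unfolding depth_def by measurable
qed

lemma clock_bdd:
  "bdd_above ((\<lambda>q. if 0 \<le> q \<and> q \<le> t \<and> q + max 0 (depth x q - y) / \<gamma> \<le> t then q else 0) ` \<rat>)"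
  by (rule bdd_aboveI[of _ "max 0 t"]) auto

lemma clock_nonneg: "0 \<le> clock \<gamma> y x t"
  unfolding clock_def by (intro cSUP_upper2[OF clock_bdd, of 0]) auto

lemma borel_measurable_clock:
  assumes g: "g \<in> N \<rightarrow>\<^sub>M path_space" and f: "f \<in> borel_measurable N" and h: "h \<in> borel_measurable N"
  shows "(\<lambda>\<omega>. clock \<gamma> (h \<omega>) (g \<omega>) (f \<omega>)) \<in> borel_measurable N"
proof -
  note [measurable] = f h borel_measurable_depth[OF g]
  show ?thesis
    unfolding clock_def
  proof (rule borel_measurable_cSUP[OF countable_rat])
    show "(\<lambda>\<omega>. if 0 \<le> q \<and> q \<le> f \<omega> \<and> q + max 0 (depth (g \<omega>) q - h \<omega>) / \<gamma> \<le> f \<omega> then q else 0)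
        \<in> borel_measurable N" for q
      by measurable
  qed (rule clock_bdd)
qed

text \<open>All three arguments may be random: the time for the position at a stopping time, the
  starting point for the transition kernel. No regularity of the paths \<open>g \<omega>\<close> is
  assumed.\<close>

lemma borel_measurable_sticky:
  assumes g: "g \<in> N \<rightarrow>\<^sub>M path_space" and f: "f \<in> borel_measurable N" and h: "h \<in> borel_measurable N"
  shows "(\<lambda>\<omega>. sticky \<gamma> (h \<omega>) (g \<omega>) (f \<omega>)) \<in> borel_measurable N"
proof -
  note [measurable] = f h borel_measurable_clock[OF g f h]
    borel_measurable_depth[OF g borel_measurable_clock[OF g f h]]
  have [measurable]: "(\<lambda>\<omega>. g \<omega> (step_above n (clock \<gamma> (h \<omega>) (g \<omega>) (f \<omega>)))) \<in> borel_measurable N" for n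
    by (rule measurable_at_step_above[where Y = "\<lambda>s \<omega>. g \<omega> s"])
      (auto intro: measurable_path_component[OF g] clock_nonneg)
  show ?thesis unfolding sticky_def by measurable
qed

text \<open>Elements of \<open>path_space\<close> are undefined at negative times whereas sample
  paths are not. The functionals look at nonnegative times only, so the two descriptions can be
  exchanged.\<close>

lemma depth_restrict: "depth (restrict x {0..}) u = depth x u"
  unfolding depth_def by (intro arg_cong[where f = real_of_ereal] SUP_cong) auto

lemma clock_restrict: "clock \<gamma> y (restrict x {0..}) t = clock \<gamma> y x t"
  unfolding clock_def depth_restrict ..

lemma sticky_restrict: "sticky \<gamma> y (restrict x {0..}) t = sticky \<gamma> y x t"
proof -
  have "0 \<le> step_above n (clock \<gamma> y x t)" for n
    using step_above_bounds(1)[of "clock \<gamma> y x t" n] clock_nonneg[of \<gamma> y x t] by simp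
  then show ?thesis unfolding sticky_def clock_restrict depth_restrict by simp
qed

text \<open>Finite-dimensional boxes form an intersection-stable generator (on common coordinates
  the smaller bound is taken). Upper half-lines are convenient because their indicators are limits
  of the continuous functions \<open>box_approx\<close>.\<close>

lemma path_measure_eqI:
  fixes \<mu> \<nu> :: "(real \<Rightarrow> real) measure"
  assumes sets: "sets \<mu> = sets path_space" "sets \<nu> = sets path_space" and fin: "finite_measure \<mu>"
    and eq: "\<And>J b. finite J \<Longrightarrow> J \<subseteq> {0..} \<Longrightarrow>
      emeasure \<mu> {x\<in>space path_space. \<forall>j\<in>J. x j \<le> b j}
        = emeasure \<nu> {x\<in>space path_space. \<forall>j\<in>J. x j \<le> b j}"
  shows "\<mu> = \<nu>"
proof -
  define Box where "Box J b = {x\<in>space path_space. \<forall>j\<in>J. x j \<le> b j}"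
    for J and b :: "real \<Rightarrow> real"
  define E where "E = {Box J b |J b. finite J \<and> J \<subseteq> {0..}}"
  have gen: "sets path_space = sigma_sets (space path_space) E"
  proof
    let ?S = "sigma (space path_space) E"
    have E: "E \<subseteq> Pow (space path_space)" by (auto simp: E_def Box_def)
    have comp: "(\<lambda>x. x i) \<in> borel_measurable ?S" if "0 \<le> i" for i
    proof (rule borel_measurableI_le)
      fix a :: real
      have "{x\<in>space ?S. x i \<le> a} = Box {i} (\<lambda>_. a)" using E by (auto simp: Box_def space_measure_of)
      also have "\<dots> \<in> E" unfolding E_def using that by blast
      finally show "{x\<in>space ?S. x i \<le> a} \<in> sets ?S" using E by auto
    qed
    have "(\<lambda>x. x) \<in> ?S \<rightarrow>\<^sub>M PiM {0..} (\<lambda>_. borel)"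
    proof (rule measurable_PiM_single')
      show "(\<lambda>x. x) \<in> space ?S \<rightarrow> (\<Pi>\<^sub>E i\<in>{0..}. space borel)"
        using E by (simp add: space_path_space space_measure_of PiE_def)
      show "(\<lambda>x. x i) \<in> borel_measurable ?S" if "i \<in> {0..}" for i
        using comp that by simp
    qed
    then have id: "(\<lambda>x. x) \<in> ?S \<rightarrow>\<^sub>M path_space" by (simp add: path_space_def)
    have "sets path_space \<subseteq> sets ?S"
    proof
      fix A :: "(real \<Rightarrow> real) set" assume A: "A \<in> sets path_space"
      have "(\<lambda>x. x) -` A \<inter> space ?S \<in> sets ?S"
        using id A by (rule measurable_sets)
      moreover have "(\<lambda>x. x) -` A \<inter> space ?S = A"
        using sets.sets_into_space[OF A] E by (auto simp: space_measure_of)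
      ultimately show "A \<in> sets ?S" by simp
    qed
    then show "sets path_space \<subseteq> sigma_sets (space path_space) E" using E by simp
    show "sigma_sets (space path_space) E \<subseteq> sets path_space"
    proof (rule sets.sigma_sets_subset)
      show "E \<subseteq> sets path_space"
      proof
        fix A assume "A \<in> E"
        then obtain J b where A: "A = Box J b" and J: "finite J" "J \<subseteq> {0..}" by (auto simp: E_def)
        have [measurable]: "(\<lambda>x. x j) \<in> borel_measurable path_space" if "j \<in> J" for j
          using that J by (intro measurable_path_component) auto
        show "A \<in> sets path_space" unfolding A Box_def using J(1) by measurable
      qed
    qed
  qed
  show ?thesis
  proof (rule measure_eqI_generator_eq[where E = E and \<Omega> = "space path_space" and A = "\<lambda>_. space path_space"])
    show "Int_stable E"
    proof (rule Int_stableI)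
      fix A B assume "A \<in> E" "B \<in> E"
      then obtain J b K c where *: "A = Box J b" "finite J" "J \<subseteq> {0..}" "B = Box K c" "finite K" "K \<subseteq> {0..}"
        by (auto simp: E_def)
      have "A \<inter> B = Box (J \<union> K) (\<lambda>j. if j \<in> J then if j \<in> K then min (b j) (c j) else b j else c j)"
        by (auto simp: * Box_def)
      then show "A \<inter> B \<in> E" unfolding E_def using * by blast
    qed
    have "Box {} (\<lambda>_. 0) \<in> E" by (auto simp: E_def)
    then show "range (\<lambda>_. space path_space) \<subseteq> E" by (auto simp: Box_def)
    show "emeasure \<mu> (space path_space) \<noteq> \<infinity>"
      using fin sets_eq_imp_space_eq[OF sets(1)] by (metis finite_measure.emeasure_finite infinity_ennreal_def)
    show "E \<subseteq> Pow (space path_space)" by (auto simp: E_def Box_def)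
    show "sets \<mu> = sigma_sets (space path_space) E" "sets \<nu> = sigma_sets (space path_space) E"
      using sets gen by simp_all
    show "emeasure \<mu> A = emeasure \<nu> A" if "A \<in> E" for A
      using that eq by (auto simp: E_def Box_def)
  qed auto
qed

text \<open>A Vitali covering argument. Short intervals [u, u + h] on which \<open>d\<close> gains
  at least c * h cover \<open>S\<close> finely; a disjoint subfamily covers all of \<open>S\<close>
  but a null set. The gains take place over disjoint ranges of values, so c times the total length
  is at most the total growth \<open>B\<close>. As c is arbitrary, the outer measure vanishes;
  measurability of \<open>S\<close> is not assumed.\<close>

lemma negligible_steep:
  fixes d :: "real \<Rightarrow> real"
  assumes mono: "\<And>u v. 0 \<le> u \<Longrightarrow> u \<le> v \<Longrightarrow> d u \<le> d v"
    and S: "S \<subseteq> {0..t}"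
    and steep: "\<And>u c m. u \<in> S \<Longrightarrow> \<exists>h>0. h \<le> 1 / real (Suc m) \<and> real c * h \<le> d (u + h) - d u"
  shows "negligible S"
  unfolding negligible_outer_le
proof (intro allI impI)
  fix e :: real assume e: "0 < e"
  define B where "B = max 0 (d (t + 1) - d 0)"
  obtain c :: nat where c: "B / e < real c" "0 < c"
    using reals_Archimedean2[of "max 0 (B / e)"] by auto
  define K where "K = {(u, h). u \<in> S \<and> 0 < h \<and> h \<le> 1 \<and> real c * h \<le> d (u + h) - d u}"
  \<comment> \<open>The midpoint: it turns the one-sided interval [u, u + h] into a ball of radius h
    / 2, as the covering theorem demands.\<close>
  define a where "a = (\<lambda>(u, h). u + h / 2 :: real)"
  have cball: "cball (u + h / 2) (h / 2) = {u..u + h}" for u h :: real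
    by (auto simp: cball_def dist_real_def abs_if field_simps)
  have cover: "\<exists>i. i \<in> K \<and> u \<in> cball (a i) (snd i / 2) \<and> snd i / 2 < e"
    if u: "u \<in> S" "0 < e" for u e :: real
  proof -
    obtain m where m: "1 / real (Suc m) < e"
      using reals_Archimedean[OF u(2)] by (auto simp: inverse_eq_divide)
    obtain h where h: "h > 0" "h \<le> 1 / real (Suc m)" "real c * h \<le> d (u + h) - d u"
      using steep[OF u(1)] by blast
    have "1 / real (Suc m) \<le> 1" by simp
    then have "h \<le> 1" using h(2) by linarith
    then have "(u, h) \<in> K" using h u by (simp add: K_def)
    moreover have "u \<in> cball (a (u, h)) (snd (u, h) / 2)" using h by (simp add: a_def cball)
    moreover have "snd (u, h) / 2 < e" using h m by simp
    ultimately show ?thesis by blast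
  qed
  have radius: "0 < snd i / 2" if "i \<in> K" for i
    using that by (auto simp: K_def)
  obtain D where D: "countable D" "D \<subseteq> K"
    "pairwise (\<lambda>i j. disjnt (cball (a i) (snd i / 2)) (cball (a j) (snd j / 2))) D"
    "negligible (S - (\<Union>i\<in>D. cball (a i) (snd i / 2)))"
    by (rule Vitali_covering_theorem_cballs[of K "\<lambda>i. snd i / 2" S a, OF radius cover])
  \<comment> \<open>The range of values that \<open>d\<close> sweeps over the interval. Open
    endpoints keep these ranges disjoint when neighbouring ones share a value, and their lengths
    bound c times the lengths of the intervals.\<close>
  define I where "I i = {d (fst i)<..<d (fst i + snd i)}" for i :: "real \<times> real"
  define U where "U = (\<Union>i\<in>D. {fst i..fst i + snd i})"
  have U_eq: "U = (\<Union>i\<in>D. cball (a i) (snd i / 2))"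
    by (auto simp: U_def a_def cball split_beta)
  have DK: "fst i \<in> {0..t}" "0 < snd i" "snd i \<le> 1"
    "real c * snd i \<le> d (fst i + snd i) - d (fst i)" if "i \<in> D" for i
  proof -
    obtain u h where i: "i = (u, h)" by (cases i)
    with D(2) that have "(u, h) \<in> K" by blast
    then have K: "u \<in> S" "0 < h" "h \<le> 1" "real c * h \<le> d (u + h) - d u"
      by (simp_all add: K_def)
    then show "fst i \<in> {0..t}" using S i by auto
    show "0 < snd i" "snd i \<le> 1" "real c * snd i \<le> d (fst i + snd i) - d (fst i)"
      using K by (simp_all add: i)
  qed
  have sep: "fst i + snd i < fst j \<or> fst j + snd j < fst i" if "i \<in> D" "j \<in> D" "i \<noteq> j" for i j
  proof -
    have "disjnt {fst i..fst i + snd i} {fst j..fst j + snd j}"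
      using D(3) that by (auto simp: pairwise_def a_def cball split_beta)
    then have "max (fst i) (fst j) \<notin> {fst i..fst i + snd i} \<inter> {fst j..fst j + snd j}"
      by (auto simp: disjnt_def)
    then show ?thesis using DK(2)[OF that(1)] DK(2)[OF that(2)] by auto
  qed
  have disj: "disjoint_family_on (\<lambda>i. {fst i..fst i + snd i}) D"
    unfolding disjoint_family_on_def
  proof (intro ballI impI)
    fix i j assume "i \<in> D" "j \<in> D" "i \<noteq> j"
    from sep[OF this] show "{fst i..fst i + snd i} \<inter> {fst j..fst j + snd j} = {}" by auto
  qed
  have "emeasure lborel U = (\<integral>\<^sup>+i. emeasure lborel {fst i..fst i + snd i} \<partial>count_space D)"
    unfolding U_def by (intro emeasure_UN_countable disj D(1)) simp
  then have "ennreal c * emeasure lborel U = ennreal c * (\<integral>\<^sup>+i. emeasure lborel {fst i..fst i + snd i} \<partial>count_space D)"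
    by simp
  also have "\<dots> = (\<integral>\<^sup>+i. ennreal c * emeasure lborel {fst i..fst i + snd i} \<partial>count_space D)"
    by (simp add: nn_integral_cmult)
  also have "\<dots> \<le> (\<integral>\<^sup>+i. emeasure lborel (I i) \<partial>count_space D)"
  proof (rule nn_integral_mono)
    fix i assume "i \<in> space (count_space D)"
    then have i: "i \<in> D" by simp
    have "d (fst i) \<le> d (fst i + snd i)" using DK[OF i] by (intro mono) auto
    then show "ennreal c * emeasure lborel {fst i..fst i + snd i} \<le> emeasure lborel (I i)"
      using DK[OF i] by (simp add: I_def ennreal_mult[symmetric])
  qed
  also have "\<dots> = emeasure lborel (\<Union>i\<in>D. I i)"
  proof (rule emeasure_UN_countable[symmetric])
    show "disjoint_family_on I D"
      unfolding disjoint_family_on_def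
    proof (intro ballI impI)
      fix i j assume ij: "i \<in> D" "j \<in> D" "i \<noteq> j"
      have "d (fst i + snd i) \<le> d (fst j) \<or> d (fst j + snd j) \<le> d (fst i)"
        using sep[OF ij] DK[OF ij(1)] DK[OF ij(2)] by (auto intro!: mono)
      then show "I i \<inter> I j = {}" by (auto simp: I_def)
    qed
  qed (auto simp: D(1) I_def)
  also have "\<dots> \<le> emeasure lborel {d 0..d (t + 1)}"
  proof (rule emeasure_mono)
    show "(\<Union>i\<in>D. I i) \<subseteq> {d 0..d (t + 1)}"
    proof
      fix v assume "v \<in> (\<Union>i\<in>D. I i)"
      then obtain i where i: "i \<in> D" "d (fst i) < v" "v < d (fst i + snd i)" by (auto simp: I_def)
      have "d 0 \<le> d (fst i)" "d (fst i + snd i) \<le> d (t + 1)"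
        using DK[OF i(1)] by (auto intro!: mono)
      with i show "v \<in> {d 0..d (t + 1)}" by simp
    qed
  qed simp
  also have "\<dots> \<le> ennreal B" by (cases "d 0 \<le> d (t + 1)") (auto simp: B_def intro: ennreal_leI)
  finally have le: "ennreal c * emeasure lborel U \<le> ennreal B" .
  have U: "U \<in> sets borel"
    unfolding U_def using D(1) by (intro sets.countable_UN') auto
  have fin: "emeasure lborel U < \<infinity>"
    using le c(2) by (auto simp: less_top[symmetric] ennreal_mult_eq_top_iff top_unique)
  have "0 \<le> B"
    by (simp add: B_def)
  have "c * measure lborel U \<le> B"
    using le fin \<open>0 \<le> B\<close> by (simp add: emeasure_eq_ennreal_measure ennreal_mult[symmetric] less_top)
  moreover have "B < c * e" using c e by (simp add: field_simps)
  ultimately have small: "measure lborel U \<le> e"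
    using c by (metis less_eq_real_def mult_le_cancel_left_pos of_nat_0_less_iff order_le_less_trans)
  have Ul: "U \<in> lmeasurable" using U fin by (auto simp: fmeasurable_def)
  have neg: "negligible (S - U)" using D(4) U_eq by simp
  show "\<exists>T. S \<subseteq> T \<and> T \<in> lmeasurable \<and> measure lebesgue T \<le> e"
  proof (intro exI conjI)
    show "S \<subseteq> U \<union> (S - U)" by auto
    show "U \<union> (S - U) \<in> lmeasurable"
      by (intro fmeasurable.Un Ul negligible_imp_measurable neg)
    have "measure lebesgue (U \<union> (S - U)) \<le> measure lebesgue U + measure lebesgue (S - U)"
      using Ul neg by (intro measure_Un_le) (auto simp: negligible_imp_sets fmeasurableD)
    also have "\<dots> \<le> e" using small neg U by (simp add: negligible_imp_measure0)
    finally show "measure lebesgue (U \<union> (S - U)) \<le> e" .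
  qed
qed

text \<open>Independence of increments is given along increasing sequences, so finite sets of times
  have to be listed in increasing order. \<open>idx\<close> recovers the position of a time and
  respects the order.\<close>

lemma finite_enumeration:
  fixes S :: "real set"
  assumes "finite S" "S \<noteq> {}"
  shows "\<exists>n p idx. mono_on {..n::nat} p \<and> p ` {..n} = S \<and> (\<forall>s\<in>S. idx s \<le> n \<and> p (idx s) = s) \<and>
    (\<forall>s\<in>S. \<forall>t\<in>S. s \<le> t \<longrightarrow> idx s \<le> idx t)"
proof -
  define xs where "xs = sorted_list_of_set S"
  have xs: "set xs = S" "sorted xs" using assms by (simp_all add: xs_def)
  then have "xs \<noteq> []" using assms by auto
  then obtain n where n: "length xs = Suc n" by (cases xs) auto
  define idx where "idx s = (SOME i. i < length xs \<and> xs ! i = s)" for s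
  have idx: "idx s < length xs \<and> xs ! idx s = s" if "s \<in> S" for s
    unfolding idx_def by (rule someI_ex) (use that xs in \<open>simp add: in_set_conv_nth[symmetric]\<close>)
  show ?thesis
  proof (intro exI conjI ballI impI)
    show "mono_on {..n} ((!) xs)"
      by (rule mono_onI) (simp add: n sorted_nth_mono[OF xs(2)])
    have "{..n} = {..<length xs}" by (auto simp: n)
    then show "(!) xs ` {..n} = S"
      using xs(1) by (auto simp: set_conv_nth)
    show "idx s \<le> n" "xs ! idx s = s" if "s \<in> S" for s
      using idx[OF that] by (simp_all add: n)
    show "idx s \<le> idx t" if "s \<in> S" "t \<in> S" "s \<le> t" for s t
    proof (rule ccontr)
      assume *: "\<not> idx s \<le> idx t"
      then have "xs ! idx t \<le> xs ! idx s"
        using idx[OF that(1)] by (intro sorted_nth_mono[OF xs(2)]) auto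
      then have "s = t" using idx[OF that(1)] idx[OF that(2)] that(3) by simp
      with * show False by simp
    qed
  qed
qed

lemma borel_measurable_sum_components:
  assumes "I \<subseteq> A"
  shows "(\<lambda>y. \<Sum>i\<in>I. y i :: real) \<in> borel_measurable (PiM A (\<lambda>_. borel))"
proof -
  have "(\<lambda>y. y i) \<in> borel_measurable (PiM A (\<lambda>_. borel :: real measure))" if "i \<in> I" for i
    using that assms by (intro measurable_component_singleton) auto
  then show ?thesis by (rule borel_measurable_sum[of I "\<lambda>i y. y i"])
qed

lemma past_sets_closed:
  assumes "\<And>u. 0 \<le> u \<Longrightarrow> Y u \<in> borel_measurable P"
  shows "{Y u -` B \<inter> space P |u B. 0 \<le> u \<and> ennreal u \<le> t \<and> B \<in> sets borel} \<union> null_sets P \<subseteq> sets P"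
  using assms by (auto intro: measurable_sets)

lemma
  assumes "\<And>u. 0 \<le> u \<Longrightarrow> Y u \<in> borel_measurable P"
  shows sigma_algebra_past_sets: "sigma_algebra (space P) (past_sets P Y t)"
    and past_sets_subset: "past_sets P Y t \<subseteq> sets P"
proof -
  have closed: "{Y u -` B \<inter> space P |u B. 0 \<le> u \<and> ennreal u \<le> t \<and> B \<in> sets borel} \<union> null_sets P
      \<subseteq> sets P"
    using past_sets_closed[of Y P t] assms by blast
  show "past_sets P Y t \<subseteq> sets P"
    unfolding past_sets_def by (rule sets.sigma_sets_subset[OF closed])
  show "sigma_algebra (space P) (past_sets P Y t)"
    unfolding past_sets_def
    by (rule sigma_algebra_sigma_sets) (use closed sets.space_closed in blast)
qed

lemma past_sets_mono: "s \<le> t \<Longrightarrow> past_sets P Y s \<subseteq> past_sets P Y t"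
  unfolding past_sets_def by (intro sigma_sets_mono') (auto intro: order_trans)

section \<open>The law of the increments\<close>

text \<open>Every path is good here, not only almost every one.
  \<open>levy_paths_modification\<close> provides this situation by putting the zero path on a null
  set, which the completeness of \<open>M\<close> makes harmless.\<close>

locale levy_paths = prob_space M for M :: "'a measure" +
  fixes X :: "real \<Rightarrow> 'a \<Rightarrow> real"
  assumes levy: "levy_process M X" and complete: "complete_measure M"
    and good: "\<And>\<omega>. \<omega> \<in> space M \<Longrightarrow> good_path (\<lambda>t. X t \<omega>)"
begin

abbreviation past :: "real \<Rightarrow> 'a set set" where
  "past u \<equiv> past_sets M X (ennreal u)"

definition shift :: "real \<Rightarrow> 'a \<Rightarrow> real \<Rightarrow> real" where
  "shift u \<omega> = (\<lambda>s\<in>{0..}. X (u + s) \<omega> - X u \<omega>)"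

abbreviation path_law :: "(real \<Rightarrow> real) measure" where
  "path_law \<equiv> law M X"

lemma X_measurable: "0 \<le> t \<Longrightarrow> X t \<in> borel_measurable M"
  using levy by (simp add: levy_process_def)

lemma X_0: "\<omega> \<in> space M \<Longrightarrow> X 0 \<omega> = 0"
  using good_path_0[OF good] .

lemma increments_indep:
  "0 \<le> p 0 \<Longrightarrow> mono_on {..n} p \<Longrightarrow>
    indep_vars (\<lambda>_. borel) (\<lambda>i \<omega>. X (p (Suc i)) \<omega> - X (p i) \<omega>) {..<n}"
  using levy by (simp add: levy_process_def)

lemma increments_stationary:
  "0 \<le> s \<Longrightarrow> 0 \<le> t \<Longrightarrow> distr M borel (\<lambda>\<omega>. X (s + t) \<omega> - X s \<omega>) = distr M borel (X t)"
  using levy by (simp add: levy_process_def)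

lemma X_at_measurable:
  "\<sigma> \<in> borel_measurable M \<Longrightarrow> (\<And>\<omega>. \<omega> \<in> space M \<Longrightarrow> 0 \<le> \<sigma> \<omega>) \<Longrightarrow>
    (\<lambda>\<omega>. X (\<sigma> \<omega>) \<omega>) \<in> borel_measurable M"
  by (rule measurable_right_continuous_at)
    (auto intro: X_measurable good_path_right_continuous[OF good])

lemma shift_measurable:
  assumes "\<sigma> \<in> borel_measurable M" "\<And>\<omega>. \<omega> \<in> space M \<Longrightarrow> 0 \<le> \<sigma> \<omega>"
  shows "(\<lambda>\<omega>. shift (\<sigma> \<omega>) \<omega>) \<in> M \<rightarrow>\<^sub>M path_space"
  unfolding shift_def using assms
  by (intro measurable_path_spaceI borel_measurable_diff X_at_measurable borel_measurable_add) auto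

lemma path_measurable: "(\<lambda>\<omega>. \<lambda>t\<in>{0..}. X t \<omega>) \<in> M \<rightarrow>\<^sub>M path_space"
  by (intro measurable_path_spaceI X_measurable)

lemma sets_path_law[simp]: "sets path_law = sets path_space"
  by (simp add: law_def)

lemma space_path_law[simp]: "space path_law = space path_space"
  by (simp add: law_def)

lemma prob_space_path_law: "prob_space path_law"
  unfolding law_def by (intro prob_space_distr path_measurable)

lemma measure_path_law:
  "D \<in> sets path_space \<Longrightarrow> measure path_law D = prob {\<omega>\<in>space M. (\<lambda>t\<in>{0..}. X t \<omega>) \<in> D}"
  unfolding law_def by (subst measure_distr[OF path_measurable]) (auto intro!: arg_cong[where f = prob])

text \<open>Stationarity is given for single increments only. Through independence the joint law of
  the increments over a grid is a product whose factors depend only on the spacings, hence it is the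
  same for the grid moved by \<open>u\<close>.\<close>

lemma shift_box_stationary:
  assumes u: "0 \<le> u" and K: "finite K" "K \<subseteq> {0..}"
  shows "prob {\<omega>\<in>space M. \<forall>s\<in>K. X (u + s) \<omega> - X u \<omega> \<le> b s}
    = prob {\<omega>\<in>space M. \<forall>s\<in>K. X s \<omega> \<le> b s}"
proof -
  \<comment> \<open>Time 0 is inserted so that the grid starts there, time 1 so that there is at
    least one increment: the product characterisation of independence asks for a nonempty index
    set.\<close>
  have fin: "finite ({0, 1} \<union> K)" "{0, 1} \<union> K \<noteq> {}" using K(1) by auto
  obtain n p idx where *: "mono_on {..n::nat} p" "p ` {..n} = {0, 1} \<union> K"
    "\<forall>s\<in>{0, 1} \<union> K. idx s \<le> n \<and> p (idx s) = s"
    using finite_enumeration[OF fin] by blast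
  have p: "mono_on {..n} p" "p ` {..n} = {0, 1} \<union> K"
    "\<And>s. s \<in> {0, 1} \<union> K \<Longrightarrow> idx s \<le> n" "\<And>s. s \<in> {0, 1} \<union> K \<Longrightarrow> p (idx s) = s"
    using * by blast+
  have p_nonneg: "0 \<le> p i" if "i \<le> n" for i
  proof -
    have "p i \<in> {0, 1} \<union> K" using p(2) that by blast
    then show ?thesis using K(2) by auto
  qed
  have p0: "p 0 = 0"
  proof (rule antisym)
    have "p 0 \<le> p (idx 0)" using p(3)[of 0] by (intro mono_onD[OF p(1)]) auto
    then show "p 0 \<le> 0" using p(4)[of 0] by simp
  qed (simp add: p_nonneg)
  have ne: "{..<n} \<noteq> {}"
  proof
    assume "{..<n} = {}"
    then have "n = 0" by auto
    then have "idx 0 = 0" "idx 1 = 0" using p(3)[of 0] p(3)[of 1] by simp_all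
    then show False using p(4)[of 0] p(4)[of 1] by simp
  qed
  define inc where "inc v i \<omega> = X (v + p (Suc i)) \<omega> - X (v + p i) \<omega>" for v i \<omega>
  define E where "E = {y\<in>space (PiM {..<n} (\<lambda>_. borel)). \<forall>s\<in>K. (\<Sum>i<idx s. y i) \<le> b s}"
  have E: "E \<in> sets (PiM {..<n} (\<lambda>_. borel))"
  proof -
    have [measurable]: "(\<lambda>y. \<Sum>i<idx s. y i :: real) \<in> borel_measurable (PiM {..<n} (\<lambda>_. borel))" if "s \<in> K" for s
      using p(3)[of s] that
      by (intro borel_measurable_sum_components) auto
    show ?thesis unfolding E_def using K(1) by measurable
  qed
  have eq: "distr M (PiM {..<n} (\<lambda>_. borel)) (\<lambda>\<omega>. \<lambda>i\<in>{..<n}. inc v i \<omega>)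
      = PiM {..<n} (\<lambda>i. distr M borel (X (p (Suc i) - p i)))" if v: "0 \<le> v" for v
  proof -
    have meas: "inc v i \<in> borel_measurable M" if "i \<in> {..<n}" for i
      unfolding inc_def using v p_nonneg[of i] p_nonneg[of "Suc i"] that
      by (intro borel_measurable_diff X_measurable) auto
    have "indep_vars (\<lambda>_. borel) (inc v) {..<n}"
      unfolding inc_def using v p(1) p0 by (intro increments_indep) (auto simp: mono_on_def)
    then have "distr M (PiM {..<n} (\<lambda>_. borel)) (\<lambda>\<omega>. \<lambda>i\<in>{..<n}. inc v i \<omega>)
        = PiM {..<n} (\<lambda>i. distr M borel (inc v i))"
      using indep_vars_iff_distr_eq_PiM'[where I = "{..<n}" and M' = "\<lambda>_. borel" and X = "inc v"] ne meas by simp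
    also have "\<dots> = PiM {..<n} (\<lambda>i. distr M borel (X (p (Suc i) - p i)))"
    proof (rule PiM_cong)
      fix i assume i: "i \<in> {..<n}"
      have "p i \<le> p (Suc i)" using i by (intro mono_onD[OF p(1)]) auto
      then show "distr M borel (inc v i) = distr M borel (X (p (Suc i) - p i))"
        using increments_stationary[of "v + p i" "p (Suc i) - p i"] v p_nonneg[of i] i
        by (simp add: inc_def[abs_def] add.commute)
    qed simp
    finally show ?thesis .
  qed
  have *: "prob {\<omega>\<in>space M. \<forall>s\<in>K. X (v + s) \<omega> - X v \<omega> \<le> b s}
      = measure (PiM {..<n} (\<lambda>i. distr M borel (X (p (Suc i) - p i)))) E" if v: "0 \<le> v" for v
  proof -
    have meas: "(\<lambda>\<omega>. \<lambda>i\<in>{..<n}. inc v i \<omega>) \<in> M \<rightarrow>\<^sub>M PiM {..<n} (\<lambda>_. borel)"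
    proof (rule measurable_restrict)
      fix i assume "i \<in> {..<n}"
      then show "inc v i \<in> borel_measurable M"
        unfolding inc_def using v p_nonneg[of i] p_nonneg[of "Suc i"]
        by (intro borel_measurable_diff X_measurable) auto
    qed
    have sum: "(\<Sum>i<idx s. (\<lambda>i\<in>{..<n}. inc v i \<omega>) i) = X (v + s) \<omega> - X v \<omega>" if "s \<in> K" for s \<omega>
    proof -
      have "(\<Sum>i<idx s. (\<lambda>i\<in>{..<n}. inc v i \<omega>) i) = (\<Sum>i<idx s. inc v i \<omega>)"
        using p(3)[of s] that by (intro sum.cong) auto
      also have "\<dots> = X (v + p (idx s)) \<omega> - X (v + p 0) \<omega>"
        unfolding inc_def by (rule sum_lessThan_telescope)
      finally show ?thesis using p(4)[of s] that p0 by simp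
    qed
    have "{\<omega>\<in>space M. \<forall>s\<in>K. X (v + s) \<omega> - X v \<omega> \<le> b s}
        = (\<lambda>\<omega>. \<lambda>i\<in>{..<n}. inc v i \<omega>) -` E \<inter> space M"
      using sum by (auto simp: E_def space_PiM)
    then show ?thesis
      unfolding eq[OF v, symmetric] by (simp add: measure_distr[OF meas E])
  qed
  have "prob {\<omega>\<in>space M. \<forall>s\<in>K. X s \<omega> \<le> b s} = prob {\<omega>\<in>space M. \<forall>s\<in>K. X (0 + s) \<omega> - X 0 \<omega> \<le> b s}"
    by (intro arg_cong[where f = prob]) (auto simp: X_0)
  then show ?thesis using *[OF u] *[of 0] by simp
qed

text \<open>All times, including 0 and \<open>u\<close>, are put on one grid and the increments are
  cut at the position of \<open>u\<close>. Values up to \<open>u\<close> are partial sums of the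
  first block, increments after \<open>u\<close> are partial sums of the second, and the blocks are
  independent.\<close>

lemma past_indep_box:
  assumes u: "0 \<le> u" and J: "finite J" "J \<subseteq> {0..u}" "\<And>r. r \<in> J \<Longrightarrow> B r \<in> sets borel"
    and K: "finite K" "K \<subseteq> {0..}"
  shows "prob {\<omega>\<in>space M. (\<forall>r\<in>J. X r \<omega> \<in> B r) \<and> (\<forall>s\<in>K. X (u + s) \<omega> - X u \<omega> \<le> b s)}
    = prob {\<omega>\<in>space M. \<forall>r\<in>J. X r \<omega> \<in> B r} * prob {\<omega>\<in>space M. \<forall>s\<in>K. X (u + s) \<omega> - X u \<omega> \<le> b s}"
proof -
  define S where "S = {0, u} \<union> J \<union> (+) u ` K"
  have S: "finite S" "S \<noteq> {}" "0 \<in> S" "u \<in> S" "\<And>r. r \<in> J \<Longrightarrow> r \<in> S" "\<And>s. s \<in> K \<Longrightarrow> u + s \<in> S"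
    using J K by (auto simp: S_def)
  have S_nonneg: "0 \<le> s" if "s \<in> S" for s using that u J(2) K(2) by (auto simp: S_def)
  obtain n p idx where *: "mono_on {..n::nat} p" "p ` {..n} = S"
    "\<forall>s\<in>S. idx s \<le> n \<and> p (idx s) = s" "\<forall>s\<in>S. \<forall>t\<in>S. s \<le> t \<longrightarrow> idx s \<le> idx t"
    using finite_enumeration[OF S(1,2)] by blast
  have p: "mono_on {..n} p" "p ` {..n} = S"
    "\<And>s. s \<in> S \<Longrightarrow> idx s \<le> n" "\<And>s. s \<in> S \<Longrightarrow> p (idx s) = s"
    "\<And>s t. s \<in> S \<Longrightarrow> t \<in> S \<Longrightarrow> s \<le> t \<Longrightarrow> idx s \<le> idx t"
    using * by blast+
  have p_nonneg: "0 \<le> p i" if "i \<le> n" for i using p(2) that by (intro S_nonneg) auto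
  have p0: "p 0 = 0"
  proof (rule antisym)
    have "p 0 \<le> p (idx 0)" using p(3)[of 0] S by (intro mono_onD[OF p(1)]) auto
    then show "p 0 \<le> 0" using p(4)[of 0] S by simp
  qed (simp add: p_nonneg)
  define m where "m = idx u"
  have m: "m \<le> n" "p m = u" using p(3,4) S by (auto simp: m_def)
  define inc where "inc i \<omega> = X (p (Suc i)) \<omega> - X (p i) \<omega>" for i \<omega>
  have ind: "indep_vars (\<lambda>_. borel) inc {..<n}"
    unfolding inc_def using p(1) p0 by (intro increments_indep) auto
  define L where "L = PiM {..<m} (\<lambda>_. borel :: real measure)"
  define R where "R = PiM {m..<n} (\<lambda>_. borel :: real measure)"
  define EL where "EL = {y\<in>space L. \<forall>r\<in>J. (\<Sum>i<idx r. y i) \<in> B r}"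
  define ER where "ER = {y\<in>space R. \<forall>s\<in>K. (\<Sum>i=m..<idx (u + s). y i) \<le> b s}"
  have J_idx: "idx r \<le> m" if "r \<in> J" for r
    using that J(2) S unfolding m_def by (intro p(5)) auto
  have K_idx: "m \<le> idx (u + s)" "idx (u + s) \<le> n" if "s \<in> K" for s
    using that K(2) S unfolding m_def by (auto intro!: p(5) p(3))
  have EL: "EL \<in> sets L"
  proof -
    have [measurable]: "(\<lambda>y. \<Sum>i<idx r. y i :: real) \<in> borel_measurable L" if "r \<in> J" for r
      unfolding L_def using J_idx[OF that]
      by (intro borel_measurable_sum_components) auto
    note J(3)[measurable]
    show ?thesis unfolding EL_def using J(1) by measurable
  qed
  have ER: "ER \<in> sets R"
  proof -
    have [measurable]: "(\<lambda>y. \<Sum>i=m..<idx (u + s). y i :: real) \<in> borel_measurable R" if "s \<in> K" for s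
      unfolding R_def using K_idx[OF that]
      by (intro borel_measurable_sum_components) auto
    show ?thesis unfolding ER_def using K(1) by measurable
  qed
  let ?l = "\<lambda>\<omega>. restrict (\<lambda>i. inc i \<omega>) {..<m}" and ?r = "\<lambda>\<omega>. restrict (\<lambda>i. inc i \<omega>) {m..<n}"
  have indep: "indep_var L ?l R ?r"
    unfolding L_def R_def using m by (intro indep_var_restrict[OF ind]) auto
  have l: "(\<Sum>i<idx r. ?l \<omega> i) = X r \<omega>" if "r \<in> J" "\<omega> \<in> space M" for r \<omega>
  proof -
    have "(\<Sum>i<idx r. ?l \<omega> i) = (\<Sum>i<idx r. inc i \<omega>)"
      using J_idx[OF that(1)] by (intro sum.cong) auto
    also have "\<dots> = X (p (idx r)) \<omega> - X (p 0) \<omega>"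
      unfolding inc_def by (rule sum_lessThan_telescope)
    finally show ?thesis using p(4)[of r] S that p0 by (simp add: X_0)
  qed
  have r: "(\<Sum>i=m..<idx (u + s). ?r \<omega> i) = X (u + s) \<omega> - X u \<omega>" if "s \<in> K" for s \<omega>
  proof -
    have "(\<Sum>i=m..<idx (u + s). ?r \<omega> i) = (\<Sum>i=m..<idx (u + s). inc i \<omega>)"
      using K_idx[OF that] by (intro sum.cong) auto
    also have "\<dots> = X (p (idx (u + s))) \<omega> - X (p m) \<omega>"
      unfolding inc_def using K_idx[OF that] by (intro sum_Suc_diff')
    finally show ?thesis using p(4)[of "u + s"] S that m by simp
  qed
  have "?l -` EL \<inter> space M = {\<omega>\<in>space M. \<forall>r\<in>J. X r \<omega> \<in> B r}"
    using l by (auto simp: EL_def L_def space_PiM)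
  moreover have "?r -` ER \<inter> space M = {\<omega>\<in>space M. \<forall>s\<in>K. X (u + s) \<omega> - X u \<omega> \<le> b s}"
    using r by (auto simp: ER_def R_def space_PiM)
  moreover have "(\<lambda>\<omega>. (?l \<omega>, ?r \<omega>)) -` (EL \<times> ER) \<inter> space M
      = (?l -` EL \<inter> space M) \<inter> (?r -` ER \<inter> space M)"
    by auto
  ultimately show ?thesis
    using indep_varD[OF indep EL ER] by (simp add: Collect_conj_eq[symmetric] Int_def conj_ac) 
qed


text \<open>For fixed \<open>A\<close> both sides are finite measures in \<open>D\<close>, so
  agreement on boxes is enough. It is used with the shift at a fixed time and at a random
  one.\<close>

lemma prob_shift_eqI:
  assumes A: "A \<in> events" and Y: "Y \<in> M \<rightarrow>\<^sub>M path_space"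
    and box: "\<And>J b. finite J \<Longrightarrow> J \<subseteq> {0..} \<Longrightarrow>
      prob (A \<inter> {\<omega>\<in>space M. \<forall>j\<in>J. Y \<omega> j \<le> b j}) = prob A * prob {\<omega>\<in>space M. \<forall>j\<in>J. X j \<omega> \<le> b j}"
    and D: "D \<in> sets path_space"
  shows "prob (A \<inter> {\<omega>\<in>space M. Y \<omega> \<in> D}) = prob A * measure path_law D"
proof -
  interpret path: prob_space path_law by (rule prob_space_path_law)
  define \<mu> where "\<mu> = distr (density M (indicator A)) path_space Y"
  define \<nu> where "\<nu> = scale_measure (ennreal (prob A)) path_law"
  have Y': "Y \<in> density M (indicator A) \<rightarrow>\<^sub>M path_space" using Y by simp
  have \<mu>: "emeasure \<mu> B = ennreal (prob (A \<inter> {\<omega>\<in>space M. Y \<omega> \<in> B}))" if B: "B \<in> sets path_space" for B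
  proof -
    have "emeasure \<mu> B = emeasure (density M (indicator A)) (Y -` B \<inter> space M)"
      unfolding \<mu>_def using B Y' by (subst emeasure_distr) auto
    also have "\<dots> = (\<integral>\<^sup>+\<omega>. indicator (A \<inter> {\<omega>\<in>space M. Y \<omega> \<in> B}) \<omega> \<partial>M)"
      using measurable_sets[OF Y B] A
      by (subst emeasure_density) (auto intro!: nn_integral_cong simp: indicator_def)
    also have "\<dots> = emeasure M (A \<inter> {\<omega>\<in>space M. Y \<omega> \<in> B})"
      using measurable_sets[OF Y B] A by (intro nn_integral_indicator) (auto simp: vimage_def Int_def conj_ac)
    finally show ?thesis by (simp add: emeasure_eq_measure)
  qed
  have \<nu>: "emeasure \<nu> B = ennreal (prob A * measure path_law B)" for B
    by (simp add: \<nu>_def path.emeasure_eq_measure ennreal_mult)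
  have "\<mu> = \<nu>"
  proof (rule path_measure_eqI)
    show "sets \<mu> = sets path_space" "sets \<nu> = sets path_space" by (simp_all add: \<mu>_def \<nu>_def)
    show "finite_measure \<mu>"
    proof (rule finite_measureI)
      have "emeasure \<mu> (space path_space) \<noteq> \<infinity>" by (subst \<mu>) auto
      then show "emeasure \<mu> (space \<mu>) \<noteq> \<infinity>" by (simp add: \<mu>_def)
    qed
    fix J :: "real set" and b :: "real \<Rightarrow> real" assume J: "finite J" "J \<subseteq> {0..}"
    let ?B = "{x\<in>space path_space. \<forall>j\<in>J. x j \<le> b j}"
    have [measurable]: "(\<lambda>x. x j) \<in> borel_measurable path_space" if "j \<in> J" for j
      using that J by (intro measurable_path_component) auto
    have B: "?B \<in> sets path_space" using J(1) by measurable
    have "{\<omega>\<in>space M. Y \<omega> \<in> ?B} = {\<omega>\<in>space M. \<forall>j\<in>J. Y \<omega> j \<le> b j}"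
      using measurable_space[OF Y] by auto
    moreover have "{\<omega>\<in>space M. (\<lambda>t\<in>{0..}. X t \<omega>) \<in> ?B} = {\<omega>\<in>space M. \<forall>j\<in>J. X j \<omega> \<le> b j}"
      using measurable_space[OF path_measurable] J by (auto simp: subset_iff)
    ultimately show "emeasure \<mu> ?B = emeasure \<nu> ?B"
      using box[OF J] by (simp add: \<mu>[OF B] \<nu> measure_path_law[OF B])
  qed
  then show ?thesis using \<mu>[OF D] \<nu>[of D] by simp
qed

text \<open>The generator must absorb the null sets contained in \<open>past_sets\<close>, so
  \<open>E\<close> collects the events that agree almost surely with a cylinder over finitely many
  times up to \<open>u\<close>. On \<open>E\<close> the formula comes from boxes; \<open>E\<close>
  is intersection-stable, and induction over disjoint unions reaches all of
  \<open>past u\<close>.\<close>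

lemma simple_markov:
  assumes u: "0 \<le> u" and A: "A \<in> past u" and D: "D \<in> sets path_space"
  shows "prob (A \<inter> {\<omega>\<in>space M. shift u \<omega> \<in> D}) = prob A * measure path_law D"
proof -
  interpret complete_measure M by (rule complete)
  interpret path: prob_space path_law by (rule prob_space_path_law)
  define rep where "rep A J B \<longleftrightarrow> finite J \<and> J \<subseteq> {0..u} \<and> (\<forall>r\<in>J. B r \<in> sets borel) \<and>
    (AE \<omega> in M. \<omega> \<in> A \<longleftrightarrow> (\<forall>r\<in>J. X r \<omega> \<in> B r))" for A J B
  define E where "E = {A\<in>events. \<exists>J B. rep A J B}"
  have Y: "shift u \<in> M \<rightarrow>\<^sub>M path_space"
    using shift_measurable[of "\<lambda>_. u"] u by simp
  let ?D = "{\<omega>\<in>space M. shift u \<omega> \<in> D}"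
  have D': "?D \<in> events" using measurable_sets[OF Y D] by (simp add: vimage_def Int_def conj_ac)
  have on_E: "prob (A \<inter> ?D) = prob A * measure path_law D" if AE: "A \<in> E" for A
  proof -
    obtain J B where "A \<in> events" and rep: "rep A J B" using AE unfolding E_def by blast
    have J: "finite J" "J \<subseteq> {0..u}" "\<And>r. r \<in> J \<Longrightarrow> B r \<in> sets borel"
      and ae: "AE \<omega> in M. \<omega> \<in> A \<longleftrightarrow> (\<forall>r\<in>J. X r \<omega> \<in> B r)"
      using rep by (simp_all add: rep_def)
    have [measurable]: "X r \<in> borel_measurable M" if "r \<in> J" for r
      using that J(2) by (intro X_measurable) auto
    note J(3)[measurable]
    let ?A = "{\<omega>\<in>space M. \<forall>r\<in>J. X r \<omega> \<in> B r}"
    have A': "?A \<in> events" using J(1) by measurable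
    have ae': "AE \<omega> in M. \<omega> \<in> A \<inter> C \<longleftrightarrow> \<omega> \<in> ?A \<inter> C" for C
      using ae AE_space[of M] by eventually_elim simp
    have "prob (?A \<inter> ?D) = prob ?A * measure path_law D"
    proof (rule prob_shift_eqI[OF A' Y _ D])
      fix K :: "real set" and b assume K: "finite K" "K \<subseteq> {0..}"
      have "{\<omega>\<in>space M. \<forall>j\<in>K. shift u \<omega> j \<le> b j} = {\<omega>\<in>space M. \<forall>s\<in>K. X (u + s) \<omega> - X u \<omega> \<le> b s}"
        using K(2) by (auto simp: shift_def subset_iff)
      moreover have "?A \<inter> {\<omega>\<in>space M. \<forall>s\<in>K. X (u + s) \<omega> - X u \<omega> \<le> b s}
          = {\<omega>\<in>space M. (\<forall>r\<in>J. X r \<omega> \<in> B r) \<and> (\<forall>s\<in>K. X (u + s) \<omega> - X u \<omega> \<le> b s)}"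
        by auto
      ultimately show "prob (?A \<inter> {\<omega>\<in>space M. \<forall>j\<in>K. shift u \<omega> j \<le> b j})
          = prob ?A * prob {\<omega>\<in>space M. \<forall>j\<in>K. X j \<omega> \<le> b j}"
        using past_indep_box[OF u J K] shift_box_stationary[OF u K] by simp
    qed
    moreover have "prob (A \<inter> ?D) = prob (?A \<inter> ?D)"
      by (rule finite_measure_eq_AE[OF ae']) (use \<open>A \<in> events\<close> A' D' in blast)+
    moreover have "prob A = prob ?A"
      using finite_measure_eq_AE[OF ae'[of UNIV]] \<open>A \<in> events\<close> A' by simp
    ultimately show ?thesis by simp
  qed
  have E: "E \<subseteq> Pow (space M)"
    using sets.space_closed[of M] unfolding E_def by blast
  have "Int_stable E"
  proof (rule Int_stableI)
    fix A A' assume "A \<in> E" "A' \<in> E"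
    then obtain J B J' B' where ev: "A \<in> events" "A' \<in> events" and rep: "rep A J B" "rep A' J' B'"
      unfolding E_def by blast
    have ae: "AE \<omega> in M. \<omega> \<in> A \<longleftrightarrow> (\<forall>r\<in>J. X r \<omega> \<in> B r)"
      "AE \<omega> in M. \<omega> \<in> A' \<longleftrightarrow> (\<forall>r\<in>J'. X r \<omega> \<in> B' r)"
      using rep by (simp_all add: rep_def)
    define C where "C r = (if r \<in> J then if r \<in> J' then B r \<inter> B' r else B r else B' r)" for r
    have "AE \<omega> in M. \<omega> \<in> A \<inter> A' \<longleftrightarrow> (\<forall>r\<in>J \<union> J'. X r \<omega> \<in> C r)"
      using ae by eventually_elim (auto simp: C_def)
    then have "rep (A \<inter> A') (J \<union> J') C"
      using rep by (auto simp: rep_def C_def)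
    then show "A \<inter> A' \<in> E" unfolding E_def using ev by blast
  qed
  have "past u \<subseteq> sigma_sets (space M) E"
    unfolding past_sets_def
  proof (rule sigma_sets_mono', safe)
    fix r B assume r: "0 \<le> r" "ennreal r \<le> ennreal u" and B: "B \<in> sets (borel :: real measure)"
    have "r \<le> u" using r u by (simp add: ennreal_le_iff)
    moreover have "AE \<omega> in M. \<omega> \<in> X r -` B \<inter> space M \<longleftrightarrow> (\<forall>r'\<in>{r}. X r' \<omega> \<in> (\<lambda>_. B) r')"
      using AE_space[of M] by eventually_elim simp
    moreover have "X r -` B \<inter> space M \<in> events" using measurable_sets[OF X_measurable[OF r(1)] B] .
    ultimately have "rep (X r -` B \<inter> space M) {r} (\<lambda>_. B)" "X r -` B \<inter> space M \<in> events"
      using r B by (simp_all add: rep_def)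
    then show "X r -` B \<inter> space M \<in> E" unfolding E_def by blast
  next
    \<comment> \<open>A null set agrees almost surely with the empty cylinder, obtained by asking
      \<open>X 0\<close> to lie in the empty set.\<close>
    fix N assume N: "N \<in> null_sets M"
    then have "AE \<omega> in M. \<omega> \<in> N \<longleftrightarrow> (\<forall>r\<in>{0}. X r \<omega> \<in> (\<lambda>_. {}) r)"
      using AE_not_in[OF N] by simp
    then have "rep N {0} (\<lambda>_. {})" using u by (simp add: rep_def)
    then show "N \<in> E" unfolding E_def using N by blast
  qed
  with A have A: "A \<in> sigma_sets (space M) E" by blast
  have E_events: "sigma_sets (space M) E \<subseteq> events"
    by (rule sets.sigma_sets_subset) (simp add: E_def Collect_subset)
  show ?thesis
    using \<open>Int_stable E\<close> E A
  proof (induction rule: sigma_sets_induct_disjoint)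
    case (basic A)
    then show ?case by (rule on_E)
  next
    case empty
    show ?case by simp
  next
    case (compl A)
    have "A \<in> events" using compl(1) E_events by blast
    have "rep (space M) {0} (\<lambda>_. UNIV)" using u by (simp add: rep_def)
    then have "space M \<in> E" unfolding E_def by blast
    then have "prob (space M \<inter> ?D) = prob (space M) * measure path_law D" by (rule on_E)
    moreover have "space M \<inter> ?D = ?D" by blast
    ultimately have PD: "prob ?D = measure path_law D" by (simp only: prob_space mult_1)
    have "(space M - A) \<inter> ?D = ?D - A \<inter> ?D" by blast
    then have "prob ((space M - A) \<inter> ?D) = prob (?D - A \<inter> ?D)" by (rule arg_cong)
    also have "\<dots> = prob ?D - prob (A \<inter> ?D)"
      using \<open>A \<in> events\<close> D' by (intro finite_measure_Diff) auto
    also have "\<dots> = (1 - prob A) * measure path_law D"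
      unfolding PD compl(2) by (simp add: left_diff_distrib)
    also have "1 - prob A = prob (space M - A)" using \<open>A \<in> events\<close> by (simp only: prob_compl)
    finally show ?case .
  next
    case (union A)
    have A: "range A \<subseteq> events" using union(2) E_events by (rule order_trans)
    have disj: "disjoint_family (\<lambda>i. A i \<inter> ?D)"
      using union(1) by (auto simp: disjoint_family_on_def)
    have "range (\<lambda>i. A i \<inter> ?D) \<subseteq> events"
    proof (rule image_subsetI)
      fix i show "A i \<inter> ?D \<in> events" using A D' by (intro sets.Int) (simp_all add: image_subset_iff)
    qed
    then have "(\<lambda>i. prob (A i \<inter> ?D)) sums prob (\<Union>i. A i \<inter> ?D)"
      using disj by (rule finite_measure_UNION)
    moreover have "(\<lambda>i. prob (A i) * measure path_law D) sums (prob (\<Union>i. A i) * measure path_law D)"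
      by (intro sums_mult2 finite_measure_UNION A union(1))
    ultimately have "prob (\<Union>i. A i \<inter> ?D) = prob (\<Union>i. A i) * measure path_law D"
      by (intro sums_unique2) (simp_all only: union(3))
    moreover have "(\<Union>i. A i) \<inter> ?D = (\<Union>i. A i \<inter> ?D)" by (simp only: UN_simps(4))
    ultimately show ?case by (simp only:)
  qed
qed

text \<open>Passage from sets to functions. It is needed because the approximation of random times
  converges only when tested against continuous functions of the coordinates.\<close>

lemma integral_split_law:
  assumes A: "A \<in> events" and Y: "Y \<in> M \<rightarrow>\<^sub>M path_space" and g: "g \<in> borel_measurable path_space"
    and split: "\<And>D. D \<in> sets path_space \<Longrightarrow>
      prob (A \<inter> {\<omega>\<in>space M. Y \<omega> \<in> D}) = prob A * measure path_law D"
  shows "(\<integral>\<omega>. indicat_real A \<omega> * g (Y \<omega>) \<partial>M) = prob A * (\<integral>x. g x \<partial>path_law)"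
proof -
  interpret path: prob_space path_law by (rule prob_space_path_law)
  have *: "distr (density M (\<lambda>\<omega>. ennreal (indicat_real A \<omega>))) path_space Y
      = density path_law (\<lambda>_. ennreal (prob A))"
  proof (rule measure_eqI)
    fix D assume "D \<in> sets (distr (density M (\<lambda>\<omega>. ennreal (indicat_real A \<omega>))) path_space Y)"
    then have D: "D \<in> sets path_space" by simp
    have "emeasure (distr (density M (\<lambda>\<omega>. ennreal (indicat_real A \<omega>))) path_space Y) D
        = emeasure (density M (\<lambda>\<omega>. ennreal (indicat_real A \<omega>))) (Y -` D \<inter> space M)"
      using D Y by (subst emeasure_distr) auto
    also have "\<dots> = (\<integral>\<^sup>+\<omega>. indicator (A \<inter> {\<omega>\<in>space M. Y \<omega> \<in> D}) \<omega> \<partial>M)"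
      using measurable_sets[OF Y D] A
      by (subst emeasure_density) (auto intro!: nn_integral_cong simp: indicator_def)
    also have "\<dots> = emeasure M (A \<inter> {\<omega>\<in>space M. Y \<omega> \<in> D})"
      using measurable_sets[OF Y D] A by (intro nn_integral_indicator) (auto simp: vimage_def Int_def conj_ac)
    also have "\<dots> = ennreal (prob A) * emeasure path_law D"
      using split[OF D] by (simp add: emeasure_eq_measure path.emeasure_eq_measure ennreal_mult)
    finally show "emeasure (distr (density M (\<lambda>\<omega>. ennreal (indicat_real A \<omega>))) path_space Y) D
        = emeasure (density path_law (\<lambda>_. ennreal (prob A))) D"
      using D by (simp add: emeasure_density_const)
  qed simp
  have "(\<integral>\<omega>. indicat_real A \<omega> * g (Y \<omega>) \<partial>M)
      = (\<integral>\<omega>. g (Y \<omega>) \<partial>density M (\<lambda>\<omega>. ennreal (indicat_real A \<omega>)))"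
    using A Y g by (subst integral_density) (auto intro: measurable_compose)
  also have "\<dots> = (\<integral>x. g x \<partial>distr (density M (\<lambda>\<omega>. ennreal (indicat_real A \<omega>))) path_space Y)"
    using Y g by (subst integral_distr) auto
  also have "\<dots> = prob A * (\<integral>x. g x \<partial>path_law)"
    unfolding * using g by (subst integral_density) (auto simp: cong: measurable_cong_sets)
  finally show ?thesis .
qed

text \<open>A product of ramps: 1 on the box, 0 as soon as some coordinate exceeds its bound by 1 /
  m. It is continuous in the coordinates, so it survives the limit in the random time, which the
  indicator of the box would not.\<close>

definition box_approx :: "real set \<Rightarrow> (real \<Rightarrow> real) \<Rightarrow> nat \<Rightarrow> (real \<Rightarrow> real) \<Rightarrow> real" where
  "box_approx J b m x = (\<Prod>j\<in>J. max 0 (min 1 (1 - real m * (x j - b j))))"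

lemma box_approx_bounds: "0 \<le> box_approx J b m x" "box_approx J b m x \<le> 1"
  unfolding box_approx_def by (rule prod_nonneg, simp) (rule prod_le_1, simp)

lemma box_approx_measurable:
  assumes "J \<subseteq> {0..}" shows "box_approx J b m \<in> borel_measurable path_space"
proof -
  have [measurable]: "(\<lambda>x. x j) \<in> borel_measurable path_space" if "j \<in> J" for j
    using that assms by (intro measurable_path_component) auto
  show ?thesis
    unfolding box_approx_def[abs_def]
    by (intro borel_measurable_prod borel_measurable_max borel_measurable_min borel_measurable_diff
        borel_measurable_times borel_measurable_const) simp
qed

lemma box_approx_LIMSEQ:
  assumes "finite J"
  shows "(\<lambda>m. box_approx J b m x) \<longlonglongrightarrow> (if \<forall>j\<in>J. x j \<le> b j then 1 else 0)"
proof -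
  have "(\<lambda>m. max 0 (min 1 (1 - real m * (x j - b j)))) \<longlonglongrightarrow> (if x j \<le> b j then 1 else 0)" for j
  proof (cases "x j \<le> b j")
    case True
    then have "max 0 (min 1 (1 - real m * (x j - b j))) = 1" for m
      using mult_nonneg_nonpos[of "real m" "x j - b j"] by simp
    then show ?thesis using True by simp
  next
    case False
    then obtain k :: nat where k: "1 / (x j - b j) < real k" using reals_Archimedean2 by blast
    have "max 0 (min 1 (1 - real m * (x j - b j))) = 0" if "k \<le> m" for m
    proof -
      have "1 / (x j - b j) < real m" using k that by (meson less_le_trans of_nat_le_iff)
      then have "1 < real m * (x j - b j)" using False by (simp add: field_simps)
      then show ?thesis by simp
    qed
    then have "\<forall>\<^sub>F m in sequentially. max 0 (min 1 (1 - real m * (x j - b j))) = 0"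
      unfolding eventually_sequentially by blast
    then show ?thesis using False by (simp add: tendsto_eventually)
  qed
  then have "(\<lambda>m. box_approx J b m x) \<longlonglongrightarrow> (\<Prod>j\<in>J. if x j \<le> b j then 1 else 0)"
    unfolding box_approx_def by (intro tendsto_prod)
  also have "(\<Prod>j\<in>J. if x j \<le> b j then 1 else 0) = (if \<forall>j\<in>J. x j \<le> b j then 1 else 0 :: real)"
  proof (cases "\<forall>j\<in>J. x j \<le> b j")
    case False
    then obtain j where "j \<in> J" "\<not> x j \<le> b j" by blast
    then have "(\<Prod>j\<in>J. if x j \<le> b j then 1 else 0 :: real) = 0"
      using assms by (intro prod_zero) auto
    then show ?thesis using False by simp
  qed simp
  finally show ?thesis .
qed

lemma past_subset: "past u \<subseteq> events"
  using past_sets_subset[of X M] X_measurable by blast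

end

section \<open>Strong Markov property of the driving process at optional times\<close>

context levy_paths
begin

text \<open>Approximation of \<open>S\<close> from above by grid times, where
  \<open>simple_markov\<close> applies piece by piece, followed by two limits: in the mesh by right
  continuity, and from ramps to box indicators. The condition is on the strict events
  \<open>S < u\<close>, as passage times and clocks supply it, and the set \<open>A\<close> allows
  times that are defined on a part of the space only.\<close>

lemma strong_markov:
  assumes A: "A \<subseteq> space M" and S: "\<And>\<omega>. \<omega> \<in> A \<Longrightarrow> 0 \<le> S \<omega>"
    and opt: "\<And>u. 0 < u \<Longrightarrow> {\<omega>\<in>A. S \<omega> < u} \<in> past u"
    and D: "D \<in> sets path_space"
  shows "A \<in> events"
    and "prob (A \<inter> {\<omega>\<in>space M. shift (S \<omega>) \<omega> \<in> D}) = prob A * measure path_law D"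
proof -
  interpret path: prob_space path_law by (rule prob_space_path_law)
  have opt': "{\<omega>\<in>A. S \<omega> < u} \<in> events" for u
  proof (cases "0 < u")
    case True
    then show ?thesis using opt past_subset by blast
  next
    case False
    then have "{\<omega>\<in>A. S \<omega> < u} = {}" using S by force
    then show ?thesis by (metis sets.empty_sets)
  qed
  have "A = (\<Union>n. {\<omega>\<in>A. S \<omega> < real n})" using reals_Archimedean2 by blast
  also have "\<dots> \<in> events" using opt' by (intro sets.countable_UN) auto
  finally show A_ev: "A \<in> events" .
  \<comment> \<open>Outside \<open>A\<close> the value 0 is a mere default that makes the time total
    and measurable; every event considered below lies inside \<open>A\<close>.\<close>
  define \<sigma> where "\<sigma> \<omega> = (if \<omega> \<in> A then S \<omega> else 0)" for \<omega>
  have \<sigma>_nonneg: "0 \<le> \<sigma> \<omega>" for \<omega> using S by (simp add: \<sigma>_def)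
  have \<sigma>: "\<sigma> \<in> borel_measurable M"
  proof (rule borel_measurableI_less)
    fix u :: real
    have "{\<omega>\<in>space M. \<sigma> \<omega> < u} = {\<omega>\<in>A. S \<omega> < u} \<union> (if 0 < u then space M - A else {})"
      using A by (auto simp: \<sigma>_def)
    then show "{\<omega>\<in>space M. \<sigma> \<omega> < u} \<in> events" using opt' A_ev by simp
  qed
  have step_nonneg: "0 \<le> step_above n (\<sigma> \<omega>)" for n \<omega>
    using step_above_bounds(1)[of "\<sigma> \<omega>" n] \<sigma>_nonneg[of \<omega>] by simp
  have step: "(\<lambda>\<omega>. step_above n (\<sigma> \<omega>)) \<in> borel_measurable M" for n
    using \<sigma> unfolding step_above_def by measurable
  note Yn = shift_measurable[OF step step_nonneg] and Y = shift_measurable[OF \<sigma> \<sigma>_nonneg]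
  \<comment> \<open>On the piece \<open>B k\<close> the time \<open>S\<close> lies in [k / N, (k +
    1) / N), so the grid time is the constant \<open>v k\<close>; the piece belongs to the past of
    \<open>v k\<close> because it is cut out by two strict inequalities with bounds up to
    \<open>v k\<close>.\<close>
  have disc: "prob (A \<inter> {\<omega>\<in>space M. shift (step_above n (\<sigma> \<omega>)) \<omega> \<in> D}) = prob A * measure path_law D"
    if D: "D \<in> sets path_space" for n D
  proof -
    define N where "N = real (Suc n)"
    have N: "0 < N" by (simp add: N_def)
    define v where "v k = (real k + 1) / N" for k
    define B where "B k = {\<omega>\<in>A. S \<omega> < v k} - {\<omega>\<in>A. S \<omega> < real k / N}" for k
    let ?D = "\<lambda>k. {\<omega>\<in>space M. shift (v k) \<omega> \<in> D}"
    have v: "0 < v k" for k using N by (simp add: v_def)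
    have past: "B k \<in> past (v k)" for k
    proof -
      interpret sigma_algebra "space M" "past (v k)"
        using sigma_algebra_past_sets[of X M] X_measurable by blast
      have "{\<omega>\<in>A. S \<omega> < real k / N} \<in> past (v k)"
      proof (cases "k = 0")
        case True
        then have "{\<omega>\<in>A. S \<omega> < real k / N} = {}" using S by force
        then show ?thesis by (metis empty_sets)
      next
        case False
        then have "{\<omega>\<in>A. S \<omega> < real k / N} \<in> past (real k / N)" using N by (intro opt) simp
        moreover have "past (real k / N) \<subseteq> past (v k)"
          using N by (intro past_sets_mono ennreal_leI) (simp add: v_def divide_right_mono)
        ultimately show ?thesis by blast
      qed
      then show ?thesis unfolding B_def using opt[OF v] by (intro Diff)
    qed
    have B_iff: "\<omega> \<in> B k \<longleftrightarrow> \<omega> \<in> A \<and> \<lfloor>N * S \<omega>\<rfloor> = int k" for \<omega> k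
      using N by (auto simp: B_def v_def floor_eq_iff field_simps not_less)
    have B_ev: "range B \<subseteq> events" using past past_subset by blast
    have disj: "disjoint_family B" by (auto simp: disjoint_family_on_def B_iff)
    have UN: "(\<Union>k. B k) = A"
    proof
      show "A \<subseteq> (\<Union>k. B k)"
      proof
        fix \<omega> assume "\<omega> \<in> A"
        then have "0 \<le> N * S \<omega>" using S N by simp
        then have "\<lfloor>N * S \<omega>\<rfloor> = int (nat \<lfloor>N * S \<omega>\<rfloor>)" by simp
        then show "\<omega> \<in> (\<Union>k. B k)" using \<open>\<omega> \<in> A\<close> B_iff by blast
      qed
    qed (auto simp: B_iff)
    have D_ev: "?D k \<in> events" for k
      using measurable_sets[OF shift_measurable[of "\<lambda>_. v k"] D] v[of k]
      by (simp add: vimage_def Int_def conj_ac)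
    have "A \<inter> {\<omega>\<in>space M. shift (step_above n (\<sigma> \<omega>)) \<omega> \<in> D} = (\<Union>k. B k \<inter> ?D k)"
    proof -
      have "step_above n (\<sigma> \<omega>) = v k" if "\<omega> \<in> B k" for \<omega> k
        using that unfolding B_iff step_above_def by (simp add: v_def \<sigma>_def N_def)
      then show ?thesis unfolding UN[symmetric] by auto
    qed
    moreover have "(\<lambda>k. prob (B k \<inter> ?D k)) sums prob (\<Union>k. B k \<inter> ?D k)"
    proof (rule finite_measure_UNION)
      show "range (\<lambda>k. B k \<inter> ?D k) \<subseteq> events" using B_ev D_ev by blast
      show "disjoint_family (\<lambda>k. B k \<inter> ?D k)" using disj by (auto simp: disjoint_family_on_def)
    qed
    moreover have "prob (B k \<inter> ?D k) = prob (B k) * measure path_law D" for k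
      using v[of k] by (intro simple_markov past D) simp
    moreover have "(\<lambda>k. prob (B k) * measure path_law D) sums (prob (\<Union>k. B k) * measure path_law D)"
      by (intro sums_mult2 finite_measure_UNION B_ev disj)
    ultimately show ?thesis using sums_unique2 UN by simp
  qed
  have cont: "(\<lambda>n. shift (step_above n s) \<omega> j) \<longlonglongrightarrow> shift s \<omega> j"
    if \<omega>: "\<omega> \<in> space M" and s: "0 \<le> s" and j: "0 \<le> j" for \<omega> s j
  proof -
    have "((\<lambda>r. X r \<omega>) \<longlongrightarrow> X (j + s) \<omega>) (at_right (j + s))"
      using good_path_right_continuous[OF good[OF \<omega>], of "j + s"] s j by (simp add: continuous_within)
    then have "((\<lambda>r. X (j + r) \<omega>) \<longlongrightarrow> X (j + s) \<omega>) (at_right s)"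
      by (rule tendsto_shift_right)
    then have "continuous (at_right s) (\<lambda>r. X (j + r) \<omega> - X r \<omega>)"
      using good_path_right_continuous[OF good[OF \<omega>] s]
      unfolding continuous_within by (intro tendsto_diff)
    from right_continuous_step_above[OF this] show ?thesis
      using j by (simp add: shift_def add.commute)
  qed
  show "prob (A \<inter> {\<omega>\<in>space M. shift (S \<omega>) \<omega> \<in> D}) = prob A * measure path_law D"
  proof -
    have "prob (A \<inter> {\<omega>\<in>space M. shift (\<sigma> \<omega>) \<omega> \<in> D}) = prob A * measure path_law D"
    proof (rule prob_shift_eqI[OF A_ev Y _ D])
      fix J :: "real set" and b :: "real \<Rightarrow> real" assume J: "finite J" "J \<subseteq> {0..}"
      let ?g = "box_approx J b"
      note g = box_approx_measurable[OF J(2), of b]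
      \<comment> \<open>First limit, for a fixed ramp: the left side converges by dominated
        convergence as the mesh tends to 0, while the right side is the same for every mesh.\<close>
      have eq: "(\<integral>\<omega>. indicat_real A \<omega> * ?g m (shift (\<sigma> \<omega>) \<omega>) \<partial>M) = prob A * (\<integral>x. ?g m x \<partial>path_law)" for m
      proof (rule LIMSEQ_unique)
        show "(\<lambda>n. \<integral>\<omega>. indicat_real A \<omega> * ?g m (shift (step_above n (\<sigma> \<omega>)) \<omega>) \<partial>M)
            \<longlonglongrightarrow> (\<integral>\<omega>. indicat_real A \<omega> * ?g m (shift (\<sigma> \<omega>) \<omega>) \<partial>M)"
        proof (rule integral_dominated_convergence[where w = "\<lambda>_. 1"])
          show "AE \<omega> in M. (\<lambda>n. indicat_real A \<omega> * ?g m (shift (step_above n (\<sigma> \<omega>)) \<omega>))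
              \<longlonglongrightarrow> indicat_real A \<omega> * ?g m (shift (\<sigma> \<omega>) \<omega>)"
          proof (rule AE_I2)
            fix \<omega> assume \<omega>: "\<omega> \<in> space M"
            have "(\<lambda>n. shift (step_above n (\<sigma> \<omega>)) \<omega> j) \<longlonglongrightarrow> shift (\<sigma> \<omega>) \<omega> j" if "j \<in> J" for j
              using that J by (intro cont \<omega> \<sigma>_nonneg) auto
            then show "(\<lambda>n. indicat_real A \<omega> * ?g m (shift (step_above n (\<sigma> \<omega>)) \<omega>))
                \<longlonglongrightarrow> indicat_real A \<omega> * ?g m (shift (\<sigma> \<omega>) \<omega>)"
              unfolding box_approx_def by (intro tendsto_intros) auto
          qed
          show "(\<lambda>\<omega>. indicat_real A \<omega> * ?g m (shift (\<sigma> \<omega>) \<omega>)) \<in> borel_measurable M"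
            using A_ev measurable_compose[OF Y g] by measurable
          show "(\<lambda>\<omega>. indicat_real A \<omega> * ?g m (shift (step_above n (\<sigma> \<omega>)) \<omega>)) \<in> borel_measurable M" for n
            using A_ev measurable_compose[OF Yn g] by measurable
        qed (use box_approx_bounds in \<open>auto simp: indicator_def\<close>)
        show "(\<lambda>n. \<integral>\<omega>. indicat_real A \<omega> * ?g m (shift (step_above n (\<sigma> \<omega>)) \<omega>) \<partial>M)
            \<longlonglongrightarrow> prob A * (\<integral>x. ?g m x \<partial>path_law)"
        proof -
          have "(\<integral>\<omega>. indicat_real A \<omega> * ?g m (shift (step_above n (\<sigma> \<omega>)) \<omega>) \<partial>M)
              = prob A * (\<integral>x. ?g m x \<partial>path_law)" for n
            by (rule integral_split_law[OF A_ev Yn g disc])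
          then show ?thesis by (simp only: tendsto_const)
        qed
      qed
      let ?A = "A \<inter> {\<omega>\<in>space M. \<forall>j\<in>J. shift (\<sigma> \<omega>) \<omega> j \<le> b j}"
      let ?B = "{x\<in>space path_space. \<forall>j\<in>J. x j \<le> b j}"
      have comp[measurable]: "(\<lambda>x. x j :: real) \<in> borel_measurable path_space" if "j \<in> J" for j
        using that J by (intro measurable_path_component) auto
      have B: "?B \<in> sets path_space" using J(1) by measurable
      have "{\<omega>\<in>space M. \<forall>j\<in>J. shift (\<sigma> \<omega>) \<omega> j \<le> b j} = (\<lambda>\<omega>. shift (\<sigma> \<omega>) \<omega>) -` ?B \<inter> space M"
        using measurable_space[OF Y] by auto
      then have A': "?A \<in> events" using measurable_sets[OF Y B] A_ev by auto
      \<comment> \<open>Second limit: the ramps tend to the indicator of the closed box, on the side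
        of \<open>M\<close> and on the side of the path law.\<close>
      have "(\<lambda>m. \<integral>\<omega>. indicat_real A \<omega> * ?g m (shift (\<sigma> \<omega>) \<omega>) \<partial>M) \<longlonglongrightarrow> (\<integral>\<omega>. indicat_real ?A \<omega> \<partial>M)"
      proof (rule integral_dominated_convergence[where w = "\<lambda>_. 1"])
        show "AE \<omega> in M. (\<lambda>m. indicat_real A \<omega> * ?g m (shift (\<sigma> \<omega>) \<omega>)) \<longlonglongrightarrow> indicat_real ?A \<omega>"
        proof (rule AE_I2)
          fix \<omega> assume "\<omega> \<in> space M"
          then have "indicat_real ?A \<omega> = indicat_real A \<omega> * (if \<forall>j\<in>J. shift (\<sigma> \<omega>) \<omega> j \<le> b j then 1 else 0)"
            by (simp add: indicator_def)
          then show "(\<lambda>m. indicat_real A \<omega> * ?g m (shift (\<sigma> \<omega>) \<omega>)) \<longlonglongrightarrow> indicat_real ?A \<omega>"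
            using box_approx_LIMSEQ[OF J(1)] by (simp only:) (intro tendsto_mult tendsto_const)
        qed
        show "indicat_real ?A \<in> borel_measurable M"
          using A' by (intro borel_measurable_indicator)
        show "(\<lambda>\<omega>. indicat_real A \<omega> * ?g m (shift (\<sigma> \<omega>) \<omega>)) \<in> borel_measurable M" for m
          using A_ev measurable_compose[OF Y g] by measurable
      qed (use box_approx_bounds in \<open>auto simp: indicator_def\<close>)
      moreover have "(\<lambda>m. prob A * (\<integral>x. ?g m x \<partial>path_law)) \<longlonglongrightarrow> prob A * (\<integral>x. indicat_real ?B x \<partial>path_law)"
      proof (intro tendsto_mult tendsto_const integral_dominated_convergence[where w = "\<lambda>_. 1"])
        show "AE x in path_law. (\<lambda>m. ?g m x) \<longlonglongrightarrow> indicat_real ?B x"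
        proof (rule AE_I2)
          fix x :: "real \<Rightarrow> real" assume "x \<in> space path_law"
          then have "indicat_real ?B x = (if \<forall>j\<in>J. x j \<le> b j then 1 else 0)"
            by (simp add: indicator_def)
          then show "(\<lambda>m. ?g m x) \<longlonglongrightarrow> indicat_real ?B x" using box_approx_LIMSEQ[OF J(1)] by (simp only:)
        qed
        show "indicat_real ?B \<in> borel_measurable path_law"
          using B by (intro borel_measurable_indicator) simp
        show "?g m \<in> borel_measurable path_law" for m using g by (simp cong: measurable_cong_sets)
      qed (use box_approx_bounds in \<open>auto simp: indicator_def\<close>)
      ultimately have "(\<integral>\<omega>. indicat_real ?A \<omega> \<partial>M) = prob A * (\<integral>x. indicat_real ?B x \<partial>path_law)"
        unfolding eq by (rule LIMSEQ_unique)
      then have "prob ?A = prob A * measure path_law ?B" using A' B by simp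
      moreover have "{\<omega>\<in>space M. (\<lambda>t\<in>{0..}. X t \<omega>) \<in> ?B} = {\<omega>\<in>space M. \<forall>j\<in>J. X j \<omega> \<le> b j}"
        using measurable_space[OF path_measurable] J by (auto simp: subset_iff)
      ultimately show "prob ?A = prob A * prob {\<omega>\<in>space M. \<forall>j\<in>J. X j \<omega> \<le> b j}"
        using measure_path_law[OF B] by simp
    qed
    moreover have "A \<inter> {\<omega>\<in>space M. shift (S \<omega>) \<omega> \<in> D} = A \<inter> {\<omega>\<in>space M. shift (\<sigma> \<omega>) \<omega> \<in> D}"
      by (auto simp: \<sigma>_def)
    ultimately show ?thesis by simp
  qed
qed

end

section \<open>First passage times\<close>

context levy_paths
begin

abbreviation dep :: "'a \<Rightarrow> real \<Rightarrow> real" where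
  "dep \<omega> \<equiv> depth (\<lambda>t. X t \<omega>)"

lemma optional_shift_event:
  assumes A: "A \<subseteq> space M" and S: "\<And>\<omega>. \<omega> \<in> A \<Longrightarrow> 0 \<le> S \<omega>"
    and opt: "\<And>u. 0 < u \<Longrightarrow> {\<omega>\<in>A. S \<omega> < u} \<in> past u"
    and D: "D \<in> sets path_space"
  shows "A \<inter> {\<omega>\<in>space M. shift (S \<omega>) \<omega> \<in> D} \<in> events"
proof -
  have A_ev: "A \<in> events" by (rule strong_markov(1)[OF A S opt D])
  define \<sigma> where "\<sigma> \<omega> = (if \<omega> \<in> A then S \<omega> else 0)" for \<omega>
  have "\<sigma> \<in> borel_measurable M"
  proof (rule borel_measurableI_less)
    fix u
    have "{\<omega>\<in>A. S \<omega> < u} \<in> events"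
    proof (cases "0 < u")
      case True
      then show ?thesis using opt past_subset by blast
    next
      case False
      then have "\<not> S \<omega> < u" if "\<omega> \<in> A" for \<omega>
        using S[OF that] by simp
      then have "{\<omega>\<in>A. S \<omega> < u} = {}" by blast
      then show ?thesis by (metis sets.empty_sets)
    qed
    moreover have "{\<omega>\<in>space M. \<sigma> \<omega> < u} = {\<omega>\<in>A. S \<omega> < u} \<union> (if 0 < u then space M - A else {})"
      using A by (auto simp: \<sigma>_def)
    ultimately show "{\<omega>\<in>space M. \<sigma> \<omega> < u} \<in> events" using A_ev by simp
  qed
  then have "(\<lambda>\<omega>. shift (\<sigma> \<omega>) \<omega>) \<in> M \<rightarrow>\<^sub>M path_space"
    by (rule shift_measurable) (simp add: \<sigma>_def S)
  from measurable_sets[OF this D] A_ev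
  have "A \<inter> ((\<lambda>\<omega>. shift (\<sigma> \<omega>) \<omega>) -` D \<inter> space M) \<in> events" by blast
  also have "A \<inter> ((\<lambda>\<omega>. shift (\<sigma> \<omega>) \<omega>) -` D \<inter> space M) = A \<inter> {\<omega>\<in>space M. shift (S \<omega>) \<omega> \<in> D}"
    unfolding \<sigma>_def by auto
  finally show ?thesis .
qed

lemma less_depth_iff:
  assumes "good_path x" "0 \<le> u"
  shows "b < depth x u \<longleftrightarrow> (\<exists>q\<in>\<rat> \<inter> {0..u}. b < - x q)"
proof
  assume "b < depth x u"
  show "\<exists>q\<in>\<rat> \<inter> {0..u}. b < - x q"
  proof (rule ccontr)
    assume *: "\<not> ?thesis"
    have "depth x u \<le> b"
    proof (rule depth_least[OF assms])
      fix q :: real assume "q \<in> \<rat>" "0 \<le> q" "q \<le> u"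
      then show "- x q \<le> b" using * by (simp add: not_less)
    qed
    with \<open>b < depth x u\<close> show False by simp
  qed
next
  assume "\<exists>q\<in>\<rat> \<inter> {0..u}. b < - x q"
  then obtain q where q: "0 \<le> q" "q \<le> u" "b < - x q" by auto
  with depth_upper[OF assms(1) q(1,2)] show "b < depth x u" by simp
qed

lemma depth_past:
  assumes "0 \<le> u" shows "{\<omega>\<in>space M. b < dep \<omega> u} \<in> past u"
proof -
  interpret sigma_algebra "space M" "past u"
    using sigma_algebra_past_sets[of X M] X_measurable by blast
  have "{\<omega>\<in>space M. b < dep \<omega> u} = (\<Union>q\<in>\<rat> \<inter> {0..u}. X q -` {..<- b} \<inter> space M)"
  proof -
    have "b < - r \<longleftrightarrow> r < - b" for r by linarith
    then show ?thesis using less_depth_iff[OF good assms] by auto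
  qed
  also have "\<dots> \<in> past u"
  proof (rule countable_UN')
    show "countable (\<rat> \<inter> {0..u})" by (simp add: countable_rat)
    show "(\<lambda>q. X q -` {..<- b} \<inter> space M) ` (\<rat> \<inter> {0..u}) \<subseteq> past u"
    proof (rule image_subsetI)
      fix q assume q: "q \<in> \<rat> \<inter> {0..u}"
      then have "ennreal q \<le> ennreal u" by (intro ennreal_leI) simp
      then have "X q -` {..<- b} \<inter> space M \<in> {X r -` B \<inter> space M |r B. 0 \<le> r \<and> ennreal r \<le> ennreal u \<and> B \<in> sets borel}"
        using q by (intro CollectI exI[of _ q] exI[of _ "{..<- b}"]) simp
      then show "X q -` {..<- b} \<inter> space M \<in> past u"
        unfolding past_sets_def by (intro sigma_sets.Basic) blast
    qed
  qed
  finally show ?thesis .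
qed

lemma depth_event: "0 \<le> u \<Longrightarrow> {\<omega>\<in>space M. b < dep \<omega> u} \<in> events"
  using depth_past past_subset by blast

text \<open>The passage strictly below \<open>- b\<close>, capped at \<open>L\<close>: the cap keeps
  the set nonempty and the time bounded, and the strict inequality makes the time optional.\<close>

definition hit :: "real \<Rightarrow> real \<Rightarrow> 'a \<Rightarrow> real" where
  "hit b L \<omega> = Inf ({s. 0 \<le> s \<and> b < dep \<omega> s} \<union> {L})"

context
  fixes L :: real and \<omega>
  assumes L: "0 \<le> L" and \<omega>: "\<omega> \<in> space M"
begin

lemma hit_bdd: "bdd_below ({s. 0 \<le> s \<and> b < dep \<omega> s} \<union> {L})"
  using L by (intro bdd_belowI[of _ 0]) auto

lemma hit_nonneg: "0 \<le> hit b L \<omega>"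
  unfolding hit_def using L by (intro cInf_greatest) auto

lemma hit_le: "hit b L \<omega> \<le> L"
  unfolding hit_def by (intro cInf_lower hit_bdd) simp

lemma hit_mono: "b \<le> b' \<Longrightarrow> hit b L \<omega> \<le> hit b' L \<omega>"
  unfolding hit_def by (intro cInf_superset_mono hit_bdd) auto

text \<open>Left continuity of the running infimum: if the level has been passed by time
  \<open>u\<close>, it was already passed slightly earlier. This reduces events about the passage
  time to the value of the infimum at one time.\<close>

lemma hit_less_iff:
  assumes b: "0 \<le> b" and u: "0 \<le> u" "u \<le> L"
  shows "hit b L \<omega> < u \<longleftrightarrow> b < dep \<omega> u"
proof
  assume "hit b L \<omega> < u"
  then obtain s where s: "s \<in> {s. 0 \<le> s \<and> b < dep \<omega> s} \<union> {L}" "s < u"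
    unfolding hit_def using cInf_lessD[of "{s. 0 \<le> s \<and> b < dep \<omega> s} \<union> {L}" u] by blast
  then have "0 \<le> s" "b < dep \<omega> s" using u by auto
  with depth_mono[OF good[OF \<omega>], of s u] s(2) show "b < dep \<omega> u" by simp
next
  assume *: "b < dep \<omega> u"
  then have "u \<noteq> 0" using depth_0[OF good[OF \<omega>]] b by auto
  then have "0 < u" using u by simp
  obtain v where v: "0 \<le> v" "v < u" "dep \<omega> u \<le> dep \<omega> v + (dep \<omega> u - b) / 2"
    using depth_left[OF good[OF \<omega>] \<open>0 < u\<close>, of "(dep \<omega> u - b) / 2"] * by auto
  have "b < dep \<omega> v" using v(3) * by argo
  then have "hit b L \<omega> \<le> v" unfolding hit_def using v by (intro cInf_lower hit_bdd) simp
  with v(2) show "hit b L \<omega> < u" by simp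
qed

text \<open>The level is attained without overshoot. The infimum is continuous, so it equals the
  level at the passage time, and it starts to move there, so the path must sit on it.\<close>

lemma hit_attained:
  assumes b: "0 \<le> b" and less: "hit b L \<omega> < L"
  shows "dep \<omega> (hit b L \<omega>) = b" "X (hit b L \<omega>) \<omega> = - b"
proof -
  let ?h = "hit b L \<omega>"
  have h: "0 \<le> ?h" "?h \<le> L" by (rule hit_nonneg, rule hit_le)
  have after: "b < dep \<omega> c" if c: "?h < c" for c
  proof -
    have "b < dep \<omega> (min c L)" using hit_less_iff[OF b, of "min c L"] c less h by simp
    also have "\<dots> \<le> dep \<omega> c" using c less h by (intro depth_mono[OF good[OF \<omega>]]) auto
    finally show ?thesis .
  qed
  have le: "dep \<omega> ?h \<le> b" using hit_less_iff[OF b h] by simp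
  show eq: "dep \<omega> ?h = b"
  proof (rule ccontr)
    assume "dep \<omega> ?h \<noteq> b"
    with le obtain c where "?h < c" "dep \<omega> c \<le> dep \<omega> ?h + (b - dep \<omega> ?h)"
      using depth_right[OF good[OF \<omega>] h(1), of "b - dep \<omega> ?h"] by auto
    with after[of c] show False by simp
  qed
  show "X ?h \<omega> = - b"
  proof (rule ccontr)
    assume "X ?h \<omega> \<noteq> - b"
    moreover have "- X ?h \<omega> \<le> b" using depth_upper[OF good[OF \<omega>] h(1) order_refl] eq by simp
    ultimately have "- X ?h \<omega> < dep \<omega> ?h" using eq by simp
    then obtain c where "?h < c" "dep \<omega> c = dep \<omega> ?h"
      using depth_const_right[OF good[OF \<omega>] h(1)] by blast
    with after[of c] eq show False by simp
  qed
qed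

end

lemma hit_optional:
  assumes b: "0 \<le> b" and t: "0 \<le> t" "t \<le> L" and u: "0 < u"
  shows "{\<omega>\<in>{\<omega>\<in>space M. b < dep \<omega> t}. hit b L \<omega> < u} \<in> past u"
proof -
  have "{\<omega>\<in>{\<omega>\<in>space M. b < dep \<omega> t}. hit b L \<omega> < u} = {\<omega>\<in>space M. b < dep \<omega> (min t u)}"
  proof (intro Collect_cong)
    fix \<omega>
    show "\<omega> \<in> {\<omega>\<in>space M. b < dep \<omega> t} \<and> hit b L \<omega> < u \<longleftrightarrow> \<omega> \<in> space M \<and> b < dep \<omega> (min t u)"
    proof (cases "\<omega> \<in> space M")
      case True
      have "0 \<le> L" using t by simp
      note iff = hit_less_iff[OF this True b]
      have "b < dep \<omega> t \<longleftrightarrow> hit b L \<omega> < t" using iff[OF t] by simp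
      moreover have "b < dep \<omega> (min t u) \<longleftrightarrow> hit b L \<omega> < min t u"
        using iff[of "min t u"] t u by simp
      ultimately show ?thesis using True by simp
    qed simp
  qed
  also have "\<dots> \<in> past (min t u)" using t u by (intro depth_past) simp
  also have "past (min t u) \<subseteq> past u" by (intro past_sets_mono ennreal_leI) simp
  finally show ?thesis .
qed

lemma depth_path_sets:
  assumes "0 \<le> u" shows "{x\<in>space path_space. depth x u \<le> b} \<in> sets path_space"
proof -
  have "(\<lambda>x. depth x u) \<in> borel_measurable path_space"
    by (rule borel_measurable_depth[where g = "\<lambda>x. x"]) auto
  then show ?thesis by simp
qed

lemma shift_depth: "depth (shift v \<omega>) u = depth (\<lambda>s. X (v + s) \<omega> - X v \<omega>) u"
  unfolding shift_def by (rule depth_restrict)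

text \<open>If \<^term>\<open>X\<close> stayed nonnegative during \<open>\<epsilon>\<close> with positive probability, then it would do so after the
  first passages below each of \<open>n\<close> equally spaced levels; but these stays last \<open>\<epsilon>\<close> each and are disjoint.\<close>

lemma passage_dichotomy:
  assumes \<epsilon>: "0 < \<epsilon>" and b: "0 < b" and t: "0 \<le> t"
  shows "prob {\<omega>\<in>space M. b < dep \<omega> t} * measure path_law {x\<in>space path_space. depth x \<epsilon> \<le> 0} = 0"
proof -
  interpret path: prob_space path_law by (rule prob_space_path_law)
  let ?D = "{x\<in>space path_space. depth x \<epsilon> \<le> 0}"
  define p where "p = prob {\<omega>\<in>space M. b < dep \<omega> t} * measure path_law ?D"
  \<comment> \<open>The extra \<epsilon> leaves room for a stay that begins before \<open>t\<close>
    to end before the cap.\<close>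
  define L where "L = t + \<epsilon>"
  have L: "0 \<le> L" "t \<le> L" using t \<epsilon> by (auto simp: L_def)
  have bound: "\<epsilon> * (real n * p) \<le> L" if n: "0 < n" for n :: nat
  proof -
    define lev where "lev k = b * real k / real n" for k
    have lev: "0 \<le> lev k" "lev k \<le> lev (Suc k)" for k
      using b n by (auto simp: lev_def divide_right_mono)
    have lev_n: "lev k \<le> b" if "k \<le> n" for k
      using b n that by (simp add: lev_def field_simps)
    define A where "A k = {\<omega>\<in>space M. lev k < dep \<omega> t}" for k
    define E where "E k = A k \<inter> {\<omega>\<in>space M. shift (hit (lev k) L \<omega>) \<omega> \<in> ?D}" for k
    have D: "?D \<in> sets path_space" using \<epsilon> by (intro depth_path_sets) simp
    have hitA: "A k \<subseteq> space M" "\<And>\<omega>. \<omega> \<in> A k \<Longrightarrow> 0 \<le> hit (lev k) L \<omega>"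
      "\<And>u. 0 < u \<Longrightarrow> {\<omega>\<in>A k. hit (lev k) L \<omega> < u} \<in> past u" for k
    proof -
      show "A k \<subseteq> space M" by (auto simp: A_def)
      then show "0 \<le> hit (lev k) L \<omega>" if "\<omega> \<in> A k" for \<omega>
        using that by (intro hit_nonneg[OF L(1)]) blast
      show "{\<omega>\<in>A k. hit (lev k) L \<omega> < u} \<in> past u" if "0 < u" for u
        unfolding A_def by (rule hit_optional[OF lev(1) t L(2) that])
    qed
    have sm1: "A k \<in> events" for k
      by (rule strong_markov(1)[OF hitA D])
    have sm2: "prob (E k) = prob (A k) * measure path_law ?D" for k
      unfolding E_def by (rule strong_markov(2)[OF hitA D])
    have E: "E k \<in> events" for k
      unfolding E_def by (rule optional_shift_event[OF hitA D])
    \<comment> \<open>During a stay of length \<epsilon> after the passage at level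
      \<open>lev k\<close> no new infimum is made, so by \<open>depth_shift\<close> the infimum
      still equals that level when the stay ends; the next level is passed only afterwards.\<close>
    have gap: "hit (lev k) L \<omega> + \<epsilon> \<le> hit (lev (Suc k)) L \<omega>" if "\<omega> \<in> E k" for k \<omega>
    proof (rule ccontr)
      assume *: "\<not> ?thesis"
      define v where "v = hit (lev k) L \<omega>"
      have \<omega>: "\<omega> \<in> space M" "lev k < dep \<omega> t" "depth (\<lambda>s. X (v + s) \<omega> - X v \<omega>) \<epsilon> \<le> 0"
        using that by (auto simp: E_def A_def shift_depth v_def)
      have v: "0 \<le> v" "v < t" using hit_nonneg[OF L(1) \<omega>(1)] hit_less_iff[OF L(1) \<omega>(1) lev(1) t L(2)] \<omega>(2)
        by (auto simp: v_def)
      have att: "dep \<omega> v = lev k" "X v \<omega> = - lev k"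
        unfolding v_def using v \<epsilon> by (intro hit_attained[OF L(1) \<omega>(1) lev(1)]; simp add: L_def v_def)+
      have "dep \<omega> (v + \<epsilon>) \<le> lev k"
        using depth_shift[OF good[OF \<omega>(1)] v(1), of \<epsilon>] \<epsilon> \<omega>(3) att by simp
      moreover have "lev (Suc k) < dep \<omega> (v + \<epsilon>)"
      proof -
        have "hit (lev (Suc k)) L \<omega> < v + \<epsilon>" using * by (simp add: v_def)
        moreover have "0 \<le> v + \<epsilon>" "v + \<epsilon> \<le> L" using v \<epsilon> by (auto simp: L_def)
        ultimately show ?thesis using hit_less_iff[OF L(1) \<omega>(1) lev(1)] by blast
      qed
      ultimately show False using lev(2)[of k] by simp
    qed
    \<comment> \<open>The gaps add up along the levels: each stay pushes the next passage time back
      by \<epsilon>. For m = n the cap bounds the right side by \<open>L\<close>, although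
      \<open>lev (Suc n)\<close> already exceeds \<open>b\<close>.\<close>
    have "\<epsilon> * (\<Sum>k=1..m. indicat_real (E k) \<omega>) \<le> hit (lev (Suc m)) L \<omega>" if \<omega>: "\<omega> \<in> space M" for m \<omega>
    proof (induction m)
      case 0
      show ?case using hit_nonneg[OF L(1) \<omega>] by simp
    next
      case (Suc m)
      show ?case
      proof (cases "\<omega> \<in> E (Suc m)")
        case True
        from gap[OF True] Suc True show ?thesis by (simp add: distrib_left)
      next
        case False
        have "hit (lev (Suc m)) L \<omega> \<le> hit (lev (Suc (Suc m))) L \<omega>"
          by (rule hit_mono[OF L(1) \<omega> lev(2)])
        with Suc False show ?thesis by simp
      qed
    qed
    then have "\<epsilon> * (\<Sum>k=1..n. indicat_real (E k) \<omega>) \<le> L" if "\<omega> \<in> space M" for \<omega>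
      using that hit_le[OF L(1) that] order_trans by blast
    moreover have int: "integrable M (indicat_real (E k))" for k
      using E by (simp add: less_top[symmetric])
    ultimately have "(\<integral>\<omega>. \<epsilon> * (\<Sum>k=1..n. indicat_real (E k) \<omega>) \<partial>M) \<le> L"
      by (intro integral_le_const integrable_mult_right Bochner_Integration.integrable_sum AE_I2) auto
    then have le: "\<epsilon> * (\<Sum>k=1..n. prob (E k)) \<le> L"
      using E by (simp add: Bochner_Integration.integral_sum int)
    have "real n * p = (\<Sum>k=1..n. p)" by simp
    also have "\<dots> \<le> (\<Sum>k=1..n. prob (E k))"
    proof (rule sum_mono)
      fix k assume k: "k \<in> {1..n}"
      have "prob {\<omega>\<in>space M. b < dep \<omega> t} \<le> prob (A k)"
        using lev_n[of k] k sm1[of k] by (intro finite_measure_mono) (auto simp: A_def)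
      then show "p \<le> prob (E k)" unfolding p_def sm2 by (intro mult_right_mono) auto
    qed
    finally show ?thesis using le \<epsilon> by (meson mult_left_mono less_imp_le order_trans)
  qed
  \<comment> \<open>\<open>L\<close> does not depend on the number \<open>n\<close> of levels, and
    \<epsilon> * n * p stays below it for every positive \<open>n\<close>.\<close>
  have "p = 0"
  proof (rule ccontr)
    assume "p \<noteq> 0"
    then have "0 < p" by (simp add: p_def less_le)
    obtain n :: nat where n: "L / (\<epsilon> * p) < real n" using reals_Archimedean2 by blast
    have "0 \<le> L / (\<epsilon> * p)" using L(1) \<epsilon> \<open>0 < p\<close> by simp
    with n have "0 < n" by (metis less_le_trans of_nat_0_less_iff order_le_less_trans)
    moreover have "L < \<epsilon> * (real n * p)" using n \<epsilon> \<open>0 < p\<close> by (simp add: field_simps)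
    ultimately show False using bound[of n] by simp
  qed
  then show ?thesis by (simp add: p_def)
qed

text \<open>Stationarity moves the hypothesis to increments between two given times, countability to
  all pairs of rationals, right continuity to all pairs. \<open>step_above\<close> helps since its
  values are rational and it is monotone in time.\<close>

lemma AE_increment_nonneg:
  assumes nonneg: "\<And>h. 0 \<le> h \<Longrightarrow> AE \<omega> in M. 0 \<le> X h \<omega>"
  shows "AE \<omega> in M. \<forall>s t. 0 \<le> s \<longrightarrow> s \<le> t \<longrightarrow> X s \<omega> \<le> X t \<omega>"
proof -
  have inc: "AE \<omega> in M. X s \<omega> \<le> X t \<omega>" if "0 \<le> s" "s \<le> t" for s t
  proof -
    have t: "0 \<le> t" "0 \<le> t - s" using that by auto
    have m: "(\<lambda>\<omega>. X t \<omega> - X s \<omega>) \<in> borel_measurable M"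
      using that t by (intro borel_measurable_diff X_measurable) auto
    have "AE x in distr M borel (X (t - s)). 0 \<le> x"
      using nonneg[OF t(2)] X_measurable[OF t(2)] by (simp add: AE_distr_iff)
    then have "AE x in distr M borel (\<lambda>\<omega>. X t \<omega> - X s \<omega>). 0 \<le> x"
    proof -
      have "distr M borel (\<lambda>\<omega>. X t \<omega> - X s \<omega>) = distr M borel (X (t - s))"
        using increments_stationary[OF that(1) t(2)] by simp
      then show "AE x in distr M borel (X (t - s)). 0 \<le> x \<Longrightarrow> ?thesis" by (simp only:)
    qed
    then show ?thesis using m by (simp add: AE_distr_iff)
  qed
  have "AE \<omega> in M. \<forall>s\<in>\<rat>. \<forall>t\<in>\<rat>. 0 \<le> s \<longrightarrow> s \<le> t \<longrightarrow> X s \<omega> \<le> X t \<omega>"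
    using inc by (intro AE_ball_countable' countable_rat) auto
  then show ?thesis using AE_space
  proof eventually_elim
    case (elim \<omega>)
    show ?case
    proof (intro allI impI)
      fix s t :: real assume st: "0 \<le> s" "s \<le> t"
      have lim: "(\<lambda>n. X (step_above n r) \<omega>) \<longlonglongrightarrow> X r \<omega>" if "0 \<le> r" for r
        using right_continuous_step_above[OF good_path_right_continuous[OF good[OF elim(2)] that]] .
      show "X s \<omega> \<le> X t \<omega>"
      proof (rule LIMSEQ_le[OF lim lim])
        have "X (step_above n s) \<omega> \<le> X (step_above n t) \<omega>" for n
        proof -
          have "step_above n s \<le> step_above n t"
            using st by (auto simp: step_above_def intro!: divide_right_mono floor_mono mult_left_mono)
          moreover have "0 \<le> step_above n s" using step_above_bounds(1)[of s n] st by simp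
          moreover have "step_above n r \<in> \<rat>" for r by (simp add: step_above_def)
          ultimately show ?thesis using elim(1) by blast
        qed
        then show "\<exists>N. \<forall>n\<ge>N. X (step_above n s) \<omega> \<le> X (step_above n t) \<omega>" by blast
      qed (use st in auto)
    qed
  qed
qed

text \<open>If the paths are not almost surely nondecreasing, some value is negative with positive
  probability, so the infimum passes some level -1 / (n + 1) with positive probability. Then the
  other factor in \<open>passage_dichotomy\<close> vanishes for every \<epsilon>, and countably many
  \<epsilon> suffice by monotonicity.\<close>

lemma AE_depth_pos:
  assumes "\<not> (AE \<omega> in M. \<forall>s t. 0 \<le> s \<longrightarrow> s \<le> t \<longrightarrow> X s \<omega> \<le> X t \<omega>)"
  shows "AE \<omega> in M. \<forall>u>0. 0 < dep \<omega> u"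
proof -
  have "\<exists>h\<ge>0. \<not> (AE \<omega> in M. 0 \<le> X h \<omega>)"
    using AE_increment_nonneg assms by blast
  then obtain h where h: "0 \<le> h" "\<not> (AE \<omega> in M. 0 \<le> X h \<omega>)" by blast
  have "\<exists>n. prob {\<omega>\<in>space M. 1 / real (Suc n) < dep \<omega> h} \<noteq> 0"
  proof (rule ccontr)
    assume "\<not> ?thesis"
    then have "AE \<omega> in M. \<not> 1 / real (Suc n) < dep \<omega> h" for n
      using depth_event[OF h(1)] by (subst AE_iff_measurable[OF _ refl]) (auto simp: emeasure_eq_measure)
    then have "AE \<omega> in M. \<forall>n. \<not> 1 / real (Suc n) < dep \<omega> h" by (simp add: AE_all_countable)
    then have "AE \<omega> in M. 0 \<le> X h \<omega>" using AE_space
    proof eventually_elim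
      case (elim \<omega>)
      have "\<not> 0 < dep \<omega> h"
        using reals_Archimedean[of "dep \<omega> h"] elim(1) by (auto simp: inverse_eq_divide)
      then show ?case using depth_upper[OF good[OF elim(2)] h(1) order_refl] by simp
    qed
    with h(2) show False by simp
  qed
  then obtain n where "prob {\<omega>\<in>space M. 1 / real (Suc n) < dep \<omega> h} \<noteq> 0" by blast
  then have law0: "measure path_law {x\<in>space path_space. depth x \<epsilon> \<le> 0} = 0" if "0 < \<epsilon>" for \<epsilon>
    using passage_dichotomy[OF that _ h(1), of "1 / real (Suc n)"] by simp
  have "AE \<omega> in M. 0 < dep \<omega> \<epsilon>" if \<epsilon>: "0 < \<epsilon>" for \<epsilon>
  proof -
    have "{\<omega>\<in>space M. (\<lambda>t\<in>{0..}. X t \<omega>) \<in> {x\<in>space path_space. depth x \<epsilon> \<le> 0}}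
        = {\<omega>\<in>space M. \<not> 0 < dep \<omega> \<epsilon>}"
      using measurable_space[OF path_measurable] by (auto simp: depth_restrict not_less)
    then have "prob {\<omega>\<in>space M. \<not> 0 < dep \<omega> \<epsilon>} = 0"
      using law0[OF \<epsilon>] measure_path_law[OF depth_path_sets[of \<epsilon> 0]] \<epsilon> by simp
    moreover have "{\<omega>\<in>space M. \<not> 0 < dep \<omega> \<epsilon>} \<in> events"
    proof -
      have "{\<omega>\<in>space M. \<not> 0 < dep \<omega> \<epsilon>} = space M - {\<omega>\<in>space M. 0 < dep \<omega> \<epsilon>}" by blast
      also have "\<dots> \<in> events" using depth_event[of \<epsilon> 0] \<epsilon> by (intro sets.compl_sets) simp
      finally show ?thesis .
    qed
    ultimately show ?thesis
      by (subst AE_iff_measurable[OF _ refl]) (auto simp: emeasure_eq_measure)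
  qed
  then have "AE \<omega> in M. \<forall>n. 0 < dep \<omega> (1 / real (Suc n))" by (simp add: AE_all_countable)
  then show ?thesis using AE_space
  proof eventually_elim
    case (elim \<omega>)
    show ?case
    proof (intro allI impI)
      fix u :: real assume "0 < u"
      then obtain n where n: "1 / real (Suc n) < u"
        using reals_Archimedean by (auto simp: inverse_eq_divide)
      have "0 < dep \<omega> (1 / real (Suc n))" using elim(1) by blast
      also have "\<dots> \<le> dep \<omega> u" using n by (intro depth_mono[OF good[OF elim(2)]]) auto
      finally show "0 < dep \<omega> u" .
    qed
  qed
qed

end

lemma good_path_add_linear:
  assumes "good_path x" shows "good_path (\<lambda>t. x t + c * t)"
  unfolding good_path_def cadlag_def no_negative_jumps_def
proof (intro conjI allI impI)
  show "x 0 + c * 0 = 0" using good_path_0[OF assms] by simp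
  fix t :: real assume "0 \<le> t"
  from good_path_right_continuous[OF assms this] show "continuous (at_right t) (\<lambda>t. x t + c * t)"
    by (intro continuous_intros)
next
  fix t :: real assume "0 < t"
  then obtain l where l: "l \<le> x t" "(x \<longlongrightarrow> l) (at_left t)"
    using good_path_left_limit[OF assms] by blast
  then have lim: "((\<lambda>t. x t + c * t) \<longlongrightarrow> l + c * t) (at_left t)"
    by (intro tendsto_intros)
  then show "\<exists>l. ((\<lambda>t. x t + c * t) \<longlongrightarrow> l) (at_left t)" by blast
  fix l' assume "((\<lambda>t. x t + c * t) \<longlongrightarrow> l') (at_left t)"
  then have "l' = l + c * t"
    using lim by (intro tendsto_unique) (auto simp: trivial_limit_at_left_real)
  with l show "l' \<le> x t + c * t" by simp
qed

section \<open>Zeros of the reflected path\<close>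

context levy_paths
begin

text \<open>A drift changes neither the jumps nor the independence, so \<open>AE_depth_pos\<close>
  becomes available for every slope.\<close>

lemma levy_paths_drift: "levy_paths M (\<lambda>t \<omega>. X t \<omega> + c * t)"
proof (rule levy_paths.intro[OF prob_space_axioms levy_paths_axioms.intro])
  show "complete_measure M" by (rule complete)
  show "good_path (\<lambda>t. X t \<omega> + c * t)" if "\<omega> \<in> space M" for \<omega>
    by (rule good_path_add_linear[OF good[OF that]])
  note gp = good_path_add_linear[OF good]
  show "levy_process M (\<lambda>t \<omega>. X t \<omega> + c * t)"
    unfolding levy_process_def
  proof (intro conjI allI impI)
    show "prob_space M" by (rule prob_space_axioms)
    show "(\<lambda>\<omega>. X t \<omega> + c * t) \<in> borel_measurable M" if "0 \<le> t" for t
      using X_measurable[OF that] by simp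
    show "AE \<omega> in M. X 0 \<omega> + c * 0 = 0"
      using AE_space[of M] by eventually_elim (simp add: X_0)
    show "AE \<omega> in M. cadlag (\<lambda>t. X t \<omega> + c * t)"
      using AE_space[of M] by eventually_elim (use gp in \<open>simp add: good_path_def\<close>)
  next
    fix n :: nat and p :: "nat \<Rightarrow> real" assume p: "0 \<le> p 0 \<and> mono_on {..n} p"
    have "indep_vars (\<lambda>_. borel) (\<lambda>i \<omega>. (\<lambda>r. r + c * (p (Suc i) - p i)) (X (p (Suc i)) \<omega> - X (p i) \<omega>)) {..<n}"
      by (rule indep_vars_compose2[OF increments_indep]) (use p in auto)
    then show "indep_vars (\<lambda>_. borel)
        (\<lambda>i \<omega>. X (p (Suc i)) \<omega> + c * p (Suc i) - (X (p i) \<omega> + c * p i)) {..<n}"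
      by (simp add: algebra_simps)
  next
    fix s t :: real assume st: "0 \<le> s" "0 \<le> t"
    have m: "(\<lambda>\<omega>. X (s + t) \<omega> - X s \<omega>) \<in> borel_measurable M"
      using st by (intro borel_measurable_diff X_measurable) auto
    have "distr M borel (\<lambda>\<omega>. X (s + t) \<omega> + c * (s + t) - (X s \<omega> + c * s))
        = distr (distr M borel (\<lambda>\<omega>. X (s + t) \<omega> - X s \<omega>)) borel (\<lambda>r. r + c * t)"
      using m by (subst distr_distr) (auto simp: comp_def algebra_simps)
    also have "\<dots> = distr (distr M borel (X t)) borel (\<lambda>r. r + c * t)"
      by (simp only: increments_stationary[OF st])
    also have "\<dots> = distr M borel (\<lambda>\<omega>. X t \<omega> + c * t)"
      using X_measurable[OF st(2)] by (subst distr_distr) (auto simp: comp_def)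
    finally show "distr M borel (\<lambda>\<omega>. X (s + t) \<omega> + c * (s + t) - (X s \<omega> + c * s))
        = distr M borel (\<lambda>\<omega>. X t \<omega> + c * t)" .
  qed
qed

text \<open>If \<open>X t + c * t\<close> were nondecreasing, \<open>X\<close> would be a difference
  of two nondecreasing functions, hence of bounded variation on [0, 1].\<close>

lemma not_AE_mono_drift:
  assumes ub: "unbounded_variation M X" and c: "0 \<le> c"
  shows "\<not> (AE \<omega> in M. \<forall>s t. 0 \<le> s \<longrightarrow> s \<le> t \<longrightarrow> X s \<omega> + c * s \<le> X t \<omega> + c * t)"
proof
  assume mono: "AE \<omega> in M. \<forall>s t. 0 \<le> s \<longrightarrow> s \<le> t \<longrightarrow> X s \<omega> + c * s \<le> X t \<omega> + c * t"
  have "AE \<omega> in M. \<not> bounded_variation_on 0 1 (\<lambda>t. X t \<omega>)"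
    using ub unfolding unbounded_variation_def by eventually_elim auto
  with mono have "AE \<omega> in M. False"
  proof eventually_elim
    case (elim \<omega>)
    have "bounded_variation_on 0 1 (\<lambda>t. X t \<omega>)"
      unfolding bounded_variation_on_def
    proof (intro exI allI impI)
      fix n and p :: "nat \<Rightarrow> real" assume p: "mono_on {..n} p \<and> p ` {..n} \<subseteq> {0..1}"
      define W where "W t = X t \<omega> + c * t" for t
      have W: "W s \<le> W t" if "0 \<le> s" "s \<le> t" for s t using elim(1) that by (simp add: W_def)
      have p01: "0 \<le> p i" "p i \<le> 1" if "i \<le> n" for i using p that by (auto simp: image_subset_iff)
      have "(\<Sum>i<n. \<bar>X (p (Suc i)) \<omega> - X (p i) \<omega>\<bar>)
          \<le> (\<Sum>i<n. (W (p (Suc i)) - W (p i)) + c * (p (Suc i) - p i))"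
      proof (rule sum_mono)
        fix i assume "i \<in> {..<n}"
        then have i: "p i \<le> p (Suc i)" "0 \<le> p i" using p p01[of i] by (auto intro: mono_onD)
        then have "0 \<le> c * (p (Suc i) - p i)" "W (p i) \<le> W (p (Suc i))"
          using c W by auto
        then show "\<bar>X (p (Suc i)) \<omega> - X (p i) \<omega>\<bar> \<le> (W (p (Suc i)) - W (p i)) + c * (p (Suc i) - p i)"
          by (simp add: W_def algebra_simps abs_le_iff)
      qed
      also have "\<dots> = (\<Sum>i<n. W (p (Suc i)) - W (p i)) + c * (\<Sum>i<n. p (Suc i) - p i)"
        by (simp only: sum.distrib sum_distrib_left)
      also have "\<dots> = (W (p n) - W (p 0)) + c * (p n - p 0)"
        by (simp only: sum_lessThan_telescope[of "\<lambda>i. W (p i)"] sum_lessThan_telescope)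
      also have "\<dots> \<le> (W 1 - W 0) + c * 1"
        using p01[of n] p01[of 0] c by (intro add_mono diff_mono W mult_left_mono) auto
      finally show "(\<Sum>i<n. \<bar>X (p (Suc i)) \<omega> - X (p i) \<omega>\<bar>) \<le> (W 1 - W 0) + c * 1" .
    qed
    with elim(2) show False by simp
  qed
  then show False by simp
qed

text \<open>The descent below every slope holds almost surely at each fixed time, because the
  shifted path has the law of \<open>X\<close>. Fubini exchanges the quantifiers: almost surely it
  holds at Lebesgue-almost every time. Those times at which the path sits on its infimum are steep
  points of \<open>depth\<close>, and \<open>negligible_steep\<close> disposes of them.\<close>

lemma AE_infimum_times_negligible:
  assumes ub: "unbounded_variation M X"
  shows "AE \<omega> in M. negligible {u. 0 \<le> u \<and> X u \<omega> = - dep \<omega> u}"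
proof -
  define D where "D c m = {x\<in>space path_space. 0 < depth (\<lambda>s. x s + real c * s) (1 / real (Suc m))}"
    for c m :: nat
  have depth_eq: "depth (\<lambda>s\<in>{0..}. x s + real c * s) (1 / real (Suc m)) = depth (\<lambda>s. x s + real c * s) (1 / real (Suc m))"
    for x c m by (rule depth_restrict)
  have D: "D c m \<in> sets path_space" for c m
  proof -
    have "(\<lambda>x. \<lambda>s\<in>{0..}. x s + real c * s) \<in> path_space \<rightarrow>\<^sub>M path_space"
    proof (rule measurable_path_spaceI)
      fix s :: real assume "0 \<le> s"
      then have "(\<lambda>x. x s :: real) \<in> borel_measurable path_space"
        by (intro measurable_path_component[of "\<lambda>x. x"]) auto
      then show "(\<lambda>x. x s + real c * s) \<in> borel_measurable path_space" by simp
    qed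
    then have "(\<lambda>x. depth (\<lambda>s\<in>{0..}. x s + real c * s) (1 / real (Suc m))) \<in> borel_measurable path_space"
      by (rule borel_measurable_depth) simp
    then show ?thesis unfolding D_def depth_eq by simp
  qed
  have law: "measure path_law (D c m) = 1" for c m
  proof -
    interpret drift: levy_paths M "\<lambda>t \<omega>. X t \<omega> + real c * t" by (rule levy_paths_drift)
    have "AE \<omega> in M. \<forall>u>0. 0 < depth (\<lambda>t. X t \<omega> + real c * t) u"
      by (rule drift.AE_depth_pos) (use not_AE_mono_drift[OF ub, of "real c"] in simp)
    then have "AE \<omega> in M. (\<lambda>t\<in>{0..}. X t \<omega>) \<in> D c m" using AE_space[of M]
    proof eventually_elim
      case (elim \<omega>)
      have "depth (\<lambda>s. (\<lambda>t\<in>{0..}. X t \<omega>) s + real c * s) (1 / real (Suc m))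
          = depth (\<lambda>s\<in>{0..}. (\<lambda>t\<in>{0..}. X t \<omega>) s + real c * s) (1 / real (Suc m))"
        by (rule depth_restrict[symmetric])
      also have "(\<lambda>s\<in>{0..}. (\<lambda>t\<in>{0..}. X t \<omega>) s + real c * s) = (\<lambda>s\<in>{0..}. X s \<omega> + real c * s)"
        by auto
      also have "depth \<dots> (1 / real (Suc m)) = depth (\<lambda>s. X s \<omega> + real c * s) (1 / real (Suc m))"
        by (rule depth_restrict)
      finally show ?case
        using elim measurable_space[OF path_measurable] by (simp add: D_def)
    qed
    then show ?thesis
      unfolding measure_path_law[OF D] by (subst prob_eq_1)
        (use measurable_sets[OF path_measurable D] in \<open>auto simp: vimage_def Int_def conj_ac\<close>)
  qed
  \<comment> \<open>\<open>max 0 u\<close> extends the property to all real \<open>u\<close>, so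
    that Fubini can be used with Lebesgue measure on the whole line; c and m run over the naturals,
    so one null set serves them all.\<close>
  define Q where "Q u \<omega> c m \<longleftrightarrow>
    0 < depth (\<lambda>s. X (max 0 u + s) \<omega> - X (max 0 u) \<omega> + real c * s) (1 / real (Suc m))"
    for u \<omega> and c m :: nat
  have shift_Q: "Q u \<omega> c m \<longleftrightarrow> shift (max 0 u) \<omega> \<in> D c m" for u \<omega> c m
  proof -
    have "depth (\<lambda>s. shift (max 0 u) \<omega> s + real c * s) (1 / real (Suc m))
        = depth (\<lambda>s\<in>{0..}. shift (max 0 u) \<omega> s + real c * s) (1 / real (Suc m))"
      by (rule depth_restrict[symmetric])
    also have "(\<lambda>s\<in>{0..}. shift (max 0 u) \<omega> s + real c * s)
        = (\<lambda>s\<in>{0..}. X (max 0 u + s) \<omega> - X (max 0 u) \<omega> + real c * s)"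
      by (auto simp: shift_def)
    also have "depth \<dots> (1 / real (Suc m))
        = depth (\<lambda>s. X (max 0 u + s) \<omega> - X (max 0 u) \<omega> + real c * s) (1 / real (Suc m))"
      by (rule depth_restrict)
    finally show ?thesis by (simp add: Q_def D_def shift_def space_path_space)
  qed
  have Q: "AE \<omega> in M. \<forall>c m. Q u \<omega> c m" for u
  proof -
    have "AE \<omega> in M. Q u \<omega> c m" for c m
    proof -
      have sp: "space M \<in> past (max 0 u)"
        unfolding past_sets_def by (rule sigma_sets_top)
      have meas: "{\<omega>\<in>space M. shift (max 0 u) \<omega> \<in> D c m} \<in> events"
        using measurable_sets[OF shift_measurable[of "\<lambda>_. max 0 u"] D]
        by (simp add: vimage_def Int_def conj_ac)
      have "prob (space M \<inter> {\<omega>\<in>space M. shift (max 0 u) \<omega> \<in> D c m}) = prob (space M) * measure path_law (D c m)"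
        by (rule simple_markov[OF _ sp D]) simp
      then have "prob {\<omega>\<in>space M. shift (max 0 u) \<omega> \<in> D c m} = 1"
        by (simp add: prob_space law Int_absorb1 Collect_subset)
      then show ?thesis unfolding shift_Q using meas by (simp add: prob_eq_1)
    qed
    then show ?thesis by (simp add: AE_all_countable)
  qed
  have "AE \<omega> in M. AE u in lborel. \<forall>c m. Q u \<omega> c m"
  proof -
    interpret pair_sigma_finite lborel M ..
    have "{p\<in>space (lborel \<Otimes>\<^sub>M M). \<forall>c m. Q (fst p) (snd p) c m} \<in> sets (lborel \<Otimes>\<^sub>M M)"
    proof -
      have [measurable]: "(\<lambda>p. X (max 0 (fst p) + s) (snd p)) \<in> borel_measurable (lborel \<Otimes>\<^sub>M M)"
        if s: "0 \<le> s" for s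
      proof (rule measurable_right_continuous_at[where Y = "\<lambda>s p. X s (snd p)" and \<sigma> = "\<lambda>p. max 0 (fst p) + s"])
        show "(\<lambda>p. X t (snd p)) \<in> borel_measurable (lborel \<Otimes>\<^sub>M M)" if "0 \<le> t" for t
          using X_measurable[OF that] by (rule measurable_compose[OF measurable_snd])
        show "continuous (at_right t) (\<lambda>t. X t (snd p))" if "p \<in> space (lborel \<Otimes>\<^sub>M M)" "0 \<le> t" for p t
          using that by (intro good_path_right_continuous[OF good]) (auto simp: space_pair_measure)
      qed (use s in auto)
      have "(\<lambda>p. \<lambda>s\<in>{0..}. X (max 0 (fst p) + s) (snd p) - X (max 0 (fst p) + 0) (snd p) + real c * s)
          \<in> (lborel \<Otimes>\<^sub>M M) \<rightarrow>\<^sub>M path_space" for c :: nat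
        by (intro measurable_path_spaceI) measurable
      from borel_measurable_depth[OF this]
      have [measurable]: "(\<lambda>p. depth (\<lambda>s. X (max 0 (fst p) + s) (snd p) - X (max 0 (fst p)) (snd p) + real c * s)
          (1 / real (Suc m))) \<in> borel_measurable (lborel \<Otimes>\<^sub>M M)" for c m :: nat
        by (simp add: depth_restrict)
      show ?thesis unfolding Q_def by measurable
    qed
    from AE_commute[OF this] Q show ?thesis by simp
  qed
  then show ?thesis using AE_space[of M]
  proof eventually_elim
    case (elim \<omega>)
    note \<omega> = elim(2)
    obtain N where N: "{u\<in>space lborel. \<not> (\<forall>c m. Q u \<omega> c m)} \<subseteq> N" "N \<in> null_sets lborel"
      using elim(1) by (auto elim!: AE_E3 simp: eventually_ae_filter)
    have "negligible N" using N(2) by (simp add: negligible_iff_null_sets null_sets_completionI)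
    moreover have "negligible ({u. 0 \<le> u \<and> u \<le> real n \<and> X u \<omega> = - dep \<omega> u} - N)" (is "negligible (?S n)") for n :: nat
    proof (rule negligible_steep[where d = "dep \<omega>" and t = "real n"])
      show "dep \<omega> u \<le> dep \<omega> v" if "0 \<le> u" "u \<le> v" for u v
        using that by (rule depth_mono[OF good[OF \<omega>]])
      show "?S n \<subseteq> {0..real n}" by auto
      fix u c m assume u: "u \<in> ?S n"
      then have "Q u \<omega> c m" and u0: "0 \<le> u" "X u \<omega> = - dep \<omega> u" using N(1) by auto
      then have *: "0 < depth (\<lambda>s. X (u + s) \<omega> - X u \<omega> + real c * s) (1 / real (Suc m))"
        by (simp add: Q_def max_def)
      have gp: "good_path (\<lambda>s. X (u + s) \<omega> - X u \<omega> + real c * s)"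
        by (intro good_path_add_linear good_path_shift good \<omega> u0)
      have "0 \<le> 1 / real (Suc m)" by simp
      from less_depth_iff[OF gp this] *
      obtain h where h: "h \<in> {0..1 / real (Suc m)}" "0 < - (X (u + h) \<omega> - X u \<omega> + real c * h)"
        by blast
      \<comment> \<open>At such an \<open>h\<close> the path has fallen by more than c * h from its
        infimum value \<open>- dep \<omega> u\<close>, so the infimum itself has moved by at least c
        * h within 1 / (m + 1). At h = 0 the strict inequality would fail.\<close>
      have "h \<noteq> 0" using h(2) by auto
      moreover have "- X (u + h) \<omega> \<le> dep \<omega> (u + h)"
        using h(1) u0 by (intro depth_upper[OF good[OF \<omega>]]) auto
      ultimately show "\<exists>h>0. h \<le> 1 / real (Suc m) \<and> real c * h \<le> dep \<omega> (u + h) - dep \<omega> u"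
        using h u0 by (intro exI[of _ h]) auto
    qed
    then have "negligible (\<Union>n. ?S n)" unfolding negligible_iff_null_sets by (rule null_sets_UN)
    ultimately have "negligible (N \<union> (\<Union>n. ?S n))" by (rule negligible_Un)
    then show ?case
      by (rule negligible_subset) (use real_arch_simple in blast)
  qed
qed

text \<open>Quasi-left-continuity: the passage times below levels increasing to \<open>z\<close> announce the first time at
  which the infimum is \<open>- z\<close>, and after each of them the path is a fresh copy of \<^term>\<open>X\<close>, so
  there is almost surely no jump at the announced time.\<close>

lemma AE_reaches_level:
  assumes z: "0 < z"
  shows "AE \<omega> in M. \<forall>t\<ge>0. z \<le> dep \<omega> t \<longrightarrow> (\<exists>s\<in>{0..t}. z + X s \<omega> = 0)"
proof -
  interpret path: prob_space path_law by (rule prob_space_path_law)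
  \<comment> \<open>Levels strictly below \<open>z\<close> that increase to it; the offset 2 makes
    the first one z / 2.\<close>
  define lev where "lev n = z - z / real (Suc (Suc n))" for n
  have lev: "0 \<le> lev n" "lev n < z" "lev n \<le> lev (Suc n)" for n
    using z by (auto simp: lev_def field_simps)
  have "(\<lambda>n. 1 / real (Suc (Suc n))) \<longlonglongrightarrow> 0"
    using LIMSEQ_Suc[OF LIMSEQ_inverse_real_of_nat] by (simp only: inverse_eq_divide)
  from tendsto_mult[OF tendsto_const[of z] this]
  have lev_gap: "(\<lambda>n. z / real (Suc (Suc n))) \<longlonglongrightarrow> 0" by simp
  from tendsto_diff[OF tendsto_const[of z] this]
  have lev_lim: "lev \<longlonglongrightarrow> z" by (simp add: lev_def[abs_def])
  \<comment> \<open>Paths that rise by more than 1 / (k + 1) within time 1 / (m + 1). A jump at the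
    announced time would force this on the copies started at late passages. Rational times make the
    set measurable.\<close>
  define D where "D k m = {x\<in>space path_space. \<exists>q\<in>\<rat> \<inter> {0<..<1 / real (Suc m)}. 1 / real (Suc k) < x q}"
    for k m :: nat
  have D: "D k m \<in> sets path_space" for k m
  proof -
    have "D k m = (\<Union>q\<in>\<rat> \<inter> {0<..<1 / real (Suc m)}. {x\<in>space path_space. 1 / real (Suc k) < x q})"
      by (auto simp: D_def)
    also have "\<dots> \<in> sets path_space"
    proof (intro sets.countable_UN'')
      fix q assume "q \<in> \<rat> \<inter> {0<..<1 / real (Suc m)}"
      then have "(\<lambda>x. x q :: real) \<in> borel_measurable path_space"
        by (intro measurable_path_component) auto
      then show "{x\<in>space path_space. 1 / real (Suc k) < x q} \<in> sets path_space" by simp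
    qed (simp add: countable_rat)
    finally show ?thesis .
  qed
  \<comment> \<open>For fixed k the probability of such a rise vanishes with the allowed time,
    because paths are right-continuous at 0, where they start from 0.\<close>
  have small: "(\<lambda>m. measure path_law (D k m)) \<longlonglongrightarrow> 0" for k
  proof -
    define B where "B m = {\<omega>\<in>space M. (\<lambda>t\<in>{0..}. X t \<omega>) \<in> D k m}" for m
    have "range B \<subseteq> events"
      using measurable_sets[OF path_measurable D] by (auto simp: B_def vimage_def Int_def conj_ac)
    moreover have "decseq B"
    proof (rule decseq_SucI)
      fix m
      have "1 / real (Suc (Suc m)) \<le> 1 / real (Suc m)" by (intro divide_left_mono) auto
      then show "B (Suc m) \<subseteq> B m"
        by (fastforce simp: B_def D_def simp del: of_nat_Suc)
    qed
    ultimately have "(\<lambda>m. prob (B m)) \<longlonglongrightarrow> prob (\<Inter>m. B m)"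
      by (rule finite_Lim_measure_decseq)
    also have "(\<Inter>m. B m) = {}"
    proof (rule equals0I)
      fix \<omega> assume *: "\<omega> \<in> (\<Inter>m. B m)"
      then have \<omega>: "\<omega> \<in> space M" by (auto simp: B_def)
      obtain b where b: "0 < b" "\<And>r. 0 < r \<Longrightarrow> r < b \<Longrightarrow> \<bar>X r \<omega> - X 0 \<omega>\<bar> < 1 / real (Suc k)"
        using good_path_right[OF good[OF \<omega>], of 0 "1 / real (Suc k)"] by auto
      obtain m where m: "1 / real (Suc m) < b"
        using reals_Archimedean[OF b(1)] by (auto simp: inverse_eq_divide)
      have "\<omega> \<in> B m" using * by blast
      then obtain q where q: "0 < q" "q < 1 / real (Suc m)" "1 / real (Suc k) < X q \<omega>"
        by (auto simp: B_def D_def)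
      have "\<bar>X q \<omega> - X 0 \<omega>\<bar> < 1 / real (Suc k)" using q m by (intro b(2)) auto
      with q(3) X_0[OF \<omega>] show False by simp
    qed
    finally show ?thesis unfolding B_def measure_path_law[OF D, symmetric] by simp
  qed
  have main: "AE \<omega> in M. \<forall>t\<in>{0..real N}. z \<le> dep \<omega> t \<longrightarrow> (\<exists>s\<in>{0..t}. z + X s \<omega> = 0)" for N :: nat
  proof -
    define L where "L = real N + 1"
    have L: "0 \<le> L" "real N \<le> L" "0 \<le> real N" by (auto simp: L_def)
    define A where "A n = {\<omega>\<in>space M. lev n < dep \<omega> (real N)}" for n
    define E where "E k m n = A n \<inter> {\<omega>\<in>space M. shift (hit (lev n) L \<omega>) \<omega> \<in> D k m}" for k m n
    have hitA: "A n \<subseteq> space M" "\<And>\<omega>. \<omega> \<in> A n \<Longrightarrow> 0 \<le> hit (lev n) L \<omega>"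
      "\<And>u. 0 < u \<Longrightarrow> {\<omega>\<in>A n. hit (lev n) L \<omega> < u} \<in> past u" for n
    proof -
      show "A n \<subseteq> space M" by (auto simp: A_def)
      then show "0 \<le> hit (lev n) L \<omega>" if "\<omega> \<in> A n" for \<omega>
        using that by (intro hit_nonneg[OF L(1)]) blast
      show "{\<omega>\<in>A n. hit (lev n) L \<omega> < u} \<in> past u" if "0 < u" for u
        unfolding A_def by (rule hit_optional[OF lev(1) L(3) L(2) that])
    qed
    have E: "E k m n \<in> events" for k m n
      unfolding E_def by (rule optional_shift_event[OF hitA D])
    have prob_E: "prob (E k m n) \<le> measure path_law (D k m)" for k m n
    proof -
      have "prob (E k m n) = prob (A n) * measure path_law (D k m)"
        unfolding E_def by (rule strong_markov(2)[OF hitA D])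
      also have "\<dots> \<le> 1 * measure path_law (D k m)" by (intro mult_right_mono) auto
      finally show ?thesis by simp
    qed
    \<comment> \<open>A rise after all passages with sufficiently large index. Each event
      \<open>E k m n\<close> has probability at most that of \<open>D k m\<close>, whatever n is, so
      the same bound holds for this lower limit and tends to 0 with growing m.\<close>
    define G where "G k m = (\<Union>i. \<Inter>n\<in>{i..}. E k m n)" for k m
    have I: "(\<Inter>n\<in>{i..}. E k m n) \<in> events" for k m i
      using E by (intro sets.countable_INT') auto
    then have G: "G k m \<in> events" for k m unfolding G_def by (intro sets.countable_UN) auto
    have prob_G: "prob (G k m) \<le> measure path_law (D k m)" for k m
    proof -
      have "(\<lambda>i. prob (\<Inter>n\<in>{i..}. E k m n)) \<longlonglongrightarrow> prob (G k m)"
        unfolding G_def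
      proof (rule finite_Lim_measure_incseq)
        show "range (\<lambda>i. \<Inter>n\<in>{i..}. E k m n) \<subseteq> events" using I by blast
        show "incseq (\<lambda>i. \<Inter>n\<in>{i..}. E k m n)" by (rule incseq_SucI) auto
      qed
      moreover have "prob (\<Inter>n\<in>{i..}. E k m n) \<le> measure path_law (D k m)" for i
      proof -
        have "prob (\<Inter>n\<in>{i..}. E k m n) \<le> prob (E k m i)"
          using E by (intro finite_measure_mono) auto
        then show ?thesis using prob_E order_trans by blast
      qed
      ultimately show ?thesis by (intro LIMSEQ_le_const2) auto
    qed
    have "(\<Inter>m. G k m) \<in> null_sets M" for k
    proof -
      have ev: "(\<Inter>m. G k m) \<in> events" using G by (intro sets.countable_INT) auto
      have "prob (\<Inter>m. G k m) \<le> measure path_law (D k m)" for m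
      proof -
        have "prob (\<Inter>m. G k m) \<le> prob (G k m)" using G by (intro finite_measure_mono) auto
        then show ?thesis using prob_G order_trans by blast
      qed
      then have "prob (\<Inter>m. G k m) \<le> 0" by (intro LIMSEQ_le_const[OF small]) auto
      then have "prob (\<Inter>m. G k m) = 0" using measure_nonneg[of M "\<Inter>m. G k m"] by linarith
      with ev show ?thesis by (simp add: null_sets_def emeasure_eq_measure)
    qed
    then have "(\<Union>k. \<Inter>m. G k m) \<in> null_sets M" by (intro null_sets_UN)
    from AE_not_in[OF this] AE_space[of M] show ?thesis
    proof eventually_elim
      case (elim \<omega>)
      note \<omega> = elim(2)
      show ?case
      proof (intro ballI impI)
        fix t :: real assume t: "t \<in> {0..real N}" and zt: "z \<le> dep \<omega> t"
        define h where "h n = hit (lev n) L \<omega>" for n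
        have tN: "0 \<le> t" "t \<le> L" using t by (auto simp: L_def)
        have h_t: "h n < t" for n
          using hit_less_iff[OF L(1) \<omega> lev(1) tN, of n] lev(2)[of n] zt by (simp add: h_def)
        have h0: "0 \<le> h n" for n unfolding h_def by (rule hit_nonneg[OF L(1) \<omega>])
        have "h n < L" for n using h_t[of n] tN by simp
        then have att: "dep \<omega> (h n) = lev n" "X (h n) \<omega> = - lev n" for n
          unfolding h_def by (auto intro!: hit_attained[OF L(1) \<omega> lev(1)])
        have "incseq h" unfolding h_def by (intro incseq_SucI hit_mono[OF L(1) \<omega> lev(3)])
        then obtain \<sigma> where \<sigma>: "h \<longlonglongrightarrow> \<sigma>" "\<forall>n. h n \<le> \<sigma>"
          using incseq_convergent[of h t] h_t by (metis less_imp_le)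
        have \<sigma>_t: "\<sigma> \<le> t" using \<sigma>(1) h_t by (intro LIMSEQ_le_const2) (auto intro: less_imp_le)
        have \<sigma>0: "0 \<le> \<sigma>" using \<sigma>(2) h0[of 0] order_trans by blast
        have "(\<lambda>n. dep \<omega> (h n)) \<longlonglongrightarrow> dep \<omega> \<sigma>"
          using \<sigma>0 h0 by (intro continuous_on_tendsto_compose[OF depth_continuous[OF good[OF \<omega>]] \<sigma>(1)]) auto
        then have "lev \<longlonglongrightarrow> dep \<omega> \<sigma>" by (simp add: att)
        then have dep\<sigma>: "dep \<omega> \<sigma> = z" using lev_lim LIMSEQ_unique by blast
        have h_less: "h n < \<sigma>" for n
        proof -
          have "h n \<noteq> \<sigma>" using att(1)[of n] dep\<sigma> lev(2)[of n] by auto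
          then show ?thesis using \<sigma>(2) by (simp add: less_le)
        qed
        have "z + X \<sigma> \<omega> = 0"
        proof (rule ccontr)
          assume ne: "z + X \<sigma> \<omega> \<noteq> 0"
          \<comment> \<open>The height of the supposed jump at \<sigma>: the passage values
            \<open>- lev n\<close> tend to \<open>- z\<close>, whereas the value at \<sigma> is
            \<delta> higher. For large n the rise since the passage exceeds \<delta> / 2, hence 1 /
            (k + 1).\<close>
          define \<delta> where "\<delta> = z + X \<sigma> \<omega>"
          have "- X \<sigma> \<omega> \<le> z" using depth_upper[OF good[OF \<omega>] \<sigma>0 order_refl] dep\<sigma> by simp
          with ne have \<delta>: "0 < \<delta>" by (simp add: \<delta>_def)
          then obtain k where k: "1 / real (Suc k) < \<delta> / 2"
            using reals_Archimedean[of "\<delta> / 2"] by (auto simp: inverse_eq_divide)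
          have "\<omega> \<in> G k m" for m
          proof -
            have "\<forall>\<^sub>F n in sequentially. z / real (Suc (Suc n)) < \<delta> / 2"
              using \<delta> by (intro order_tendstoD(2)[OF lev_gap]) simp
            moreover have "\<forall>\<^sub>F n in sequentially. \<sigma> - 1 / real (Suc m) < h n"
              by (intro order_tendstoD(1)[OF \<sigma>(1)]) simp
            ultimately have "\<forall>\<^sub>F n in sequentially. \<omega> \<in> E k m n"
            proof eventually_elim
              case (elim n)
              define s where "s = \<sigma> - h n"
              have s: "0 < s" "s < 1 / real (Suc m)" using h_less[of n] elim(2) by (auto simp: s_def)
              have "1 / real (Suc k) < X (h n + s) \<omega> - X (h n) \<omega>"
                using elim(1) k by (simp add: s_def att(2) lev_def \<delta>_def)
              then have pos: "0 < X (h n + s) \<omega> - X (h n) \<omega> - 1 / real (Suc k)" by simp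
              \<comment> \<open>The rise is observed at \<open>s\<close>, which may be irrational;
                right continuity preserves the strict inequality up to a rational time just after
                it.\<close>
              obtain b where b: "s < b" "\<And>r. s < r \<Longrightarrow> r < b \<Longrightarrow>
                  \<bar>(X (h n + r) \<omega> - X (h n) \<omega>) - (X (h n + s) \<omega> - X (h n) \<omega>)\<bar>
                    < X (h n + s) \<omega> - X (h n) \<omega> - 1 / real (Suc k)"
                using good_path_right[OF good_path_shift[OF good[OF \<omega>] h0[of n]] less_imp_le[OF s(1)] pos]
                by blast
              obtain q where q: "q \<in> \<rat>" "s < q" "q < min b (1 / real (Suc m))"
                using Rats_dense_in_real[of s "min b (1 / real (Suc m))"] b(1) s(2) by auto
              have "1 / real (Suc k) < X (h n + q) \<omega> - X (h n) \<omega>"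
                using b(2)[of q] q by auto
              then have "shift (h n) \<omega> \<in> D k m"
                using q s by (auto simp: D_def shift_def space_path_space intro!: bexI[of _ q])
              moreover have "\<omega> \<in> A n"
              proof -
                have "dep \<omega> t \<le> dep \<omega> (real N)" using t by (intro depth_mono[OF good[OF \<omega>]]) auto
                then show ?thesis using lev(2)[of n] zt \<omega> by (simp add: A_def)
              qed
              ultimately show ?case using \<omega> by (simp add: E_def h_def)
            qed
            then show ?thesis unfolding G_def eventually_sequentially by blast
          qed
          then show False using elim(1) by blast
        qed
        then show "\<exists>s\<in>{0..t}. z + X s \<omega> = 0" using \<sigma>0 \<sigma>_t by auto
      qed
    qed
  qed
  then have "AE \<omega> in M. \<forall>N::nat. \<forall>t\<in>{0..real N}. z \<le> dep \<omega> t \<longrightarrow> (\<exists>s\<in>{0..t}. z + X s \<omega> = 0)"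
    by (simp add: AE_all_countable)
  then show ?thesis
  proof eventually_elim
    case (elim \<omega>)
    show ?case
    proof (intro allI impI)
      fix t :: real assume t: "0 \<le> t" "z \<le> dep \<omega> t"
      obtain N :: nat where "t \<le> real N" using real_arch_simple by blast
      then have "t \<in> {0..real N}" using t by simp
      then show "\<exists>s\<in>{0..t}. z + X s \<omega> = 0" using elim t(2) by blast
    qed
  qed
qed

end

lemma right_continuous_stopped:
  fixes f :: "real \<Rightarrow> real"
  assumes "continuous (at_right s) f"
  shows "continuous (at_right s) (\<lambda>s. f (min s r))"
proof (cases "s < r")
  case True
  have "\<forall>\<^sub>F v in at_right s. f v = f (min v r)"
    unfolding eventually_at_right_field by (rule exI[of _ r]) (use True in auto)
  then have "((\<lambda>v. f (min v r)) \<longlongrightarrow> f s) (at_right s)"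
    using assms unfolding continuous_within by (rule Lim_transform_eventually[rotated])
  then show ?thesis using True by (simp add: continuous_within)
next
  case False
  have "\<forall>\<^sub>F v in at_right s. f (min s r) = f (min v r)"
    using eventually_at_right_less[of s] by eventually_elim (use False in \<open>simp add: min_def\<close>)
  then have "((\<lambda>v. f (min v r)) \<longlongrightarrow> f (min s r)) (at_right s)"
    using tendsto_const by (rule Lim_transform_eventually[rotated])
  then show ?thesis by (simp add: continuous_within)
qed

text \<open>For passing between a solution and its explicit version inside a \<sigma>-algebra
  smaller than that of \<open>M\<close>: two sets that agree almost surely differ by null sets, and
  these already belong to the smaller one.\<close>

lemma sets_AE_modification:
  assumes "complete_measure M" and alg: "sigma_algebra (space M) \<A>" and null: "null_sets M \<subseteq> \<A>"
    and sub: "\<A> \<subseteq> sets M" and A: "A \<in> \<A>" and B: "B \<subseteq> space M"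
    and ae: "AE \<omega> in M. \<omega> \<in> A \<longleftrightarrow> \<omega> \<in> B"
  shows "B \<in> \<A>"
proof -
  interpret complete_measure M by fact
  interpret \<A>: sigma_algebra "space M" \<A> by (rule alg)
  have A': "A \<in> sets M" using A sub by blast
  have B': "B \<in> sets M" using ae A' B by (rule in_sets_AE)
  have "AE \<omega> in M. \<omega> \<notin> A - B" "AE \<omega> in M. \<omega> \<notin> B - A"
    using ae by (eventually_elim, simp)+
  then have "A - B \<in> null_sets M" "B - A \<in> null_sets M"
  proof -
    have "{\<omega>\<in>space M. \<not> \<omega> \<notin> A - B} = A - B" "{\<omega>\<in>space M. \<not> \<omega> \<notin> B - A} = B - A"
      using sets.sets_into_space[OF A'] B by blast+
    moreover assume "AE \<omega> in M. \<omega> \<notin> A - B" "AE \<omega> in M. \<omega> \<notin> B - A"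
    ultimately show "A - B \<in> null_sets M" "B - A \<in> null_sets M"
      unfolding AE_iff_null_sets by (simp_all only:)
  qed
  then have "(A - (A - B)) \<union> (B - A) \<in> \<A>" using A null by blast
  also have "(A - (A - B)) \<union> (B - A) = B" by blast
  finally show ?thesis .
qed

section \<open>Adaptedness of the clock\<close>

locale sticky_levy = levy_paths +
  fixes \<gamma> :: real
  assumes \<gamma>: "0 < \<gamma>" and ub: "unbounded_variation M X"
begin

abbreviation Zc :: "real \<Rightarrow> real \<Rightarrow> 'a \<Rightarrow> real" where
  "Zc y t \<omega> \<equiv> sticky \<gamma> y (\<lambda>s. X s \<omega>) t"

abbreviation Cc :: "real \<Rightarrow> real \<Rightarrow> 'a \<Rightarrow> real" where
  "Cc y t \<omega> \<equiv> clock \<gamma> y (\<lambda>s. X s \<omega>) t"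

abbreviation past_alg :: "real \<Rightarrow> 'a measure" where
  "past_alg r \<equiv> sigma (space M) (past r)"

lemma sticky_path: "\<omega> \<in> space M \<Longrightarrow> 0 \<le> y \<Longrightarrow> sticky_path (\<lambda>s. X s \<omega>) \<gamma> y"
  by unfold_locales (use good \<gamma> in auto)

lemma sigma_algebra_past: "sigma_algebra (space M) (past r)"
  using sigma_algebra_past_sets[of X M] X_measurable by blast

lemma null_sets_past: "null_sets M \<subseteq> past r"
  unfolding past_sets_def by (auto intro: sigma_sets.Basic)

lemma sets_past_alg [simp]: "sets (past_alg r) = past r"
  using sigma_algebra.sets_measure_of_eq[OF sigma_algebra_past] .

lemma space_past_alg [simp]: "space (past_alg r) = space M"
  by (rule space_measure_of) (use past_subset sets.space_closed in blast)

lemma past_mono: "r \<le> s \<Longrightarrow> past r \<subseteq> past s"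
  by (intro past_sets_mono ennreal_leI)

lemma dep_past_measurable:
  assumes "0 \<le> u" "u \<le> r" shows "(\<lambda>\<omega>. dep \<omega> u) \<in> borel_measurable (past_alg r)"
proof (rule borel_measurableI_greater)
  fix b show "{\<omega>\<in>space (past_alg r). b < dep \<omega> u} \<in> sets (past_alg r)"
    using depth_past[OF assms(1), of b] past_mono[OF assms(2)] by auto
qed

lemma X_past_measurable:
  assumes "0 \<le> u" "u \<le> r" shows "X u \<in> borel_measurable (past_alg r)"
proof (rule measurableI)
  fix B :: "real set" assume "B \<in> sets borel"
  then have "X u -` B \<inter> space M \<in> {X u -` B \<inter> space M |u B. 0 \<le> u \<and> ennreal u \<le> ennreal r \<and> B \<in> sets borel}"
    using assms by (intro CollectI exI[of _ u] exI[of _ B]) (simp add: ennreal_leI)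
  then have "X u -` B \<inter> space M \<in> past r"
    unfolding past_sets_def by (intro sigma_sets.Basic) blast
  then show "X u -` B \<inter> space (past_alg r) \<in> sets (past_alg r)" by simp
qed simp

context
  fixes y :: real
  assumes y: "0 \<le> y"
begin

text \<open>Inverting the clock: it has not passed \<open>r\<close> exactly if \<tau> at
  \<open>r\<close> is at least \<open>t\<close>, and \<tau> at \<open>r\<close> is read off from the
  infimum up to \<open>r\<close>. So each clock value is a stopping time of
  \<open>X\<close>.\<close>

lemma clock_past_le:
  assumes "0 \<le> t" "0 \<le> r"
  shows "{\<omega>\<in>space M. Cc y t \<omega> \<le> r} \<in> past r"
proof -
  note [measurable] = dep_past_measurable[OF assms(2) order_refl]
  have "{\<omega>\<in>space M. Cc y t \<omega> \<le> r} = {\<omega>\<in>space (past_alg r). t \<le> r + max 0 (dep \<omega> r - y) / \<gamma>}"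
    using sticky_path.clock_le_iff[OF sticky_path[OF _ y] assms]
    by (auto simp: sticky_path.\<tau>_def[OF sticky_path[OF _ y]] sticky_path.push_def[OF sticky_path[OF _ y]])
  also have "\<dots> \<in> sets (past_alg r)" by measurable
  finally show ?thesis by simp
qed

lemma clock_past_less:
  assumes "0 \<le> t" "0 \<le> r"
  shows "{\<omega>\<in>space M. Cc y t \<omega> < r} \<in> past r"
proof -
  note [measurable] = dep_past_measurable[OF assms(2) order_refl]
  have "{\<omega>\<in>space M. Cc y t \<omega> < r} = {\<omega>\<in>space (past_alg r). t < r + max 0 (dep \<omega> r - y) / \<gamma>}"
    using sticky_path.clock_less_iff[OF sticky_path[OF _ y] assms]
    by (auto simp: sticky_path.\<tau>_def[OF sticky_path[OF _ y]] sticky_path.push_def[OF sticky_path[OF _ y]])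
  also have "\<dots> \<in> sets (past_alg r)" by measurable
  finally show ?thesis by simp
qed

text \<open>On the event that the clock is at most \<open>r\<close>, the value of \<open>Z\<close>
  is unchanged when \<open>X\<close> and its infimum are evaluated at the clock stopped at
  \<open>r\<close>. Stopping also the process keeps the approximation from the right within the past
  of \<open>r\<close>.\<close>

lemma sticky_past:
  assumes t: "0 \<le> t" and r: "0 \<le> r" and B: "B \<in> sets borel"
  shows "{\<omega>\<in>space M. Zc y t \<omega> \<in> B \<and> Cc y t \<omega> \<le> r} \<in> past r"
proof -
  define \<sigma> where "\<sigma> \<omega> = min (Cc y t \<omega>) r" for \<omega>
  have \<sigma>0: "0 \<le> \<sigma> \<omega>" for \<omega> using r clock_nonneg by (simp add: \<sigma>_def)
  have \<sigma>[measurable]: "\<sigma> \<in> borel_measurable (past_alg r)"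
  proof (rule borel_measurableI_le)
    fix b
    consider "b < 0" | "0 \<le> b" "b < r" | "r \<le> b" by linarith
    then show "{\<omega>\<in>space (past_alg r). \<sigma> \<omega> \<le> b} \<in> sets (past_alg r)"
    proof cases
      case 1
      then have "\<not> \<sigma> \<omega> \<le> b" for \<omega> using \<sigma>0[of \<omega>] by simp
      then have "{\<omega>\<in>space (past_alg r). \<sigma> \<omega> \<le> b} = {}" by blast
      then show ?thesis by (metis sets.empty_sets)
    next
      case 2
      then have "{\<omega>\<in>space (past_alg r). \<sigma> \<omega> \<le> b} = {\<omega>\<in>space M. Cc y t \<omega> \<le> b}"
        by (auto simp: \<sigma>_def)
      also have "\<dots> \<in> past r" using clock_past_le[OF t 2(1)] past_mono[of b r] 2 by auto
      finally show ?thesis by simp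
    next
      case 3
      then have "{\<omega>\<in>space (past_alg r). \<sigma> \<omega> \<le> b} = space (past_alg r)" by (auto simp: \<sigma>_def)
      then show ?thesis by (metis sets.top)
    qed
  qed
  have X\<sigma>: "(\<lambda>\<omega>. X (min (\<sigma> \<omega>) r) \<omega>) \<in> borel_measurable (past_alg r)"
  proof (rule measurable_right_continuous_at[where Y = "\<lambda>s. X (min s r)"])
    show "continuous (at_right s) (\<lambda>s. X (min s r) \<omega>)" if "\<omega> \<in> space (past_alg r)" "0 \<le> s" for s \<omega>
      using good_path_right_continuous[OF good, of \<omega> s] that by (intro right_continuous_stopped) auto
  qed (use \<sigma> \<sigma>0 r in \<open>auto intro: X_past_measurable\<close>)
  have d\<sigma>: "(\<lambda>\<omega>. dep \<omega> (min (\<sigma> \<omega>) r)) \<in> borel_measurable (past_alg r)"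
  proof (rule measurable_right_continuous_at[where Y = "\<lambda>s \<omega>. dep \<omega> (min s r)"])
    show "continuous (at_right s) (\<lambda>s. dep \<omega> (min s r))" if \<omega>: "\<omega> \<in> space (past_alg r)" and s: "0 \<le> s" for s \<omega>
    proof (rule right_continuous_stopped)
      have "continuous (at s within {0..}) (dep \<omega>)"
        using depth_continuous[OF good] \<omega> s by (simp add: continuous_on_eq_continuous_within)
      then show "continuous (at_right s) (dep \<omega>)"
        by (rule continuous_within_subset) (use s in auto)
    qed
  qed (use \<sigma> \<sigma>0 r in \<open>auto intro: dep_past_measurable\<close>)
  note [measurable] = X\<sigma> d\<sigma> B
  have "{\<omega>\<in>space (past_alg r). y + X (min (\<sigma> \<omega>) r) \<omega> + max 0 (dep \<omega> (min (\<sigma> \<omega>) r) - y) \<in> B}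
      \<in> sets (past_alg r)" (is "?W \<in> _")
    by measurable
  then have "?W \<inter> {\<omega>\<in>space M. Cc y t \<omega> \<le> r} \<in> sets (past_alg r)"
    using clock_past_le[OF t r] by (intro sets.Int) simp_all
  also have "?W \<inter> {\<omega>\<in>space M. Cc y t \<omega> \<le> r} = {\<omega>\<in>space M. Zc y t \<omega> \<in> B \<and> Cc y t \<omega> \<le> r}"
    using sticky_path.sticky_eq[OF sticky_path[OF _ y] t]
    by (auto simp: \<sigma>_def min_def sticky_path.reflected_def[OF sticky_path[OF _ y]]
        sticky_path.push_def[OF sticky_path[OF _ y]])
  finally show ?thesis by simp
qed

lemma sticky_measurable: "0 \<le> t \<Longrightarrow> Zc y t \<in> borel_measurable M"
  using borel_measurable_sticky[OF path_measurable, of "\<lambda>_. t" "\<lambda>_. y"] by (simp add: sticky_restrict)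

lemma clock_measurable: "0 \<le> t \<Longrightarrow> Cc y t \<in> borel_measurable M"
  using borel_measurable_clock[OF path_measurable, of "\<lambda>_. t" "\<lambda>_. y"] by (simp add: clock_restrict)

lemma AE_sticky_solves: "AE \<omega> in M. solves_path (\<lambda>s. X s \<omega>) \<gamma> y (\<lambda>t. Zc y t \<omega>) (\<lambda>t. Cc y t \<omega>)"
  using AE_infimum_times_negligible[OF ub] AE_space[of M]
proof eventually_elim
  case (elim \<omega>)
  show ?case by (rule sticky_path.sticky_solves[OF sticky_path[OF elim(2) y] elim(1)])
qed

lemma solution_path:
  assumes "\<omega> \<in> space M" "solves_path (\<lambda>s. X s \<omega>) \<gamma> y f c"
  shows "solution_path (\<lambda>s. X s \<omega>) \<gamma> y f c"
  using sticky_path[OF assms(1) y] assms(2) by (simp add: solution_path_def solution_path_axioms_def)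

lemma AE_solution_eq:
  assumes "sticky_solution M X \<gamma> y Z C"
  shows "AE \<omega> in M. \<forall>t\<ge>0. Z t \<omega> = Zc y t \<omega> \<and> C t \<omega> = Cc y t \<omega>"
proof -
  have "AE \<omega> in M. solves_path (\<lambda>s. X s \<omega>) \<gamma> y (\<lambda>t. Z t \<omega>) (\<lambda>t. C t \<omega>)"
    using assms by (simp add: sticky_solution_def)
  then show ?thesis using AE_space[of M]
  proof eventually_elim
    case (elim \<omega>)
    interpret solution_path "\<lambda>s. X s \<omega>" \<gamma> y "\<lambda>t. Z t \<omega>" "\<lambda>t. C t \<omega>"
      by (rule solution_path[OF elim(2,1)])
    show ?case using f_unique c_unique by blast
  qed
qed

end

end

section \<open>The strong Markov property\<close>

text \<open>The natural filtration in the strong Markov property is that of the given solution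
  \<open>Y\<close>, which equals the explicit version \<open>Zc\<close> only almost surely. Both are
  carried along and compared through null sets.\<close>

locale sticky_process = sticky_levy +
  fixes y :: real and Y :: "real \<Rightarrow> 'a \<Rightarrow> real"
  assumes y: "0 \<le> y" and Y_measurable: "\<And>t. 0 \<le> t \<Longrightarrow> Y t \<in> borel_measurable M"
    and Y_eq: "AE \<omega> in M. \<forall>t\<ge>0. Y t \<omega> = Zc y t \<omega>"
begin

abbreviation H :: "ennreal \<Rightarrow> 'a measure" where
  "H \<equiv> natural_filtration M Y"

lemma sigma_algebra_past_Y: "sigma_algebra (space M) (past_sets M Y t)"
  and past_Y_subset: "past_sets M Y t \<subseteq> events"
  using sigma_algebra_past_sets[of Y M] past_sets_subset[of Y M] Y_measurable by blast+

lemma null_sets_past_Y: "null_sets M \<subseteq> past_sets M Y t"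
  unfolding past_sets_def by (auto intro: sigma_sets.Basic)

lemma sets_H: "sets (H t) = (\<Inter>s\<in>insert \<infinity> {t<..}. past_sets M Y s)" (is "_ = ?I")
proof -
  have sub: "?I \<subseteq> Pow (space M)" using past_Y_subset sets.space_closed by blast
  have "sigma_sets (space M) ?I = ?I"
  proof
    show "sigma_sets (space M) ?I \<subseteq> ?I"
    proof (rule INT_greatest)
      fix s assume "s \<in> insert \<infinity> {t<..}"
      then have "sigma_sets (space M) ?I \<subseteq> sigma_sets (space M) (past_sets M Y s)"
        by (intro sigma_sets_mono') blast
      also have "\<dots> = past_sets M Y s" by (rule sigma_algebra.sigma_sets_eq[OF sigma_algebra_past_Y])
      finally show "sigma_sets (space M) ?I \<subseteq> past_sets M Y s" .
    qed
  qed (auto intro: sigma_sets.Basic)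
  then show ?thesis using sub by (simp add: natural_filtration_def)
qed

lemma space_H: "space (H t) = space M"
  unfolding natural_filtration_def
  by (rule space_measure_of) (use past_Y_subset sets.space_closed in blast)

lemma H_subset_past: "t < s \<Longrightarrow> sets (H t) \<subseteq> past_sets M Y s"
  unfolding sets_H by blast

lemma H_events: "sets (H t) \<subseteq> events"
  unfolding sets_H using past_Y_subset by blast

lemma null_sets_H: "null_sets M \<subseteq> sets (H t)"
  unfolding sets_H using null_sets_past_Y by blast

lemma H_mono: "s \<le> t \<Longrightarrow> sets (H s) \<subseteq> sets (H t)"
  unfolding sets_H by auto

lemma filtration_H: "filtration (space M) H"
  by unfold_locales (simp_all add: space_H H_mono)

interpretation H: filtration "space M" H by (rule filtration_H)

lemma H_AE_modification:
  assumes "A \<in> sets (H t)" "B \<subseteq> space M" "AE \<omega> in M. \<omega> \<in> A \<longleftrightarrow> \<omega> \<in> B"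
  shows "B \<in> sets (H t)"
proof -
  have "sigma_algebra (space M) (sets (H t))"
    using sets.sigma_algebra_axioms[of "H t"] unfolding space_H .
  from sets_AE_modification[OF complete this null_sets_H H_events assms] show ?thesis .
qed

lemma Zc_H_measurable:
  assumes "0 \<le> u" "ennreal u \<le> t"
  shows "Zc y u \<in> borel_measurable (H t)"
proof (rule measurableI)
  fix B :: "real set" assume B: "B \<in> sets borel"
  have "Y u -` B \<inter> space M \<in> past_sets M Y s" if "s \<in> insert \<infinity> {t<..}" for s
  proof -
    have "ennreal u \<le> s"
    proof (cases "s = \<infinity>")
      case False
      with that have "t \<le> s" by (simp add: less_imp_le)
      with assms(2) show ?thesis by (rule order_trans)
    qed simp
    then have "Y u -` B \<inter> space M \<in> {Y u -` B \<inter> space M |u B. 0 \<le> u \<and> ennreal u \<le> s \<and> B \<in> sets borel}"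
      using assms B by (intro CollectI exI[of _ u] exI[of _ B]) simp
    then show ?thesis unfolding past_sets_def by (intro sigma_sets.Basic) blast
  qed
  then have "Y u -` B \<inter> space M \<in> sets (H t)" unfolding sets_H by (rule INT_I)
  moreover have "AE \<omega> in M. \<omega> \<in> Y u -` B \<inter> space M \<longleftrightarrow> \<omega> \<in> Zc y u -` B \<inter> space M"
    using Y_eq by eventually_elim (use assms in simp)
  ultimately show "Zc y u -` B \<inter> space (H t) \<in> sets (H t)"
    unfolding space_H by (rule H_AE_modification[OF _ Int_lower2])
qed simp

lemma past_AE_modification:
  assumes "A \<in> past u" "B \<subseteq> space M" "AE \<omega> in M. \<omega> \<in> A \<longleftrightarrow> \<omega> \<in> B"
  shows "B \<in> past u"
  by (rule sets_AE_modification[OF complete sigma_algebra_past null_sets_past past_subset assms])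

text \<open>What \<open>Y\<close> reveals up to time \<open>s\<close> is known to \<open>X\<close>
  by time \<open>Cc y s\<close>. For a generator at r \<le> s the clock at r is smaller still, so
  \<open>sticky_past\<close> applies. Complements are taken inside the event that the clock is below
  \<open>u\<close>, itself in the past of \<open>u\<close>.\<close>

lemma past_Y_before_clock:
  assumes A: "A \<in> past_sets M Y (ennreal s)" and s: "0 \<le> s" and u: "0 < u"
  shows "{\<omega>\<in>A. Cc y s \<omega> < u} \<in> past u"
proof -
  interpret past: sigma_algebra "space M" "past u" by (rule sigma_algebra_past)
  have C: "{\<omega>\<in>space M. Cc y s \<omega> < u} \<in> past u" by (rule clock_past_less[OF y s less_imp_le[OF u]])
  show ?thesis
    using A[unfolded past_sets_def]
  proof (induction rule: sigma_sets.induct)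
    case (Basic a)
    then have "(\<exists>r B. a = Y r -` B \<inter> space M \<and> 0 \<le> r \<and> ennreal r \<le> ennreal s \<and> B \<in> sets borel)
        \<or> a \<in> null_sets M" (is "?P \<or> ?Q")
      by (simp only: Un_iff mem_Collect_eq)
    then have "{\<omega>\<in>a. Cc y s \<omega> < u} \<in> past u"
    proof
      assume ?P
      then obtain r B where 1: "a = Y r -` B \<inter> space M" "0 \<le> r" "ennreal r \<le> ennreal s" "B \<in> sets borel"
        by blast
      have "r \<le> s" using 1(3) s by (simp add: ennreal_le_iff)
      have "{\<omega>\<in>space M. Zc y r \<omega> \<in> B \<and> Cc y r \<omega> \<le> u} \<inter> {\<omega>\<in>space M. Cc y s \<omega> < u} \<in> past u"
        using 1 u C by (intro past.Int sticky_past[OF y]) auto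
      then show ?thesis
      proof (rule past_AE_modification)
        show "{\<omega>\<in>a. Cc y s \<omega> < u} \<subseteq> space M" using 1(1) by auto
        show "AE \<omega> in M. \<omega> \<in> {\<omega>\<in>space M. Zc y r \<omega> \<in> B \<and> Cc y r \<omega> \<le> u} \<inter> {\<omega>\<in>space M. Cc y s \<omega> < u}
            \<longleftrightarrow> \<omega> \<in> {\<omega>\<in>a. Cc y s \<omega> < u}"
          using Y_eq AE_space[of M]
        proof eventually_elim
          case (elim \<omega>)
          have "Cc y r \<omega> \<le> Cc y s \<omega>"
            by (rule sticky_path.clock_mono[OF sticky_path[OF elim(2) y] 1(2) \<open>r \<le> s\<close>])
          moreover have "Y r \<omega> = Zc y r \<omega>" using elim(1) 1(2) by blast
          ultimately show ?case using elim(2) 1(1) by auto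
        qed
      qed
    next
      assume 2: ?Q
      have "a \<inter> {\<omega>\<in>space M. Cc y s \<omega> < u} \<in> null_sets M"
        using 2 C past_subset by (intro null_set_Int2) auto
      moreover have "a \<inter> {\<omega>\<in>space M. Cc y s \<omega> < u} = {\<omega>\<in>a. Cc y s \<omega> < u}"
        using sets.sets_into_space[OF null_setsD2[OF 2]] by blast
      ultimately have "{\<omega>\<in>a. Cc y s \<omega> < u} \<in> null_sets M" by (simp only:)
      then show ?thesis by (rule subsetD[OF null_sets_past])
    qed
    then show ?case .
  next
    case Empty
    have "{\<omega>\<in>{}. Cc y s \<omega> < u} = {}" by blast
    then show ?case by (simp only: past.empty_sets)
  next
    case (Compl a)
    have "{\<omega>\<in>a. Cc y s \<omega> < u} \<in> past u" by (rule Compl.IH)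
    with C have "{\<omega>\<in>space M. Cc y s \<omega> < u} - {\<omega>\<in>a. Cc y s \<omega> < u} \<in> past u" by (rule past.Diff)
    also have "{\<omega>\<in>space M. Cc y s \<omega> < u} - {\<omega>\<in>a. Cc y s \<omega> < u} = {\<omega>\<in>space M - a. Cc y s \<omega> < u}" by blast
    finally show ?case by (simp only:)
  next
    case (Union a)
    have "{\<omega>\<in>a i. Cc y s \<omega> < u} \<in> past u" for i by (rule Union.IH)
    then have "(\<Union>i. {\<omega>\<in>a i. Cc y s \<omega> < u}) \<in> past u" by (intro past.countable_UN image_subsetI)
    also have "(\<Union>i. {\<omega>\<in>a i. Cc y s \<omega> < u}) = {\<omega>\<in>\<Union>(range a). Cc y s \<omega> < u}" by blast
    finally show ?case by (simp only:)
  qed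
qed

context
  fixes T :: "'a \<Rightarrow> ennreal"
  assumes T: "stopping_time H T"
begin

abbreviation "ZT \<omega> \<equiv> Zc y (enn2real (T \<omega>)) \<omega>"
abbreviation "CT \<omega> \<equiv> Cc y (enn2real (T \<omega>)) \<omega>"

lemma pre_sigma_subset: "sets (H.pre_sigma T) \<subseteq> events"
proof
  fix A assume "A \<in> sets (H.pre_sigma T)"
  from H.sets_pre_sigmaD[OF T this, of \<infinity>] have "A \<in> sets (H \<infinity>)" by simp
  then show "A \<in> events" by (rule subsetD[OF H_events])
qed

lemma finite_in_pre_sigma: "{\<omega>\<in>space M. T \<omega> < \<infinity>} \<in> sets (H.pre_sigma T)"
proof -
  have "T \<in> borel_measurable (H.pre_sigma T)" by (rule H.measurable_stopping_time_pre_sigma[OF T])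
  then have "{\<omega>\<in>space (H.pre_sigma T). T \<omega> < \<infinity>} \<in> sets (H.pre_sigma T)" by measurable
  then show ?thesis by (simp add: H.space_pre_sigma)
qed

text \<open>The clock at a stopping time of \<open>Y\<close> is an optional time of
  \<open>X\<close>, also on events of the stopped past. If it is below \<open>u\<close>, rationals q
  < s fit between the stopping time and \<tau> at \<open>u\<close>. Two are needed: \<open>H\<close>
  at q is a right limit and is contained in the raw past only at times s > q.\<close>

lemma clock_at_optional:
  assumes A: "A \<in> sets (H.pre_sigma T)" and u: "0 < u"
  shows "{\<omega>\<in>{\<omega>\<in>A. T \<omega> < \<infinity>}. CT \<omega> < u} \<in> past u"
proof -
  interpret past: sigma_algebra "space M" "past u" by (rule sigma_algebra_past)
  have A_sub: "A \<subseteq> space M" using A pre_sigma_subset sets.space_closed by blast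
  define I where "I = {(q, s). q \<in> \<rat> \<and> s \<in> \<rat> \<and> 0 \<le> q \<and> q < (s::real)}"
  have "I \<subseteq> \<rat> \<times> \<rat>" by (auto simp: I_def)
  then have I: "countable I" by (rule countable_subset) (simp add: countable_rat)
  have "{\<omega>\<in>{\<omega>\<in>A. T \<omega> < \<infinity>}. CT \<omega> < u}
      = (\<Union>(q, s)\<in>I. {\<omega>\<in>{\<omega>\<in>A. T \<omega> \<le> ennreal q}. Cc y s \<omega> < u})" (is "?L = ?R")
  proof
    show "?L \<subseteq> ?R"
    proof
      fix \<omega> assume "\<omega> \<in> ?L"
      then have \<omega>: "\<omega> \<in> A" "T \<omega> < \<infinity>" "CT \<omega> < u" by auto
      interpret sticky_path "\<lambda>s. X s \<omega>" \<gamma> y using A_sub \<omega> y by (intro sticky_path) auto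
      define \<theta> where "\<theta> = enn2real (T \<omega>)"
      have \<theta>: "0 \<le> \<theta>" "T \<omega> = ennreal \<theta>" using \<omega>(2) by (simp_all add: \<theta>_def less_top)
      have "\<theta> < \<tau> u" using \<omega>(3) clock_less_iff[OF \<theta>(1), of u] u by (simp add: \<theta>_def)
      then obtain q where q: "q \<in> \<rat>" "\<theta> < q" "q < \<tau> u" using Rats_dense_in_real by blast
      then obtain s where s: "s \<in> \<rat>" "q < s" "s < \<tau> u" using Rats_dense_in_real by blast
      have "C s < u" using clock_less_iff[of s u] s q \<theta> u by simp
      moreover have "(q, s) \<in> I" using q s \<theta> by (simp add: I_def)
      moreover have "T \<omega> \<le> ennreal q" using \<theta>(2) q(2) by (simp add: ennreal_leI)
      ultimately show "\<omega> \<in> ?R" using \<omega>(1) by blast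
    qed
    show "?R \<subseteq> ?L"
    proof
      fix \<omega> assume "\<omega> \<in> ?R"
      then obtain q s where \<omega>: "\<omega> \<in> A" "T \<omega> \<le> ennreal q" "Cc y s \<omega> < u" "0 \<le> q" "q < s"
        by (auto simp: I_def)
      interpret sticky_path "\<lambda>s. X s \<omega>" \<gamma> y using A_sub \<omega> y by (intro sticky_path) auto
      have "enn2real (T \<omega>) \<le> q" using \<omega> by (intro enn2real_leI)
      then have "CT \<omega> \<le> C s" using \<omega>(5) by (intro clock_mono) auto
      moreover have "T \<omega> < \<infinity>" using le_less_trans[OF \<omega>(2) ennreal_less_top] by simp
      ultimately show "\<omega> \<in> ?L" using \<omega> by simp
    qed
  qed
  also have "\<dots> \<in> past u"
  proof (rule past.countable_UN'[OF I])
    show "(\<lambda>(q, s). {\<omega>\<in>{\<omega>\<in>A. T \<omega> \<le> ennreal q}. Cc y s \<omega> < u}) ` I \<subseteq> past u"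
    proof (rule image_subsetI)
      fix p assume "p \<in> I"
      then obtain q s where p: "p = (q, s)" "0 \<le> q" "q < s" by (auto simp: I_def)
      have "{\<omega>\<in>A. T \<omega> \<le> ennreal q} \<in> sets (H (ennreal q))" by (rule H.sets_pre_sigmaD[OF T A])
      also have "\<dots> \<subseteq> past_sets M Y (ennreal s)" using p by (intro H_subset_past) (simp add: ennreal_less_iff)
      finally have "{\<omega>\<in>{\<omega>\<in>A. T \<omega> \<le> ennreal q}. Cc y s \<omega> < u} \<in> past u"
        using p u by (intro past_Y_before_clock) auto
      then show "(case p of (q, s) \<Rightarrow> {\<omega>\<in>{\<omega>\<in>A. T \<omega> \<le> ennreal q}. Cc y s \<omega> < u}) \<in> past u"
        unfolding p(1) split_conv .
    qed
  qed
  finally show ?thesis .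
qed

text \<open>On T \<le> r the position is the right-continuous explicit version evaluated at a
  measurable time and stopped at \<open>r\<close>, so it is known at \<open>r\<close>. For the index
  infinity the finite cases are united, because T is finite on the event.\<close>

lemma ZT_in_pre_sigma:
  assumes B: "B \<in> sets borel"
  shows "{\<omega>\<in>space M. T \<omega> < \<infinity> \<and> ZT \<omega> \<in> B} \<in> sets (H.pre_sigma T)"
proof (rule H.sets_pre_sigmaI[OF T])
  have real_case: "{\<omega>\<in>space M. T \<omega> < \<infinity> \<and> ZT \<omega> \<in> B \<and> T \<omega> \<le> ennreal r} \<in> sets (H (ennreal r))" if r: "0 \<le> r" for r
  proof -
    have T_le: "{\<omega>\<in>space M. T \<omega> \<le> ennreal b} \<in> sets (H (ennreal r))" if "b \<le> r" for b
      using H.stopping_time_le_const[OF T, of "ennreal b" "ennreal r"] that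
      by (simp add: pred_def space_H ennreal_leI)
    define \<rho> where "\<rho> \<omega> = (if T \<omega> \<le> ennreal r then enn2real (T \<omega>) else r)" for \<omega>
    have \<rho>0: "0 \<le> \<rho> \<omega>" for \<omega> using r by (simp add: \<rho>_def)
    have \<rho>_le: "\<rho> \<omega> \<le> r" for \<omega> using r by (simp add: \<rho>_def enn2real_leI)
    have \<rho>: "\<rho> \<in> borel_measurable (H (ennreal r))"
    proof (rule borel_measurableI_le)
      fix b
      consider "b < 0" | "0 \<le> b" "b < r" | "r \<le> b" by linarith
      then show "{\<omega>\<in>space (H (ennreal r)). \<rho> \<omega> \<le> b} \<in> sets (H (ennreal r))"
      proof cases
        case 1
        then have "\<not> \<rho> \<omega> \<le> b" for \<omega> using \<rho>0[of \<omega>] by simp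
        then have "{\<omega>\<in>space (H (ennreal r)). \<rho> \<omega> \<le> b} = {}" by blast
        then show ?thesis by (metis sets.empty_sets)
      next
        case 2
        have "\<rho> \<omega> \<le> b \<longleftrightarrow> T \<omega> \<le> ennreal b" for \<omega>
        proof
          assume *: "\<rho> \<omega> \<le> b"
          then have "T \<omega> \<le> ennreal r" using 2 by (auto simp: \<rho>_def split: if_splits)
          then have "ennreal (enn2real (T \<omega>)) = T \<omega>"
            using le_less_trans[OF _ ennreal_less_top] by (intro ennreal_enn2real) blast
          moreover have "enn2real (T \<omega>) \<le> b" using * \<open>T \<omega> \<le> ennreal r\<close> by (simp add: \<rho>_def)
          ultimately show "T \<omega> \<le> ennreal b" by (metis ennreal_leI)
        next
          assume *: "T \<omega> \<le> ennreal b"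
          also have "ennreal b \<le> ennreal r" using 2 by (simp add: ennreal_leI)
          finally have "T \<omega> \<le> ennreal r" .
          then show "\<rho> \<omega> \<le> b" using * 2 by (simp add: \<rho>_def enn2real_leI)
        qed
        then show ?thesis using T_le[of b] 2 by (simp add: space_H)
      next
        case 3
        then have "\<rho> \<omega> \<le> b" for \<omega> using \<rho>_le[of \<omega>] by simp
        then have "{\<omega>\<in>space (H (ennreal r)). \<rho> \<omega> \<le> b} = space (H (ennreal r))" by blast
        then show ?thesis by (metis sets.top)
      qed
    qed
    have W: "(\<lambda>\<omega>. Zc y (min (\<rho> \<omega>) r) \<omega>) \<in> borel_measurable (H (ennreal r))"
    proof (rule measurable_right_continuous_at[where Y = "\<lambda>s. Zc y (min s r)"])
      show "continuous (at_right s) (\<lambda>s. Zc y (min s r) \<omega>)" if "\<omega> \<in> space (H (ennreal r))" "0 \<le> s" for s \<omega>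
        using sticky_path.sticky_right_continuous[OF sticky_path[OF _ y]] that
        by (intro right_continuous_stopped) (simp add: space_H)
      show "Zc y (min s r) \<in> borel_measurable (H (ennreal r))" if "0 \<le> s" for s
        using that r by (intro Zc_H_measurable ennreal_leI) auto
    qed (use \<rho> \<rho>0 in auto)
    have "{\<omega>\<in>space M. T \<omega> < \<infinity> \<and> ZT \<omega> \<in> B \<and> T \<omega> \<le> ennreal r}
        = ((\<lambda>\<omega>. Zc y (min (\<rho> \<omega>) r) \<omega>) -` B \<inter> space (H (ennreal r))) \<inter> {\<omega>\<in>space M. T \<omega> \<le> ennreal r}"
    proof (intro set_eqI)
      fix \<omega>
      have "T \<omega> < \<infinity>" if "T \<omega> \<le> ennreal r" using le_less_trans[OF that ennreal_less_top] by simp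
      moreover have "min (\<rho> \<omega>) r = enn2real (T \<omega>)" if "T \<omega> \<le> ennreal r"
        using \<rho>_le[of \<omega>] that by (simp add: \<rho>_def)
      ultimately show "\<omega> \<in> {\<omega>\<in>space M. T \<omega> < \<infinity> \<and> ZT \<omega> \<in> B \<and> T \<omega> \<le> ennreal r} \<longleftrightarrow>
          \<omega> \<in> ((\<lambda>\<omega>. Zc y (min (\<rho> \<omega>) r) \<omega>) -` B \<inter> space (H (ennreal r))) \<inter> {\<omega>\<in>space M. T \<omega> \<le> ennreal r}"
        by (cases "T \<omega> \<le> ennreal r") (simp_all add: space_H conj_commute)
    qed
    also have "\<dots> \<in> sets (H (ennreal r))" by (rule sets.Int[OF measurable_sets[OF W B] T_le[OF order_refl]])
    finally show ?thesis .
  qed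
  fix t :: ennreal
  show "{\<omega>\<in>{\<omega>\<in>space M. T \<omega> < \<infinity> \<and> ZT \<omega> \<in> B}. T \<omega> \<le> t} \<in> sets (H t)"
  proof (cases t)
    case (real r)
    have "{\<omega>\<in>{\<omega>\<in>space M. T \<omega> < \<infinity> \<and> ZT \<omega> \<in> B}. T \<omega> \<le> t}
        = {\<omega>\<in>space M. T \<omega> < \<infinity> \<and> ZT \<omega> \<in> B \<and> T \<omega> \<le> ennreal r}"
      unfolding real(2) by blast
    then show ?thesis using real_case[OF real(1)] real(2) by (simp only:)
  next
    case top
    have "{\<omega>\<in>{\<omega>\<in>space M. T \<omega> < \<infinity> \<and> ZT \<omega> \<in> B}. T \<omega> \<le> t}
        = (\<Union>n::nat. {\<omega>\<in>space M. T \<omega> < \<infinity> \<and> ZT \<omega> \<in> B \<and> T \<omega> \<le> ennreal (real n)})"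
    proof -
      have "\<exists>n::nat. T \<omega> \<le> ennreal (real n)" if fin: "T \<omega> < \<infinity>" for \<omega>
      proof -
        obtain n :: nat where "enn2real (T \<omega>) \<le> real n" using real_arch_simple by blast
        then have "ennreal (enn2real (T \<omega>)) \<le> ennreal (real n)" by (rule ennreal_leI)
        then show ?thesis
          using fin ennreal_enn2real[of "T \<omega>"] by (intro exI[of _ n]) (simp only: infinity_ennreal_def)
      qed
      then show ?thesis using top by auto
    qed
    also have "\<dots> \<in> sets (H t)"
    proof (rule sets.countable_UN, rule image_subsetI)
      fix n :: nat
      have "sets (H (ennreal (real n))) \<subseteq> sets (H t)" using top by (intro H_mono) simp
      with real_case[of "real n"]
      show "{\<omega>\<in>space M. T \<omega> < \<infinity> \<and> ZT \<omega> \<in> B \<and> T \<omega> \<le> ennreal (real n)} \<in> sets (H t)"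
        by (simp add: subset_iff)
    qed
    finally show ?thesis .
  qed
qed

end

end

section \<open>Integrating out an independent future, and the transition kernel\<close>

context levy_paths
begin

text \<open>The product formula on rectangles says that, restricted to \<open>A\<close>, the pair
  (V, W) has a product law with second factor the path law. Uniqueness of product measures extends
  it to all sets \<open>E\<close>, and Fubini integrates out \<open>W\<close> with \<open>V\<close>
  frozen.\<close>

lemma prob_freeze:
  assumes A: "A \<in> events" and V: "V \<in> borel_measurable M" and W: "W \<in> M \<rightarrow>\<^sub>M path_space"
    and rect: "\<And>B D. B \<in> sets borel \<Longrightarrow> D \<in> sets path_space \<Longrightarrow>
      prob (A \<inter> {\<omega>\<in>space M. V \<omega> \<in> B \<and> W \<omega> \<in> D})
        = prob (A \<inter> {\<omega>\<in>space M. V \<omega> \<in> B}) * measure path_law D"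
    and E: "E \<in> sets (borel \<Otimes>\<^sub>M path_space)"
  shows "prob (A \<inter> {\<omega>\<in>space M. (V \<omega>, W \<omega>) \<in> E})
    = (\<integral>\<omega>. indicat_real A \<omega> * measure path_law (Pair (V \<omega> :: real) -` E) \<partial>M)"
proof -
  interpret path: prob_space path_law by (rule prob_space_path_law)
  define \<nu> where "\<nu> = density M (indicator A)"
  define N where "N = distr \<nu> borel V"
  define P where "P = distr \<nu> (borel \<Otimes>\<^sub>M path_space) (\<lambda>\<omega>. (V \<omega>, W \<omega>))"
  have VW: "(\<lambda>\<omega>. (V \<omega>, W \<omega>)) \<in> M \<rightarrow>\<^sub>M borel \<Otimes>\<^sub>M path_space" using V W by (rule measurable_Pair)
  have VW': "(\<lambda>\<omega>. (V \<omega>, W \<omega>)) \<in> \<nu> \<rightarrow>\<^sub>M borel \<Otimes>\<^sub>M path_space"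
    and V': "V \<in> \<nu> \<rightarrow>\<^sub>M borel" using VW V by (simp_all add: \<nu>_def)
  have \<nu>: "emeasure \<nu> B = emeasure M (A \<inter> B)" if "B \<in> events" for B
    using A that unfolding \<nu>_def by (subst emeasure_density) (auto simp: indicator_inter_arith[symmetric])
  have space_\<nu>: "space \<nu> = space M" by (simp add: \<nu>_def)
  have N: "emeasure N B = ennreal (prob (A \<inter> {\<omega>\<in>space M. V \<omega> \<in> B}))" if B: "B \<in> sets borel" for B
  proof -
    have "V -` B \<inter> space M = {\<omega>\<in>space M. V \<omega> \<in> B}" by blast
    then show ?thesis
      using measurable_sets[OF V B] unfolding N_def emeasure_distr[OF V' B] space_\<nu>
      by (simp add: \<nu> emeasure_eq_measure)
  qed
  have P: "emeasure P B = ennreal (prob (A \<inter> {\<omega>\<in>space M. (V \<omega>, W \<omega>) \<in> B}))"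
    if B: "B \<in> sets (borel \<Otimes>\<^sub>M path_space)" for B
  proof -
    have "(\<lambda>\<omega>. (V \<omega>, W \<omega>)) -` B \<inter> space M = {\<omega>\<in>space M. (V \<omega>, W \<omega>) \<in> B}" by blast
    then show ?thesis
      using measurable_sets[OF VW B] unfolding P_def emeasure_distr[OF VW' B] space_\<nu>
      by (simp add: \<nu> emeasure_eq_measure)
  qed
  have fin: "finite_measure N"
  proof (rule finite_measureI)
    show "emeasure N (space N) \<noteq> \<infinity>" using N[of UNIV] by (simp add: N_def)
  qed
  have sets_path: "sets (borel \<Otimes>\<^sub>M path_law) = sets ((borel :: real measure) \<Otimes>\<^sub>M path_space)"
    by (rule sets_pair_measure_cong) simp_all
  have sets_N: "sets N = sets borel" by (simp add: N_def)
  have sec: "(\<lambda>v. emeasure path_law (Pair v -` E)) \<in> borel_measurable borel"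
    by (rule path.measurable_emeasure_Pair) (use E sets_path in simp)
  have "N \<Otimes>\<^sub>M path_law = P"
  proof (rule pair_measure_eqI)
    show "sigma_finite_measure N" using fin by (rule finite_measure.axioms(1))
    show "sigma_finite_measure path_law" by unfold_locales
    show "sets (N \<Otimes>\<^sub>M path_law) = sets P"
      using sets_pair_measure_cong[OF sets_N refl, of path_law] sets_path by (simp add: P_def)
    fix B D assume "B \<in> sets N" "D \<in> sets path_law"
    then have B: "B \<in> sets borel" and D: "D \<in> sets path_space" by (simp_all add: N_def)
    have "emeasure N B * emeasure path_law D
        = ennreal (prob (A \<inter> {\<omega>\<in>space M. V \<omega> \<in> B}) * measure path_law D)"
      by (simp add: N[OF B] path.emeasure_eq_measure ennreal_mult)
    also have "\<dots> = emeasure P (B \<times> D)"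
      unfolding rect[OF B D, symmetric] using B D by (subst P) auto
    finally show "emeasure N B * emeasure path_law D = emeasure P (B \<times> D)" .
  qed
  then have "emeasure P E = emeasure (N \<Otimes>\<^sub>M path_law) E" by simp
  also have "\<dots> = (\<integral>\<^sup>+v. emeasure path_law (Pair v -` E) \<partial>N)"
  proof (rule path.emeasure_pair_measure_alt)
    show "E \<in> sets (N \<Otimes>\<^sub>M path_law)"
      using E sets_pair_measure_cong[OF sets_N refl, of path_law] sets_path by simp
  qed
  also have "\<dots> = (\<integral>\<^sup>+\<omega>. emeasure path_law (Pair (V \<omega>) -` E) \<partial>\<nu>)"
    unfolding N_def by (rule nn_integral_distr[OF V']) (simp add: sec)
  also have "\<dots> = (\<integral>\<^sup>+\<omega>. indicator A \<omega> * emeasure path_law (Pair (V \<omega>) -` E) \<partial>M)"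
    unfolding \<nu>_def by (rule nn_integral_density) (use A measurable_compose[OF V sec] in simp_all)
  also have "\<dots> = (\<integral>\<^sup>+\<omega>. ennreal (indicat_real A \<omega> * measure path_law (Pair (V \<omega>) -` E)) \<partial>M)"
    by (rule nn_integral_cong) (simp add: path.emeasure_eq_measure indicator_def)
  finally have eq: "ennreal (prob (A \<inter> {\<omega>\<in>space M. (V \<omega>, W \<omega>) \<in> E}))
      = (\<integral>\<^sup>+\<omega>. ennreal (indicat_real A \<omega> * measure path_law (Pair (V \<omega>) -` E)) \<partial>M)"
    by (simp only: P[OF E])
  have meas: "(\<lambda>\<omega>. indicat_real A \<omega> * measure path_law (Pair (V \<omega>) -` E)) \<in> borel_measurable M"
  proof -
    have "(\<lambda>v. measure path_law (Pair v -` E)) \<in> borel_measurable borel"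
      unfolding measure_def using sec by (rule borel_measurable_enn2real)
    from measurable_compose[OF V this] show ?thesis using A by simp
  qed
  have "(\<integral>\<omega>. indicat_real A \<omega> * measure path_law (Pair (V \<omega>) -` E) \<partial>M)
      = enn2real (\<integral>\<^sup>+\<omega>. ennreal (indicat_real A \<omega> * measure path_law (Pair (V \<omega>) -` E)) \<partial>M)"
    by (rule integral_eq_nn_integral[OF meas]) simp
  also have "\<dots> = prob (A \<inter> {\<omega>\<in>space M. (V \<omega>, W \<omega>) \<in> E})" unfolding eq[symmetric] by simp
  finally show ?thesis by simp
qed

end

context sticky_levy
begin

text \<open>The law of the solution started at \<open>v\<close>, transported to path space. Taken
  for every real \<open>v\<close>, it is Borel measurable on the whole line;
  \<open>measure_law_Y\<close> identifies it for v \<ge> 0.\<close>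

definition kernel :: "real \<Rightarrow> (real \<Rightarrow> real) set \<Rightarrow> real" where
  "kernel v D = measure path_law {x\<in>space path_space. (\<lambda>t\<in>{0..}. sticky \<gamma> v x t) \<in> D}"

lemma sticky_path_measurable:
  "(\<lambda>p. \<lambda>t\<in>{0..}. sticky \<gamma> (fst p) (snd p) t) \<in> borel \<Otimes>\<^sub>M path_space \<rightarrow>\<^sub>M path_space"
  by (intro measurable_path_spaceI borel_measurable_sticky) simp_all

lemma sticky_kernel_sets:
  assumes "D \<in> sets path_space"
  shows "{p\<in>space (borel \<Otimes>\<^sub>M path_space). (\<lambda>t\<in>{0..}. sticky \<gamma> (fst p) (snd p) t) \<in> D}
    \<in> sets (borel \<Otimes>\<^sub>M path_space)" (is "?E \<in> _")
    and "kernel v D = measure path_law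
      (Pair v -` {p\<in>space (borel \<Otimes>\<^sub>M path_space). (\<lambda>t\<in>{0..}. sticky \<gamma> (fst p) (snd p) t) \<in> D})"
proof -
  have "?E = (\<lambda>p. \<lambda>t\<in>{0..}. sticky \<gamma> (fst p) (snd p) t) -` D \<inter> space (borel \<Otimes>\<^sub>M path_space)"
    by blast
  then show "?E \<in> sets (borel \<Otimes>\<^sub>M path_space)"
    using measurable_sets[OF sticky_path_measurable assms] by (simp only:)
  have "Pair v -` ?E = {x\<in>space path_space. (\<lambda>t\<in>{0..}. sticky \<gamma> v x t) \<in> D}"
    by (simp add: space_pair_measure set_eq_iff)
  then show "kernel v D = measure path_law (Pair v -` ?E)" by (simp only: kernel_def)
qed

lemma kernel_measurable:
  assumes D: "D \<in> sets path_space"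
  shows "(\<lambda>v. kernel v D) \<in> borel_measurable borel"
proof -
  interpret path: prob_space path_law by (rule prob_space_path_law)
  have "sets (borel \<Otimes>\<^sub>M path_law) = sets ((borel :: real measure) \<Otimes>\<^sub>M path_space)"
    by (rule sets_pair_measure_cong) simp_all
  then have "(\<lambda>v. emeasure path_law (Pair v -` {p\<in>space (borel \<Otimes>\<^sub>M path_space).
      (\<lambda>t\<in>{0..}. sticky \<gamma> (fst p) (snd p) t) \<in> D})) \<in> borel_measurable (borel :: real measure)"
    using sticky_kernel_sets(1)[OF D] by (intro path.measurable_emeasure_Pair) (simp only:)
  then show ?thesis
    unfolding sticky_kernel_sets(2)[OF D] measure_def by (rule borel_measurable_enn2real)
qed

lemma kernel_bounds: "0 \<le> kernel v D" "kernel v D \<le> 1"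
proof -
  interpret path: prob_space path_law by (rule prob_space_path_law)
  show "0 \<le> kernel v D" "kernel v D \<le> 1" by (simp_all add: kernel_def)
qed

end

context sticky_process
begin

lemma measure_law_Y:
  assumes D: "D \<in> sets path_space"
  shows "measure (law M Y) D = kernel y D"
proof -
  have Ym: "(\<lambda>\<omega>. \<lambda>t\<in>{0..}. Y t \<omega>) \<in> M \<rightarrow>\<^sub>M path_space"
    by (rule measurable_path_spaceI) (rule Y_measurable)
  have Zm: "(\<lambda>\<omega>. \<lambda>t\<in>{0..}. Zc y t \<omega>) \<in> M \<rightarrow>\<^sub>M path_space"
    by (rule measurable_path_spaceI) (rule sticky_measurable[OF y])
  have sec: "{x\<in>space path_space. (\<lambda>t\<in>{0..}. sticky \<gamma> y x t) \<in> D} \<in> sets path_space"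
  proof -
    have "(\<lambda>x. \<lambda>t\<in>{0..}. sticky \<gamma> y x t) \<in> path_space \<rightarrow>\<^sub>M path_space"
      by (intro measurable_path_spaceI borel_measurable_sticky) simp_all
    from measurable_sets[OF this D] show ?thesis by (simp add: vimage_def Int_def conj_commute)
  qed
  have "measure (law M Y) D = prob ((\<lambda>\<omega>. \<lambda>t\<in>{0..}. Y t \<omega>) -` D \<inter> space M)"
    unfolding law_def by (rule measure_distr[OF Ym D])
  also have "\<dots> = prob ((\<lambda>\<omega>. \<lambda>t\<in>{0..}. Zc y t \<omega>) -` D \<inter> space M)"
  proof (rule finite_measure_eq_AE)
    show "AE \<omega> in M. \<omega> \<in> (\<lambda>\<omega>. \<lambda>t\<in>{0..}. Y t \<omega>) -` D \<inter> space M
        \<longleftrightarrow> \<omega> \<in> (\<lambda>\<omega>. \<lambda>t\<in>{0..}. Zc y t \<omega>) -` D \<inter> space M"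
      using Y_eq
    proof eventually_elim
      case (elim \<omega>)
      then have "(\<lambda>t\<in>{0..}. Y t \<omega>) = (\<lambda>t\<in>{0..}. Zc y t \<omega>)" by (intro restrict_ext) simp
      then show ?case by simp
    qed
  qed (rule measurable_sets[OF Ym D], rule measurable_sets[OF Zm D])
  also have "(\<lambda>\<omega>. \<lambda>t\<in>{0..}. Zc y t \<omega>) -` D \<inter> space M
      = {\<omega>\<in>space M. (\<lambda>t\<in>{0..}. X t \<omega>) \<in> {x\<in>space path_space. (\<lambda>t\<in>{0..}. sticky \<gamma> y x t) \<in> D}}"
  proof -
    have "(\<lambda>t\<in>{0..}. sticky \<gamma> y (\<lambda>t\<in>{0..}. X t \<omega>) t) = (\<lambda>t\<in>{0..}. Zc y t \<omega>)" for \<omega>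
      by (rule restrict_ext) (rule sticky_restrict)
    then show ?thesis using measurable_space[OF path_measurable] by auto
  qed
  also have "prob \<dots> = kernel y D"
    unfolding kernel_def by (rule measure_path_law[OF sec, symmetric])
  finally show ?thesis .
qed

interpretation H: filtration "space M" H by (rule filtration_H)

text \<open>By the flow property the future of \<open>Y\<close> is a measurable function of the
  position at \<open>T\<close> and of the increments of \<open>X\<close> after the clock at
  \<open>T\<close>. These increments are a fresh copy of \<open>X\<close>, independent of the
  stopped past, so \<open>prob_freeze\<close> replaces them by an integral over the path
  law.\<close>

lemma strong_markov_sticky:
  assumes T: "stopping_time H T" and D: "D \<in> sets path_space"
  shows "AE \<omega> in M. T \<omega> < \<infinity> \<longrightarrow>
    real_cond_exp M (H.pre_sigma T)
      (indicator {\<omega>\<in>space M. T \<omega> < \<infinity> \<and> (\<lambda>t\<in>{0..}. Y (enn2real (T \<omega>) + t) \<omega>) \<in> D}) \<omega>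
    = kernel (Y (enn2real (T \<omega>)) \<omega>) D"
proof -
  let ?F = "H.pre_sigma T"
  let ?\<theta> = "\<lambda>\<omega>. enn2real (T \<omega>)"
  define ZT where "ZT \<omega> = Zc y (enn2real (T \<omega>)) \<omega>" for \<omega>
  define CT where "CT \<omega> = Cc y (enn2real (T \<omega>)) \<omega>" for \<omega>
  define A0 where "A0 = {\<omega>\<in>space M. T \<omega> < \<infinity>}"
  have sub: "subalgebra M ?F"
    using pre_sigma_subset[OF T] by (simp add: subalgebra_def H.space_pre_sigma)
  interpret S: finite_measure_subalgebra M ?F by unfold_locales (rule sub)
  have A0: "A0 \<in> sets ?F" unfolding A0_def by (rule finite_in_pre_sigma[OF T])
  have A0_ev: "A0 \<in> events" using A0 pre_sigma_subset[OF T] by blast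
  have T_meas: "T \<in> borel_measurable M"
    by (rule measurable_stopping_time[OF T]) (rule H_events, rule space_H)
  then have \<theta>: "?\<theta> \<in> borel_measurable M" by simp
  have ZT: "ZT \<in> borel_measurable M"
    using borel_measurable_sticky[OF path_measurable \<theta>, of "\<lambda>_. y" \<gamma>]
    by (simp add: sticky_restrict ZT_def[abs_def])
  have CT: "CT \<in> borel_measurable M"
    using borel_measurable_clock[OF path_measurable \<theta>, of "\<lambda>_. y" \<gamma>]
    by (simp add: clock_restrict CT_def[abs_def])
  have Sh: "(\<lambda>\<omega>. shift (CT \<omega>) \<omega>) \<in> M \<rightarrow>\<^sub>M path_space"
    by (rule shift_measurable[OF CT]) (simp add: CT_def clock_nonneg)
  have flow: "Zc y (?\<theta> \<omega> + t) \<omega> = sticky \<gamma> (ZT \<omega>) (shift (CT \<omega>) \<omega>) t"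
    if "\<omega> \<in> space M" "0 \<le> t" for \<omega> t
    unfolding shift_def sticky_restrict ZT_def CT_def
    by (rule sticky_flow[OF good[OF that(1)] \<gamma> y _ that(2)]) simp
  let ?E = "{p\<in>space (borel \<Otimes>\<^sub>M path_space). (\<lambda>t\<in>{0..}. sticky \<gamma> (fst p) (snd p) t) \<in> D}"
  define Fc where "Fc = {\<omega>\<in>space M. T \<omega> < \<infinity> \<and> (\<lambda>t\<in>{0..}. Zc y (?\<theta> \<omega> + t) \<omega>) \<in> D}"
  define FY where "FY = {\<omega>\<in>space M. T \<omega> < \<infinity> \<and> (\<lambda>t\<in>{0..}. Y (?\<theta> \<omega> + t) \<omega>) \<in> D}"
  have Fc_eq: "Fc = A0 \<inter> {\<omega>\<in>space M. (ZT \<omega>, shift (CT \<omega>) \<omega>) \<in> ?E}"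
  proof (intro set_eqI)
    fix \<omega>
    have "(\<lambda>t\<in>{0..}. Zc y (?\<theta> \<omega> + t) \<omega>) = (\<lambda>t\<in>{0..}. sticky \<gamma> (ZT \<omega>) (shift (CT \<omega>) \<omega>) t)"
      if "\<omega> \<in> space M"
      using flow[OF that] by (intro restrict_ext) simp
    then show "\<omega> \<in> Fc \<longleftrightarrow> \<omega> \<in> A0 \<inter> {\<omega>\<in>space M. (ZT \<omega>, shift (CT \<omega>) \<omega>) \<in> ?E}"
      using measurable_space[OF Sh, of \<omega>]
      by (cases "\<omega> \<in> space M") (simp_all add: Fc_def A0_def space_pair_measure)
  qed
  have E: "?E \<in> sets (borel \<Otimes>\<^sub>M path_space)" by (rule sticky_kernel_sets(1)[OF D])
  have Fc: "Fc \<in> events"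
  proof -
    have "(\<lambda>\<omega>. (ZT \<omega>, shift (CT \<omega>) \<omega>)) -` ?E \<inter> space M \<in> events"
      by (rule measurable_sets[OF measurable_Pair[OF ZT Sh] E])
    moreover have "(\<lambda>\<omega>. (ZT \<omega>, shift (CT \<omega>) \<omega>)) -` ?E \<inter> space M
        = {\<omega>\<in>space M. (ZT \<omega>, shift (CT \<omega>) \<omega>) \<in> ?E}" by blast
    ultimately show ?thesis unfolding Fc_eq using A0_ev by (simp only: sets.Int)
  qed
  have F_AE: "AE \<omega> in M. \<omega> \<in> Fc \<longleftrightarrow> \<omega> \<in> FY"
    using Y_eq
  proof eventually_elim
    case (elim \<omega>)
    have "(\<lambda>t\<in>{0..}. Y (?\<theta> \<omega> + t) \<omega>) = (\<lambda>t\<in>{0..}. Zc y (?\<theta> \<omega> + t) \<omega>)"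
      using elim by (intro restrict_ext) simp
    then show ?case by (simp add: Fc_def FY_def)
  qed
  have FY: "FY \<in> events"
    by (rule complete_measure.in_sets_AE[OF complete F_AE Fc]) (simp add: FY_def Collect_subset)
  define g where "g \<omega> = indicat_real A0 \<omega> * kernel (ZT \<omega>) D" for \<omega>
  have g_F: "g \<in> borel_measurable ?F"
  proof -
    \<comment> \<open>Measurability of the position with respect to the stopped past is known on T <
      \<infinity> only. The default 0 elsewhere is cancelled by the indicator of \<open>A0\<close>
      in \<open>g\<close>.\<close>
    define V where "V \<omega> = (if \<omega> \<in> A0 then ZT \<omega> else 0)" for \<omega>
    have "V \<in> borel_measurable ?F"
    proof (rule measurableI)
      fix B :: "real set" assume B: "B \<in> sets borel"
      have "{\<omega>\<in>space M. T \<omega> < \<infinity> \<and> ZT \<omega> \<in> B} \<union> (if 0 \<in> B then space ?F - A0 else {}) \<in> sets ?F"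
        using ZT_in_pre_sigma[OF T B] A0 by (simp add: ZT_def)
      also have "{\<omega>\<in>space M. T \<omega> < \<infinity> \<and> ZT \<omega> \<in> B} \<union> (if 0 \<in> B then space ?F - A0 else {})
          = V -` B \<inter> space ?F"
        unfolding H.space_pre_sigma V_def A0_def by (cases "0 \<in> B") (auto split: if_splits)
      finally show "V -` B \<inter> space ?F \<in> sets ?F" .
    qed simp
    from measurable_compose[OF this kernel_measurable[OF D]]
    have "(\<lambda>\<omega>. indicat_real A0 \<omega> * kernel (V \<omega>) D) \<in> borel_measurable ?F"
      using A0 by simp
    also have "(\<lambda>\<omega>. indicat_real A0 \<omega> * kernel (V \<omega>) D) = g"
      by (intro ext) (simp add: g_def V_def indicator_def)
    finally show ?thesis .
  qed
  have g_M: "g \<in> borel_measurable M" by (rule measurable_from_subalg[OF sub g_F])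
  have key: "(\<integral>\<omega>\<in>A. indicator FY \<omega> \<partial>M) = (\<integral>\<omega>\<in>A. g \<omega> \<partial>M)" if A: "A \<in> sets ?F" for A
  proof -
    have A_ev: "A \<in> events" using A pre_sigma_subset[OF T] by blast
    let ?A = "A \<inter> A0"
    have rect: "prob (?A \<inter> {\<omega>\<in>space M. ZT \<omega> \<in> B \<and> shift (CT \<omega>) \<omega> \<in> D'})
        = prob (?A \<inter> {\<omega>\<in>space M. ZT \<omega> \<in> B}) * measure path_law D'"
      if B: "B \<in> sets borel" and D': "D' \<in> sets path_space" for B D'
    proof -
      \<comment> \<open>The condition on the position is absorbed into the event: as it belongs to
        the stopped past, the strong Markov property of \<open>X\<close> on this smaller event
        already yields the factorisation over rectangles.\<close>
      let ?A2 = "A \<inter> {\<omega>\<in>space M. T \<omega> < \<infinity> \<and> ZT \<omega> \<in> B}"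
      have A2: "?A2 \<in> sets ?F"
        using A ZT_in_pre_sigma[OF T B] unfolding ZT_def by (rule sets.Int)
      let ?A3 = "{\<omega>\<in>?A2. T \<omega> < \<infinity>}"
      have "prob (?A3 \<inter> {\<omega>\<in>space M. shift (CT \<omega>) \<omega> \<in> D'}) = prob ?A3 * measure path_law D'"
      proof (rule strong_markov(2)[OF _ _ _ D'])
        show "?A3 \<subseteq> space M" by blast
        show "0 \<le> CT \<omega>" for \<omega> by (simp add: CT_def clock_nonneg)
        show "{\<omega>\<in>?A3. CT \<omega> < u} \<in> past u" if "0 < u" for u
          using clock_at_optional[OF T A2 that] by (simp only: CT_def)
      qed
      moreover have "?A3 = ?A \<inter> {\<omega>\<in>space M. ZT \<omega> \<in> B}" by (auto simp: A0_def)
      moreover have "?A \<inter> {\<omega>\<in>space M. ZT \<omega> \<in> B} \<inter> {\<omega>\<in>space M. shift (CT \<omega>) \<omega> \<in> D'}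
          = ?A \<inter> {\<omega>\<in>space M. ZT \<omega> \<in> B \<and> shift (CT \<omega>) \<omega> \<in> D'}" by blast
      ultimately show ?thesis by (simp only:)
    qed
    have "(\<integral>\<omega>\<in>A. indicator FY \<omega> \<partial>M) = (\<integral>\<omega>. indicat_real (A \<inter> FY) \<omega> \<partial>M)"
      unfolding set_lebesgue_integral_def by (simp add: indicator_inter_arith)
    also have "\<dots> = prob (A \<inter> FY)" using A_ev FY by simp
    also have "\<dots> = prob (A \<inter> Fc)"
    proof (rule finite_measure_eq_AE)
      show "AE \<omega> in M. \<omega> \<in> A \<inter> FY \<longleftrightarrow> \<omega> \<in> A \<inter> Fc" using F_AE by eventually_elim simp
    qed (use A_ev FY Fc in auto)
    also have "A \<inter> Fc = ?A \<inter> {\<omega>\<in>space M. (ZT \<omega>, shift (CT \<omega>) \<omega>) \<in> ?E}"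
      unfolding Fc_eq by blast
    also have "prob \<dots> = (\<integral>\<omega>. indicat_real ?A \<omega> * measure path_law (Pair (ZT \<omega>) -` ?E) \<partial>M)"
      by (rule prob_freeze[OF sets.Int[OF A_ev A0_ev] ZT Sh rect E])
    also have "\<dots> = (\<integral>\<omega>\<in>A. g \<omega> \<partial>M)"
      unfolding set_lebesgue_integral_def g_def sticky_kernel_sets(2)[OF D]
      by (simp add: indicator_inter_arith mult.assoc)
    finally show ?thesis .
  qed
  have "AE \<omega> in M. real_cond_exp M ?F (indicator FY) \<omega> = g \<omega>"
  proof (rule S.real_cond_exp_charact[OF key _ _ g_F])
    show "integrable M (indicator FY :: 'a \<Rightarrow> real)" using FY by (simp add: less_top[symmetric])
    show "integrable M g"
    proof (rule integrable_const_bound[OF _ g_M])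
      show "AE \<omega> in M. norm (g \<omega>) \<le> 1"
        using kernel_bounds[of _ D] by (intro AE_I2) (simp add: g_def indicator_def)
    qed
  qed
  then show ?thesis
    using Y_eq AE_space[of M]
  proof eventually_elim
    case (elim \<omega>)
    have "ZT \<omega> = Y (?\<theta> \<omega>) \<omega>" using elim(2) by (simp add: ZT_def)
    then show ?case using elim(1,3) by (simp add: g_def A0_def FY_def)
  qed
qed

end

section \<open>Changes on null sets, and killing of right-continuous paths\<close>

lemma cadlag_cong:
  assumes "\<And>t. 0 \<le> t \<Longrightarrow> f t = g t"
  shows "cadlag f \<longleftrightarrow> cadlag g"
proof -
  have "cadlag g" if cf: "cadlag f" and eq: "\<And>t. 0 \<le> t \<Longrightarrow> f t = g t" for f g
    unfolding cadlag_def
  proof (intro conjI allI impI)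
    fix t :: real assume t: "0 \<le> t"
    have "(f \<longlongrightarrow> f t) (at_right t)"
      using cf t by (simp add: cadlag_def continuous_within)
    moreover have "\<forall>\<^sub>F s in at_right t. f s = g s"
      using eventually_at_right_less[of t] by eventually_elim (use t eq in simp)
    ultimately have "(g \<longlongrightarrow> f t) (at_right t)" by (rule Lim_transform_eventually)
    then show "continuous (at_right t) g" using eq[OF t] by (simp add: continuous_within)
  next
    fix t :: real assume t: "0 < t"
    then obtain l where "(f \<longlongrightarrow> l) (at_left t)" using cf unfolding cadlag_def by blast
    moreover have "\<forall>\<^sub>F s in at_left t. f s = g s"
      unfolding eventually_at_left_field by (rule exI[of _ 0]) (use t eq in simp)
    ultimately have "(g \<longlongrightarrow> l) (at_left t)" by (rule Lim_transform_eventually)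
    then show "\<exists>l. (g \<longlongrightarrow> l) (at_left t)" by blast
  qed
  then show ?thesis using assms by (metis (no_types))
qed

lemma (in prob_space) indep_vars_AE_cong:
  assumes ind: "indep_vars M' X I" and Y: "\<And>i. i \<in> I \<Longrightarrow> random_variable (M' i) (Y i)"
    and ae: "AE \<omega> in M. \<forall>i\<in>I. X i \<omega> = Y i \<omega>"
  shows "indep_vars M' Y I"
  unfolding indep_vars_def2 indep_sets_def
proof (intro conjI ballI allI impI)
  show "random_variable (M' i) (Y i)" if "i \<in> I" for i by (rule Y[OF that])
  show "{Y i -` A \<inter> space M |A. A \<in> sets (M' i)} \<subseteq> events" if "i \<in> I" for i
    using measurable_sets[OF Y[OF that]] by blast
  have X: "random_variable (M' i) (X i)" if "i \<in> I" for i
    using ind that by (simp add: indep_vars_def2)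
  fix J A assume J: "J \<subseteq> I" "J \<noteq> {}" "finite J"
    and A: "A \<in> (\<Pi> i\<in>J. {Y i -` A \<inter> space M |A. A \<in> sets (M' i)})"
  have "\<forall>j\<in>J. \<exists>B. A j = Y j -` B \<inter> space M \<and> B \<in> sets (M' j)" using A by (auto simp: Pi_iff)
  then obtain B where B: "\<And>j. j \<in> J \<Longrightarrow> A j = Y j -` B j \<inter> space M"
    "\<And>j. j \<in> J \<Longrightarrow> B j \<in> sets (M' j)"
    by metis
  define A' where "A' j = X j -` B j \<inter> space M" for j
  have A'_ev: "A' j \<in> events" if "j \<in> J" for j
    unfolding A'_def using that J(1) B(2) by (intro measurable_sets[OF X]) auto
  have A_ev: "A j \<in> events" if "j \<in> J" for j
    unfolding B(1)[OF that] using that J(1) B(2) by (intro measurable_sets[OF Y]) auto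
  have ae': "AE \<omega> in M. \<forall>j\<in>J. \<omega> \<in> A j \<longleftrightarrow> \<omega> \<in> A' j"
    using ae
  proof eventually_elim
    case (elim \<omega>)
    show ?case
    proof
      fix j assume "j \<in> J"
      then have "X j \<omega> = Y j \<omega>" using elim J(1) by blast
      then show "\<omega> \<in> A j \<longleftrightarrow> \<omega> \<in> A' j" by (simp add: B(1)[OF \<open>j \<in> J\<close>] A'_def)
    qed
  qed
  have one: "prob (A j) = prob (A' j)" if "j \<in> J" for j
  proof (rule finite_measure_eq_AE)
    show "AE \<omega> in M. \<omega> \<in> A j \<longleftrightarrow> \<omega> \<in> A' j" using ae' by eventually_elim (use that in blast)
  qed (use that A_ev A'_ev in blast)+
  have "prob (\<Inter>j\<in>J. A j) = prob (\<Inter>j\<in>J. A' j)"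
  proof (rule finite_measure_eq_AE)
    show "AE \<omega> in M. \<omega> \<in> (\<Inter>j\<in>J. A j) \<longleftrightarrow> \<omega> \<in> (\<Inter>j\<in>J. A' j)" using ae' by eventually_elim simp
  qed (use J A_ev A'_ev in \<open>auto intro!: sets.finite_INT\<close>)
  also have "\<dots> = (\<Prod>j\<in>J. prob (A' j))"
  proof -
    have "indep_sets (\<lambda>i. {X i -` A \<inter> space M |A. A \<in> sets (M' i)}) I"
      using ind by (simp add: indep_vars_def2)
    moreover have "\<forall>j\<in>J. A' j \<in> {X j -` A \<inter> space M |A. A \<in> sets (M' j)}"
      using B(2) unfolding A'_def by blast
    ultimately show ?thesis using J by (intro indep_setsD) auto
  qed
  also have "\<dots> = (\<Prod>j\<in>J. prob (A j))" using one by simp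
  finally show "prob (\<Inter>j\<in>J. A j) = (\<Prod>j\<in>J. prob (A j))" .
qed

lemma good_path_zero: "good_path (\<lambda>_. 0)"
  unfolding good_path_def cadlag_def no_negative_jumps_def
proof (intro conjI allI impI)
  fix t l :: real assume "0 < t" "((\<lambda>_. 0 :: real) \<longlongrightarrow> l) (at_left t)"
  then have "l = 0" by (intro tendsto_unique[OF _ _ tendsto_const]) (auto simp: trivial_limit_at_left_real)
  then show "l \<le> 0" by simp
qed (auto intro: tendsto_const exI)

text \<open>The zero path is a good path and may replace the bad ones. The exceptional set is null,
  so neither the independence of the increments nor their laws notice.\<close>

lemma levy_paths_modification:
  assumes levy: "spectrally_positive_levy_process M X" and complete: "complete_measure M"
  obtains N where "N \<in> null_sets M" "levy_paths M (\<lambda>t \<omega>. if \<omega> \<in> N then 0 else X t \<omega>)"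
proof -
  have L: "levy_process M X" using levy by (simp add: spectrally_positive_levy_process_def)
  interpret prob_space M using L by (simp add: levy_process_def)
  have "AE \<omega> in M. X 0 \<omega> = 0" "AE \<omega> in M. cadlag (\<lambda>t. X t \<omega>)" "AE \<omega> in M. no_negative_jumps (\<lambda>t. X t \<omega>)"
    using levy by (auto simp: spectrally_positive_levy_process_def levy_process_def)
  then have "AE \<omega> in M. good_path (\<lambda>t. X t \<omega>)"
    by eventually_elim (simp add: good_path_def)
  then obtain N where N: "{\<omega>\<in>space M. \<not> good_path (\<lambda>t. X t \<omega>)} \<subseteq> N" "N \<in> null_sets M"
    by (auto simp: eventually_ae_filter)
  define X' where "X' t \<omega> = (if \<omega> \<in> N then 0 else X t \<omega>)" for t \<omega>
  have N_ev: "N \<in> events" using N(2) by blast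
  have Xm: "X t \<in> borel_measurable M" if "0 \<le> t" for t using L that by (simp add: levy_process_def)
  have X'm: "X' t \<in> borel_measurable M" if "0 \<le> t" for t
  proof -
    have "(\<lambda>\<omega>. X t \<omega> * indicat_real (space M - N) \<omega>) \<in> borel_measurable M" using Xm[OF that] N_ev by simp
    moreover have "X' t \<omega> = X t \<omega> * indicat_real (space M - N) \<omega>" if "\<omega> \<in> space M" for \<omega>
      using that by (simp add: X'_def indicator_def)
    ultimately show ?thesis by (subst measurable_cong)
  qed
  have eq: "AE \<omega> in M. \<forall>t. X t \<omega> = X' t \<omega>"
    using AE_not_in[OF N(2)] by eventually_elim (simp add: X'_def)
  have gp: "good_path (\<lambda>t. X' t \<omega>)" if "\<omega> \<in> space M" for \<omega>
    using N(1) that good_path_zero by (cases "\<omega> \<in> N") (auto simp: X'_def)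
  have "levy_paths M X'"
  proof (rule levy_paths.intro[OF prob_space_axioms levy_paths_axioms.intro])
    show "levy_process M X'"
      unfolding levy_process_def
    proof (intro conjI allI impI)
      show "prob_space M" by (rule prob_space_axioms)
      show "X' t \<in> borel_measurable M" if "0 \<le> t" for t by (rule X'm[OF that])
      show "AE \<omega> in M. X' 0 \<omega> = 0" using gp by (intro AE_I2) (simp add: good_path_def)
      show "AE \<omega> in M. cadlag (\<lambda>t. X' t \<omega>)" using gp by (intro AE_I2) (simp add: good_path_def)
      fix n :: nat and p :: "nat \<Rightarrow> real" assume p: "0 \<le> p 0 \<and> mono_on {..n} p"
      have p0: "0 \<le> p i" if "i \<le> n" for i
        using p that by (meson atMost_iff le0 mono_onD order_trans)
      show "indep_vars (\<lambda>_. borel) (\<lambda>i \<omega>. X' (p (Suc i)) \<omega> - X' (p i) \<omega>) {..<n}"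
      proof (rule indep_vars_AE_cong)
        show "indep_vars (\<lambda>_. borel) (\<lambda>i \<omega>. X (p (Suc i)) \<omega> - X (p i) \<omega>) {..<n}"
          using L p by (simp add: levy_process_def)
        show "random_variable borel (\<lambda>\<omega>. X' (p (Suc i)) \<omega> - X' (p i) \<omega>)" if "i \<in> {..<n}" for i
          using that p0[of i] p0[of "Suc i"] by (intro borel_measurable_diff X'm) auto
        show "AE \<omega> in M. \<forall>i\<in>{..<n}. X (p (Suc i)) \<omega> - X (p i) \<omega> = X' (p (Suc i)) \<omega> - X' (p i) \<omega>"
          using eq by eventually_elim simp
      qed
    next
      fix s t :: real assume st: "0 \<le> s" "0 \<le> t"
      have "distr M borel (\<lambda>\<omega>. X' (s + t) \<omega> - X' s \<omega>) = distr M borel (\<lambda>\<omega>. X (s + t) \<omega> - X s \<omega>)"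
      proof (rule distr_cong_AE)
        show "AE \<omega> in M. X' (s + t) \<omega> - X' s \<omega> = X (s + t) \<omega> - X s \<omega>" using eq by eventually_elim simp
      qed (use st in \<open>auto intro!: borel_measurable_diff Xm X'm\<close>)
      also have "\<dots> = distr M borel (X t)" using L st by (simp add: levy_process_def)
      also have "\<dots> = distr M borel (X' t)"
      proof (rule distr_cong_AE)
        show "AE \<omega> in M. X t \<omega> = X' t \<omega>" using eq by eventually_elim simp
      qed (use st in \<open>auto intro!: Xm X'm\<close>)
      finally show "distr M borel (\<lambda>\<omega>. X' (s + t) \<omega> - X' s \<omega>) = distr M borel (X' t)" .
    qed
    show "complete_measure M" by (rule complete)
    show "good_path (\<lambda>t. X' t \<omega>)" if "\<omega> \<in> space M" for \<omega> by (rule gp[OF that])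
  qed
  then show ?thesis using that[OF N(2)] by (simp add: X'_def[abs_def])
qed

lemma Inf_ennreal_image_eq_0:
  assumes "\<And>e. 0 < e \<Longrightarrow> \<exists>t. 0 < t \<and> t < e \<and> P t"
  shows "Inf (ennreal ` {t. 0 < t \<and> P t}) = 0"
proof (rule ccontr)
  let ?I = "Inf (ennreal ` {t. 0 < t \<and> P t})"
  assume "?I \<noteq> 0"
  then have "0 < ?I" by (simp add: zero_less_iff_neq_zero)
  then obtain e where e: "0 < e" "ennreal e \<le> ?I"
  proof (cases ?I)
    case (real r)
    then show ?thesis using that[of r] \<open>0 < ?I\<close> by simp
  next
    case top
    then have "ennreal 1 \<le> ?I" by (simp only: top_greatest)
    then show ?thesis by (rule that[OF zero_less_one])
  qed
  obtain t where t: "0 < t" "t < e" "P t" using assms[OF e(1)] by blast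
  have "?I \<le> ennreal t" by (rule Inf_lower) (use t in blast)
  also have "\<dots> < ennreal e" using t e(1) by (simp add: ennreal_less_iff)
  finally show False using e(2) by simp
qed

text \<open>Killing is defined by an infimum of zeros. If there is no zero up to \<open>t\<close>,
  right continuity keeps the path away from zero a little longer, so the infimum lies strictly
  beyond \<open>t\<close>.\<close>

lemma killed_right_continuous:
  fixes Y :: "real \<Rightarrow> 'b \<Rightarrow> real"
  assumes rc: "continuous (at_right t) (\<lambda>t. Y t \<omega>)" and t: "0 \<le> t"
  shows "killed Y t \<omega> = (if \<exists>s\<in>{0..t}. Y s \<omega> = 0 then \<infinity> else ereal (Y t \<omega>))"
proof -
  have "ennreal t < reaching_time Y \<omega> \<longleftrightarrow> \<not> (\<exists>s\<in>{0..t}. Y s \<omega> = 0)"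
  proof
    assume *: "ennreal t < reaching_time Y \<omega>"
    show "\<not> (\<exists>s\<in>{0..t}. Y s \<omega> = 0)"
    proof
      assume "\<exists>s\<in>{0..t}. Y s \<omega> = 0"
      then obtain s where s: "0 \<le> s" "s \<le> t" "Y s \<omega> = 0" by auto
      have "reaching_time Y \<omega> \<le> ennreal s" unfolding reaching_time_def by (rule Inf_lower) (use s in blast)
      also have "\<dots> \<le> ennreal t" using s by (simp add: ennreal_leI)
      finally show False using * by simp
    qed
  next
    assume *: "\<not> (\<exists>s\<in>{0..t}. Y s \<omega> = 0)"
    then have "Y t \<omega> \<noteq> 0" using t by auto
    have "((\<lambda>t. Y t \<omega>) \<longlongrightarrow> Y t \<omega>) (at_right t)" using rc by (simp add: continuous_within)
    from tendsto_imp_eventually_ne[OF this \<open>Y t \<omega> \<noteq> 0\<close>]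
    obtain b where b: "t < b" "\<And>s. t < s \<Longrightarrow> s < b \<Longrightarrow> Y s \<omega> \<noteq> 0"
      unfolding eventually_at_right_field by blast
    have "ennreal b \<le> reaching_time Y \<omega>"
      unfolding reaching_time_def
    proof (rule Inf_greatest)
      fix r assume "r \<in> ennreal ` {t. 0 \<le> t \<and> Y t \<omega> = 0}"
      then obtain s where s: "r = ennreal s" "0 \<le> s" "Y s \<omega> = 0" by blast
      then have "\<not> s \<le> t" using * by auto
      then have "b \<le> s" using b(2)[of s] s(3) by force
      then show "ennreal b \<le> r" using s(1) by (simp add: ennreal_leI)
    qed
    moreover have "ennreal t < ennreal b" using b(1) t by (simp add: ennreal_less_iff)
    ultimately show "ennreal t < reaching_time Y \<omega>" by simp
  qed
  then show ?thesis by (simp add: killed_def)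
qed

lemma borel_measurable_AE_modification:
  fixes f g :: "'a \<Rightarrow> 'b::topological_space"
  assumes complete: "complete_measure M" and f: "f \<in> borel_measurable M" and ae: "AE \<omega> in M. f \<omega> = g \<omega>"
  shows "g \<in> borel_measurable M"
proof (rule measurableI)
  fix B :: "'b set" assume B: "B \<in> sets borel"
  show "g -` B \<inter> space M \<in> sets M"
  proof (rule complete_measure.in_sets_AE[OF complete _ measurable_sets[OF f B]])
    show "AE \<omega> in M. \<omega> \<in> f -` B \<inter> space M \<longleftrightarrow> \<omega> \<in> g -` B \<inter> space M"
      using ae by eventually_elim simp
  qed simp
qed simp

section \<open>Behaviour at zero\<close>

context sticky_levy
begin

context
  fixes y :: real and Z C :: "real \<Rightarrow> 'a \<Rightarrow> real"
  assumes y: "0 \<le> y" and sol: "sticky_solution M X \<gamma> y Z C"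
begin

lemma AE_solution_path: "AE \<omega> in M. solution_path (\<lambda>s. X s \<omega>) \<gamma> y (\<lambda>t. Z t \<omega>) (\<lambda>t. C t \<omega>)"
proof -
  have "AE \<omega> in M. solves_path (\<lambda>s. X s \<omega>) \<gamma> y (\<lambda>t. Z t \<omega>) (\<lambda>t. C t \<omega>)"
    using sol by (simp add: sticky_solution_def)
  then show ?thesis using AE_space[of M] by eventually_elim (rule solution_path[OF y])
qed

lemma solution_measurable: "0 \<le> t \<Longrightarrow> Z t \<in> borel_measurable M"
  using sol by (simp add: sticky_solution_def)

text \<open>Both killed processes coincide with one function of the infimum and the present value of
  \<open>X\<close>. This settles their measurability, which the definition through an uncountable
  set of zeros does not show, together with the equality of the laws. For y = 0 the level is reached
  at time 0; for y > 0 \<open>AE_reaches_level\<close> is needed.\<close>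

lemma AE_killed_eq:
  "AE \<omega> in M. \<forall>t\<ge>0. killed Z t \<omega> = (if y \<le> dep \<omega> t then \<infinity> else ereal (y + X t \<omega>))
    \<and> killed (\<lambda>t \<omega>. y + X t \<omega>) t \<omega> = (if y \<le> dep \<omega> t then \<infinity> else ereal (y + X t \<omega>))"
proof -
  have level: "AE \<omega> in M. \<forall>t\<ge>0. y \<le> dep \<omega> t \<longrightarrow> (\<exists>s\<in>{0..t}. y + X s \<omega> = 0)"
  proof (cases "y = 0")
    case True
    have "\<exists>s\<in>{0..t}. y + X s \<omega> = 0" if "\<omega> \<in> space M" "0 \<le> t" for \<omega> t
      using X_0[OF that(1)] True that(2) by (intro bexI[of _ 0]) auto
    then show ?thesis by (intro AE_I2) blast
  next
    case False
    then show ?thesis using y by (intro AE_reaches_level) simp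
  qed
  then show ?thesis using AE_solution_path AE_space[of M]
  proof eventually_elim
    case (elim \<omega>)
    interpret solution_path "\<lambda>s. X s \<omega>" \<gamma> y "\<lambda>t. Z t \<omega>" "\<lambda>t. C t \<omega>" by (rule elim(2))
    show ?case
    proof (intro allI impI)
      fix t :: real assume t: "0 \<le> t"
      have hit: "(\<exists>s\<in>{0..t}. y + X s \<omega> = 0) \<longleftrightarrow> y \<le> dep \<omega> t"
      proof
        assume "\<exists>s\<in>{0..t}. y + X s \<omega> = 0"
        then obtain s where s: "0 \<le> s" "s \<le> t" "y + X s \<omega> = 0" by auto
        with depth_upper[OF good s(1,2)] show "y \<le> dep \<omega> t" by simp
      qed (use elim(1) t in blast)
      have "continuous (at_right t) (\<lambda>t. Z t \<omega>)"
      proof -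
        have "(\<lambda>t. Z t \<omega>) s = Zc y s \<omega>" if "0 \<le> s" for s using f_unique[OF that] .
        then have "cadlag (\<lambda>t. Z t \<omega>)" using cadlag_cong cadlag_sticky by metis
        then show ?thesis using t by (simp add: cadlag_def)
      qed
      from killed_right_continuous[where Y = Z, OF this t]
      have "killed Z t \<omega> = (if y \<le> dep \<omega> t then \<infinity> else ereal (Z t \<omega>))"
        unfolding zero_iff(1)[OF t] hit .
      moreover have "Z t \<omega> = y + X t \<omega>" if "\<not> y \<le> dep \<omega> t"
        using zero_iff[OF t] hit that by blast
      moreover have "killed (\<lambda>t \<omega>. y + X t \<omega>) t \<omega> = (if y \<le> dep \<omega> t then \<infinity> else ereal (y + X t \<omega>))"
      proof -
        have "continuous (at_right t) (\<lambda>t. y + X t \<omega>)"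
          by (intro continuous_intros good_path_right_continuous[OF good t])
        from killed_right_continuous[where Y = "\<lambda>t \<omega>. y + X t \<omega>", OF this t]
        show ?thesis unfolding hit .
      qed
      ultimately show "killed Z t \<omega> = (if y \<le> dep \<omega> t then \<infinity> else ereal (y + X t \<omega>))
          \<and> killed (\<lambda>t \<omega>. y + X t \<omega>) t \<omega> = (if y \<le> dep \<omega> t then \<infinity> else ereal (y + X t \<omega>))"
        by simp
    qed
  qed
qed

lemma killed_measurable:
  assumes t: "0 \<le> t"
  shows "killed Z t \<in> borel_measurable M" "killed (\<lambda>t \<omega>. y + X t \<omega>) t \<in> borel_measurable M"
proof -
  have [measurable]: "(\<lambda>\<omega>. dep \<omega> t) \<in> borel_measurable M" "X t \<in> borel_measurable M"
    using borel_measurable_depth[OF path_measurable, of "\<lambda>_. t"] X_measurable[OF t]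
    by (simp_all add: depth_restrict)
  have m: "(\<lambda>\<omega>. if y \<le> dep \<omega> t then \<infinity> else ereal (y + X t \<omega>)) \<in> borel_measurable M" by measurable
  show "killed Z t \<in> borel_measurable M"
    by (rule borel_measurable_AE_modification[OF complete m])
      (use AE_killed_eq in eventually_elim, use t in simp)
  show "killed (\<lambda>t \<omega>. y + X t \<omega>) t \<in> borel_measurable M"
    by (rule borel_measurable_AE_modification[OF complete m])
      (use AE_killed_eq in eventually_elim, use t in simp)
qed

lemma same_law_killed: "same_law M (killed (\<lambda>t \<omega>. y + X t \<omega>)) M (killed Z)"
proof -
  have "law M (killed (\<lambda>t \<omega>. y + X t \<omega>)) = law M (killed Z)"
    unfolding law_def
  proof (rule distr_cong_AE)
    show "AE \<omega> in M. (\<lambda>t\<in>{0..}. killed (\<lambda>t \<omega>. y + X t \<omega>) t \<omega>) = (\<lambda>t\<in>{0..}. killed Z t \<omega>)"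
      using AE_killed_eq by eventually_elim (intro restrict_ext, simp)
  qed (auto intro!: measurable_path_spaceI killed_measurable)
  then show ?thesis by (simp add: same_law_def killed_measurable)
qed

end

text \<open>The descent property with slope 0 makes the push positive at every positive time, so
  every interval [0, e] contains a positive amount of time at zero. The clock is positive as well,
  so every such interval also contains times away from zero.\<close>

lemma AE_sticky_at_zero:
  assumes sol: "sticky_solution M X \<gamma> 0 Z C"
  shows "AE \<omega> in M. Inf (ennreal ` {t. 0 < t \<and> Z t \<omega> = 0}) = 0 \<and>
    Inf (ennreal ` {t. 0 < t \<and> Z t \<omega> \<noteq> 0}) = 0 \<and>
    (\<integral>\<^sup>+s\<in>{0..}. indicator {0} (Z s \<omega>) \<partial>lborel) > 0"
proof -
  have "AE \<omega> in M. \<forall>u>0. 0 < dep \<omega> u"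
    by (rule AE_depth_pos) (use not_AE_mono_drift[OF ub, of 0] in simp)
  then show ?thesis using AE_solution_path[OF order_refl sol]
  proof eventually_elim
    case (elim \<omega>)
    interpret solution_path "\<lambda>s. X s \<omega>" \<gamma> 0 "\<lambda>t. Z t \<omega>" "\<lambda>t. C t \<omega>" by (rule elim(2))
    have A_pos: "0 < A t" if t: "0 < t" for t
    proof -
      have "0 < C t \<omega>" using clock_pos[OF t] c_unique[of t] t by simp
      then have "0 < push (C t \<omega>)" using elim(1) by (simp add: push_def)
      then have "0 < \<gamma> * A t" using A_eq_push[of t] t by simp
      then show ?thesis by (rule zero_less_mult_pos[OF _ \<gamma>])
    qed
    have "\<exists>t. 0 < t \<and> t < e \<and> Z t \<omega> = 0" if "0 < e" for e
      using A_diff(3)[of 0 e] A_pos[OF that] that by (auto simp: A_0)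
    then have 1: "Inf (ennreal ` {t. 0 < t \<and> Z t \<omega> = 0}) = 0" by (rule Inf_ennreal_image_eq_0)
    have "\<exists>t. 0 < t \<and> t < e \<and> Z t \<omega> \<noteq> 0" if e: "0 < e" for e
    proof (rule ccontr)
      assume "\<not> ?thesis"
      then have "C e \<omega> = C 0 \<omega>" using e by (intro c_diff(3)) auto
      then show False using clock_pos[OF e] c_unique[of e] e by (simp add: c_0)
    qed
    then have 2: "Inf (ennreal ` {t. 0 < t \<and> Z t \<omega> \<noteq> 0}) = 0" by (rule Inf_ennreal_image_eq_0)
    define S where "S = {s. 0 \<le> s \<and> Z s \<omega> = 0}"
    have "S = {s. 0 \<le> s \<and> Zc 0 (max 0 s) \<omega> = 0}" using f_unique by (auto simp: S_def max_def)
    also have "\<dots> \<in> sets borel"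
    proof -
      have [measurable]: "(\<lambda>s. Zc 0 (max 0 s) \<omega>) \<in> borel_measurable borel"
        by (rule borel_measurable_right_continuous) (rule sticky_right_continuous)
      show ?thesis by measurable
    qed
    finally have S: "S \<in> sets borel" .
    \<comment> \<open>If the zero set were null, the time \<open>A 1\<close> at zero would vanish,
      against \<open>A_pos\<close>; this relates the gauge integral of the equation to the Lebesgue
      integral of the definition.\<close>
    have "emeasure lborel S \<noteq> 0"
    proof
      assume "emeasure lborel S = 0"
      then have "negligible S"
        using S by (simp add: negligible_iff_null_sets null_sets_completionI null_sets_def)
      have "integral {0..1::real} (\<lambda>s. indicat_real {0} (Z s \<omega>)) = 0"
        by (rule integral_unique, rule has_integral_negligible[OF \<open>negligible S\<close>])
          (auto simp: S_def indicator_def)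
      then show False using A_pos[of 1] by (simp add: A_def)
    qed
    moreover have "(\<integral>\<^sup>+s\<in>{0..}. indicator {0} (Z s \<omega>) \<partial>lborel) = (\<integral>\<^sup>+s. indicator S s \<partial>lborel)"
      by (rule nn_integral_cong) (auto simp: S_def indicator_def)
    ultimately have 3: "(\<integral>\<^sup>+s\<in>{0..}. indicator {0} (Z s \<omega>) \<partial>lborel) > 0"
      using S by (simp add: zero_less_iff_neq_zero)
    show ?case using 1 2 3 by blast
  qed
qed

text \<open>Everything rests on the events Z t \<in> B, C t \<le> s: for B = UNIV they say that
  \<open>C t\<close> is a stopping time, for general \<open>B\<close> that \<open>Z t\<close> is
  measurable at that time. They come from \<open>sticky_past\<close> for the explicit version and
  reach the given solution because \<open>F\<close> contains the null sets.\<close>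

lemma time_change_solution:
  assumes F: "filtration (space M) F" and sub: "\<And>t. subalgebra M (F t)"
    and null: "null_sets M \<subseteq> sets (F 0)"
    and past: "\<And>r. 0 \<le> r \<Longrightarrow> past r \<subseteq> sets (F (ennreal r))"
    and y: "0 \<le> y" and sol: "sticky_solution M X \<gamma> y Z C"
  shows "time_change M F C"
    and "0 \<le> t \<Longrightarrow> Z t \<in> borel_measurable (filtration.pre_sigma (space M) F (\<lambda>\<omega>. ennreal (C t \<omega>)))"
proof -
  interpret F: filtration "space M" F by (rule F)
  note eq = AE_solution_eq[OF y sol]
  have F_mod: "B \<in> sets (F s)"
    if "A \<in> sets (F s)" "B \<subseteq> space M" "AE \<omega> in M. \<omega> \<in> A \<longleftrightarrow> \<omega> \<in> B" for A B s
  proof (rule sets_AE_modification[OF complete _ _ _ that])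
    show "sigma_algebra (space M) (sets (F s))"
      using sets.sigma_algebra_axioms[of "F s"] unfolding F.space_F .
    show "null_sets M \<subseteq> sets (F s)" using null F.sets_F_mono[of 0 s] by (meson order_trans zero_le)
    show "sets (F s) \<subseteq> events" using sub[of s] by (simp add: subalgebra_def)
  qed
  have event: "{\<omega>\<in>space M. Z t \<omega> \<in> B \<and> ennreal (C t \<omega>) \<le> s} \<in> sets (F s)"
    if t: "0 \<le> t" and B: "B \<in> sets borel" for t B s
  proof -
    have "{\<omega>\<in>space M. Zc y t \<omega> \<in> B \<and> ennreal (Cc y t \<omega>) \<le> s} \<in> sets (F s)"
    proof (cases s)
      case (real r)
      have "{\<omega>\<in>space M. Zc y t \<omega> \<in> B \<and> Cc y t \<omega> \<le> r} \<in> sets (F (ennreal r))"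
        using sticky_past[OF y t real(1) B] past[OF real(1)] by blast
      then show ?thesis unfolding real(2) using real(1) by (simp add: ennreal_le_iff)
    next
      case top
      have "{\<omega>\<in>space M. Zc y t \<omega> \<in> B \<and> ennreal (Cc y t \<omega>) \<le> s}
          = (\<Union>n::nat. {\<omega>\<in>space M. Zc y t \<omega> \<in> B \<and> Cc y t \<omega> \<le> real n})"
        using real_arch_simple top by auto
      also have "\<dots> \<in> sets (F s)"
      proof (rule sets.countable_UN, rule image_subsetI)
        fix n :: nat
        have "past (real n) \<subseteq> sets (F (ennreal (real n)))" by (rule past) simp
        also have "\<dots> \<subseteq> sets (F s)" using top by (intro F.sets_F_mono) simp
        finally show "{\<omega>\<in>space M. Zc y t \<omega> \<in> B \<and> Cc y t \<omega> \<le> real n} \<in> sets (F s)"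
          using sticky_past[OF y t _ B, of "real n"] by auto
      qed
      finally show ?thesis .
    qed
    then show ?thesis
    proof (rule F_mod)
      show "AE \<omega> in M. \<omega> \<in> {\<omega>\<in>space M. Zc y t \<omega> \<in> B \<and> ennreal (Cc y t \<omega>) \<le> s}
          \<longleftrightarrow> \<omega> \<in> {\<omega>\<in>space M. Z t \<omega> \<in> B \<and> ennreal (C t \<omega>) \<le> s}"
        using eq by eventually_elim (use t in simp)
    qed blast
  qed
  have stop: "stopping_time F (\<lambda>\<omega>. ennreal (C t \<omega>))" if t: "0 \<le> t" for t
  proof
    fix s show "Measurable.pred (F s) (\<lambda>\<omega>. ennreal (C t \<omega>) \<le> s)"
      using event[OF t, of UNIV s] by (simp add: pred_def F.space_F)
  qed
  have paths: "AE \<omega> in M. (\<forall>t\<ge>0. 0 \<le> C t \<omega> \<and> continuous (at_right t) (\<lambda>s. C s \<omega>)) \<and> mono_on {0..} (\<lambda>s. C s \<omega>)"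
    using eq AE_space[of M]
  proof eventually_elim
    case (elim \<omega>)
    interpret P: sticky_path "\<lambda>s. X s \<omega>" \<gamma> y by (rule sticky_path[OF elim(2) y])
    have ceq: "C t \<omega> = Cc y t \<omega>" if "0 \<le> t" for t using elim(1) that by blast
    have "continuous_on {0..} (\<lambda>s. C s \<omega>)"
      using P.clock_continuous by (subst continuous_on_cong[OF refl ceq]) auto
    then have cont: "continuous (at t within {0..}) (\<lambda>s. C s \<omega>)" if "0 \<le> t" for t
      using that by (simp add: continuous_on_eq_continuous_within)
    have "continuous (at_right t) (\<lambda>s. C s \<omega>)" if t: "0 \<le> t" for t
      by (rule continuous_within_subset[OF cont[OF t]]) (use t in auto)
    moreover have "0 \<le> C t \<omega>" if "0 \<le> t" for t using ceq[OF that] clock_nonneg by simp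
    moreover have "mono_on {0..} (\<lambda>s. C s \<omega>)"
    proof (rule mono_onI)
      fix r s :: real assume "r \<in> {0..}" "s \<in> {0..}" "r \<le> s"
      then show "C r \<omega> \<le> C s \<omega>" using P.clock_mono[of r s] ceq by simp
    qed
    ultimately show ?case by blast
  qed
  show "time_change M F C" unfolding time_change_def using paths stop by blast
  show "Z t \<in> borel_measurable (F.pre_sigma (\<lambda>\<omega>. ennreal (C t \<omega>)))" if t: "0 \<le> t"
  proof (rule measurableI)
    fix B :: "real set" assume B: "B \<in> sets borel"
    show "Z t -` B \<inter> space (F.pre_sigma (\<lambda>\<omega>. ennreal (C t \<omega>))) \<in> sets (F.pre_sigma (\<lambda>\<omega>. ennreal (C t \<omega>)))"
    proof (rule F.sets_pre_sigmaI[OF stop[OF t]])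
      fix s
      have "{\<omega>\<in>Z t -` B \<inter> space (F.pre_sigma (\<lambda>\<omega>. ennreal (C t \<omega>))). ennreal (C t \<omega>) \<le> s}
          = {\<omega>\<in>space M. Z t \<omega> \<in> B \<and> ennreal (C t \<omega>) \<le> s}"
        unfolding F.space_pre_sigma by blast
      then show "{\<omega>\<in>Z t -` B \<inter> space (F.pre_sigma (\<lambda>\<omega>. ennreal (C t \<omega>))). ennreal (C t \<omega>) \<le> s} \<in> sets (F s)"
        using event[OF t B, of s] by (simp only:)
    qed
  qed simp
qed

section \<open>The family of solutions as a Markov process\<close>

context
  fixes Z C :: "real \<Rightarrow> real \<Rightarrow> 'a \<Rightarrow> real"
  assumes sol: "\<And>y. 0 \<le> y \<Longrightarrow> sticky_solution M X \<gamma> y (Z y) (C y)"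
begin

lemma Z_eq: "0 \<le> y \<Longrightarrow> AE \<omega> in M. \<forall>t\<ge>0. Z y t \<omega> = Zc y t \<omega>"
proof -
  assume y: "0 \<le> y"
  from AE_solution_eq[OF y sol[OF y]] show ?thesis by eventually_elim blast
qed

lemma Z_process: "0 \<le> y \<Longrightarrow> sticky_process M X \<gamma> y (Z y)"
  by (rule sticky_process.intro[OF sticky_levy_axioms sticky_process_axioms.intro])
    (simp_all add: Z_eq solution_measurable[OF _ sol])

lemma AE_Z_paths:
  assumes y: "0 \<le> y"
  shows "AE \<omega> in M. cadlag (\<lambda>t. Z y t \<omega>) \<and> (\<forall>t\<ge>0. 0 \<le> Z y t \<omega>)"
  using Z_eq[OF y] AE_space[of M]
proof eventually_elim
  case (elim \<omega>)
  interpret P: sticky_path "\<lambda>s. X s \<omega>" \<gamma> y by (rule sticky_path[OF elim(2) y])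
  have zeq: "Z y t \<omega> = Zc y t \<omega>" if "0 \<le> t" for t using elim(1) that by blast
  have "cadlag (\<lambda>t. Z y t \<omega>) \<longleftrightarrow> cadlag (\<lambda>t. Zc y t \<omega>)" by (rule cadlag_cong[OF zeq])
  then have "cadlag (\<lambda>t. Z y t \<omega>)" using P.cadlag_sticky by simp
  moreover have "0 \<le> Z y t \<omega>" if "0 \<le> t" for t using zeq[OF that] P.sticky_nonneg[OF that] by simp
  ultimately show ?case by blast
qed

text \<open>The explicit version is jointly measurable in the starting point and \<omega>, so its
  law depends measurably on the starting point. The given solutions have the same laws, being chosen
  separately for each starting point up to null sets.\<close>

lemma law_Z_measurable: "(\<lambda>y. law M (Z y)) \<in> restrict_space borel {0..} \<rightarrow>\<^sub>M prob_algebra path_space"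
proof -
  let ?B = "restrict_space (borel :: real measure) {0..}"
  have id: "(\<lambda>y. y) \<in> ?B \<rightarrow>\<^sub>M borel" by (rule measurable_restrict_space1) simp
  have fst_m: "(\<lambda>p. fst p) \<in> borel_measurable (?B \<Otimes>\<^sub>M M)"
    using measurable_compose[OF measurable_fst id] .
  have path_m: "(\<lambda>p. \<lambda>t\<in>{0..}. X t (snd p)) \<in> ?B \<Otimes>\<^sub>M M \<rightarrow>\<^sub>M path_space"
    using measurable_compose[OF measurable_snd path_measurable] .
  have "(\<lambda>p. \<lambda>t\<in>{0..}. Zc (fst p) t (snd p)) \<in> ?B \<Otimes>\<^sub>M M \<rightarrow>\<^sub>M path_space"
  proof (rule measurable_path_spaceI)
    fix t :: real assume "0 \<le> t"
    have "(\<lambda>p. sticky \<gamma> (fst p) (\<lambda>t\<in>{0..}. X t (snd p)) t) \<in> borel_measurable (?B \<Otimes>\<^sub>M M)"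
      by (rule borel_measurable_sticky[OF path_m _ fst_m]) simp
    then show "(\<lambda>p. Zc (fst p) t (snd p)) \<in> borel_measurable (?B \<Otimes>\<^sub>M M)"
      by (simp only: sticky_restrict)
  qed
  then have f: "(\<lambda>(y, \<omega>). \<lambda>t\<in>{0..}. Zc y t \<omega>) \<in> ?B \<Otimes>\<^sub>M M \<rightarrow>\<^sub>M path_space"
    by (simp add: case_prod_beta')
  have "(\<lambda>_. M) \<in> ?B \<rightarrow>\<^sub>M prob_algebra M"
    by (rule measurable_const) (simp add: space_prob_algebra prob_space_axioms)
  from measurable_distr_prob_space2[OF this f]
  have "(\<lambda>y. distr M path_space (\<lambda>\<omega>. \<lambda>t\<in>{0..}. Zc y t \<omega>)) \<in> ?B \<rightarrow>\<^sub>M prob_algebra path_space" .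
  moreover have "law M (Z y) = distr M path_space (\<lambda>\<omega>. \<lambda>t\<in>{0..}. Zc y t \<omega>)" if "y \<in> space ?B" for y
  proof -
    have y: "0 \<le> y" using that by (simp add: space_restrict_space)
    show ?thesis
      unfolding law_def
    proof (rule distr_cong_AE)
      show "AE \<omega> in M. (\<lambda>t\<in>{0..}. Z y t \<omega>) = (\<lambda>t\<in>{0..}. Zc y t \<omega>)"
        using Z_eq[OF y] by eventually_elim (intro restrict_ext, simp)
      show "(\<lambda>\<omega>. \<lambda>t\<in>{0..}. Z y t \<omega>) \<in> M \<rightarrow>\<^sub>M path_space"
        by (rule measurable_path_spaceI) (rule solution_measurable[OF y sol[OF y]])
      show "(\<lambda>\<omega>. \<lambda>t\<in>{0..}. Zc y t \<omega>) \<in> M \<rightarrow>\<^sub>M path_space"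
        by (rule measurable_path_spaceI) (rule sticky_measurable[OF y])
    qed simp_all
  qed
  ultimately show ?thesis by (subst measurable_cong)
qed

lemma strong_markov_process_Z: "strong_markov_process (\<lambda>_. M) Z"
  unfolding strong_markov_process_def
proof (intro conjI allI impI ballI)
  fix y :: real assume y: "0 \<le> y"
  show "prob_space M" by (rule prob_space_axioms)
  show "Z y t \<in> borel_measurable M" if "0 \<le> t" for t by (rule solution_measurable[OF y sol[OF y] that])
  show "AE \<omega> in M. Z y 0 \<omega> = y"
    using Z_eq[OF y] AE_space[of M]
  proof eventually_elim
    case (elim \<omega>)
    interpret P: sticky_path "\<lambda>s. X s \<omega>" \<gamma> y by (rule sticky_path[OF elim(2) y])
    show ?case using elim(1) P.sticky_eq'[of 0] P.clock_0 X_0[OF elim(2)] by simp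
  qed
next
  show "(\<lambda>y. law M (Z y)) \<in> restrict_space borel {0..} \<rightarrow>\<^sub>M prob_algebra path_space"
    by (rule law_Z_measurable)
next
  fix y :: real and T B
  assume y: "0 \<le> y" and T: "stopping_time (natural_filtration M (Z y)) T"
    and B: "B \<in> sets (path_space :: (real \<Rightarrow> real) measure)"
  show "AE \<omega> in M. T \<omega> < \<infinity> \<longrightarrow>
      real_cond_exp M (filtration.pre_sigma (space M) (natural_filtration M (Z y)) T)
        (indicator {\<omega>\<in>space M. T \<omega> < \<infinity> \<and> (\<lambda>t\<in>{0..}. Z y (enn2real (T \<omega>) + t) \<omega>) \<in> B}) \<omega>
      = (let v = Z y (enn2real (T \<omega>)) \<omega> in measure (law M (Z v)) B)"
    using sticky_process.strong_markov_sticky[OF Z_process[OF y] T B] AE_Z_paths[OF y]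
  proof eventually_elim
    case (elim \<omega>)
    \<comment> \<open>Solutions are available for nonnegative starting points, so the restart
      position must be nonnegative before its law can be identified with the kernel.\<close>
    have "0 \<le> Z y (enn2real (T \<omega>)) \<omega>" using elim(2) by simp
    from sticky_process.measure_law_Y[OF Z_process[OF this] B] elim(1)
    show ?case by (simp add: Let_def)
  qed
qed

lemma sticky_levy_process_Z: "sticky_levy_process M X (\<lambda>_. M) Z"
  unfolding sticky_levy_process_def extension_of_killed_def
  using strong_markov_process_Z AE_Z_paths same_law_killed[OF _ sol] AE_sticky_at_zero[OF sol[OF order_refl]]
  by blast

end

end

lemma sticky_solution_AE_cong:
  assumes sol: "sticky_solution M X \<gamma> y Z C" and ae: "AE \<omega> in M. \<forall>t. X t \<omega> = X' t \<omega>"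
  shows "sticky_solution M X' \<gamma> y Z C"
proof -
  have "AE \<omega> in M. solves_path (\<lambda>t. X t \<omega>) \<gamma> y (\<lambda>t. Z t \<omega>) (\<lambda>t. C t \<omega>)"
    using sol by (simp add: sticky_solution_def)
  then have "AE \<omega> in M. solves_path (\<lambda>t. X' t \<omega>) \<gamma> y (\<lambda>t. Z t \<omega>) (\<lambda>t. C t \<omega>)"
    using ae
  proof eventually_elim
    case (elim \<omega>)
    have "(\<lambda>t. X t \<omega>) = (\<lambda>t. X' t \<omega>)" using elim(2) by (intro ext) blast
    with elim(1) show ?case by (simp only:)
  qed
  then show ?thesis using sol by (simp add: sticky_solution_def)
qed

lemma same_law_AE_cong:
  assumes complete: "complete_measure M" and same: "same_law M Y P W"
    and ae: "AE \<omega> in M. \<forall>t\<ge>0. Y t \<omega> = Y' t \<omega>"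
  shows "same_law M Y' P W"
proof -
  have Y: "Y t \<in> borel_measurable M" if "0 \<le> t" for t using same that by (simp add: same_law_def)
  have Y': "Y' t \<in> borel_measurable M" if t: "0 \<le> t" for t
  proof (rule borel_measurable_AE_modification[OF complete Y[OF t]])
    show "AE \<omega> in M. Y t \<omega> = Y' t \<omega>" using ae by eventually_elim (use t in blast)
  qed
  have "law M Y' = law M Y"
    unfolding law_def
  proof (rule distr_cong_AE)
    show "AE \<omega> in M. (\<lambda>t\<in>{0..}. Y' t \<omega>) = (\<lambda>t\<in>{0..}. Y t \<omega>)"
      using ae by eventually_elim (intro restrict_ext, simp)
    show "(\<lambda>\<omega>. \<lambda>t\<in>{0..}. Y' t \<omega>) \<in> M \<rightarrow>\<^sub>M path_space" by (rule measurable_path_spaceI) (rule Y')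
    show "(\<lambda>\<omega>. \<lambda>t\<in>{0..}. Y t \<omega>) \<in> M \<rightarrow>\<^sub>M path_space" by (rule measurable_path_spaceI) (rule Y)
  qed simp_all
  then show ?thesis using same Y' by (simp add: same_law_def)
qed

theorem theorem1:
  fixes M :: "'a measure" and F :: "ennreal \<Rightarrow> 'a measure"
    and X :: "real \<Rightarrow> 'a \<Rightarrow> real" and \<gamma> z :: real
  assumes "usual_filtration M F"
    and "spectrally_positive_levy_process M X"
    and "adapted F X"
    and "unbounded_variation M X"
    and "\<gamma> > 0" and "z \<ge> 0"
  shows "(\<exists>Z C. sticky_solution M X \<gamma> z Z C) \<and>
    (\<forall>Z C Z' C'. sticky_solution M X \<gamma> z Z C \<and> sticky_solution M X \<gamma> z Z' C' \<longrightarrow>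
      indistinguishable M Z Z' \<and> indistinguishable M C C') \<and>
    (\<forall>Z C. sticky_solution M X \<gamma> z Z C \<longrightarrow>
      time_change M F C \<and>
      (\<forall>t\<ge>0. Z t \<in> borel_measurable
        (filtration.pre_sigma (space M) F (\<lambda>\<omega>. ennreal (C t \<omega>))))) \<and>
    (\<forall>Z C. (\<forall>x\<ge>0. sticky_solution M X \<gamma> x (Z x) (C x)) \<longrightarrow>
      sticky_levy_process M X (\<lambda>_. M) Z)"
proof -
  have filt: "filtration (space M) F" and sub: "\<And>t. subalgebra M (F t)"
    and complete: "complete_measure M" and null: "null_sets M \<subseteq> sets (F 0)"
    using assms(1) unfolding usual_filtration_def by blast+
  interpret F: filtration "space M" F by (rule filt)
  obtain N where N: "N \<in> null_sets M" "levy_paths M (\<lambda>t \<omega>. if \<omega> \<in> N then 0 else X t \<omega>)"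
    using levy_paths_modification[OF assms(2) complete] by blast
  \<comment> \<open>All pathwise results are applied to this version with good paths everywhere. A
    solution driven by \<open>X\<close> is one driven by \<open>X'\<close> and conversely, since the
    two processes differ on a null set.\<close>
  define X' where "X' t \<omega> = (if \<omega> \<in> N then 0 else X t \<omega>)" for t \<omega>
  have ae: "AE \<omega> in M. \<forall>t. X t \<omega> = X' t \<omega>" and ae': "AE \<omega> in M. \<forall>t. X' t \<omega> = X t \<omega>"
    using AE_not_in[OF N(1)] by (eventually_elim, simp add: X'_def)+
  have lp: "levy_paths M X'" using N(2) by (simp add: X'_def[abs_def])
  have ub: "unbounded_variation M X'"
    unfolding unbounded_variation_def
    using assms(4)[unfolded unbounded_variation_def] ae
  proof eventually_elim
    case (elim \<omega>)
    have "(\<lambda>t. X t \<omega>) = (\<lambda>t. X' t \<omega>)" using elim(2) by (intro ext) blast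
    with elim(1) show ?case by (simp only: simp_thms)
  qed
  interpret sticky_levy M X' \<gamma>
    by (rule sticky_levy.intro[OF lp sticky_levy_axioms.intro[OF assms(5) ub]])
  have sol': "sticky_solution M X' \<gamma> y Z C" if "sticky_solution M X \<gamma> y Z C" for y Z C
    by (rule sticky_solution_AE_cong[OF that ae])
  \<comment> \<open>\<open>F\<close> is adapted to \<open>X\<close>, not to the modified version,
    but it contains the null sets; hence the past of \<open>X'\<close> up to \<open>r\<close>, null
    sets included, still lies in \<open>F\<close> at \<open>r\<close>.\<close>
  have past_F: "past r \<subseteq> sets (F (ennreal r))" if r: "0 \<le> r" for r
  proof -
    have F_alg: "sigma_algebra (space M) (sets (F (ennreal r)))"
      using sets.sigma_algebra_axioms[of "F (ennreal r)"] unfolding F.space_F .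
    have null_r: "null_sets M \<subseteq> sets (F (ennreal r))"
      using null F.sets_F_mono[of 0 "ennreal r"] by (meson order_trans zero_le)
    have sub_r: "sets (F (ennreal r)) \<subseteq> events" using sub[of "ennreal r"] by (simp add: subalgebra_def)
    have "X' u -` B \<inter> space M \<in> sets (F (ennreal r))"
      if u: "0 \<le> u" "ennreal u \<le> ennreal r" and B: "B \<in> sets borel" for u B
    proof (rule sets_AE_modification[OF complete F_alg null_r sub_r])
      have "X u \<in> borel_measurable (F (ennreal u))" using assms(3) u(1) by (simp add: adapted_def)
      from measurable_sets[OF this B] show "X u -` B \<inter> space M \<in> sets (F (ennreal r))"
        using F.sets_F_mono[OF u(2)] unfolding F.space_F by blast
      show "AE \<omega> in M. \<omega> \<in> X u -` B \<inter> space M \<longleftrightarrow> \<omega> \<in> X' u -` B \<inter> space M"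
        using ae by eventually_elim simp
    qed blast
    then have "{X' u -` B \<inter> space M |u B. 0 \<le> u \<and> ennreal u \<le> ennreal r \<and> B \<in> sets borel}
        \<union> null_sets M \<subseteq> sets (F (ennreal r))"
      using null_r by blast
    from sets.sigma_sets_subset[OF this] show ?thesis
      unfolding past_sets_def F.space_F .
  qed
  show ?thesis
  proof (intro conjI allI impI)
    have "sticky_solution M X' \<gamma> z (Zc z) (Cc z)"
      unfolding sticky_solution_def
      using AE_sticky_solves[OF assms(6)] sticky_measurable[OF assms(6)] clock_measurable[OF assms(6)]
      by blast
    then show "\<exists>Z C. sticky_solution M X \<gamma> z Z C"
      using sticky_solution_AE_cong[OF _ ae'] by blast
  next
    fix Z C Z' C'
    assume *: "sticky_solution M X \<gamma> z Z C \<and> sticky_solution M X \<gamma> z Z' C'"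
    have eq: "AE \<omega> in M. \<forall>t\<ge>0. Z t \<omega> = Zc z t \<omega> \<and> C t \<omega> = Cc z t \<omega>"
      "AE \<omega> in M. \<forall>t\<ge>0. Z' t \<omega> = Zc z t \<omega> \<and> C' t \<omega> = Cc z t \<omega>"
      by (rule AE_solution_eq[OF assms(6) sol'[OF conjunct1[OF *]]],
          rule AE_solution_eq[OF assms(6) sol'[OF conjunct2[OF *]]])
    show "indistinguishable M Z Z'"
      unfolding indistinguishable_def using eq by eventually_elim simp
    show "indistinguishable M C C'"
      unfolding indistinguishable_def using eq by eventually_elim simp
  next
    fix Z C
    assume "sticky_solution M X \<gamma> z Z C"
    note tc = time_change_solution[OF filt sub null past_F assms(6) sol'[OF this]]
    show "time_change M F C" by (rule tc(1))
    show "Z t \<in> borel_measurable (filtration.pre_sigma (space M) F (\<lambda>\<omega>. ennreal (C t \<omega>)))"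
      if "0 \<le> t" for t
      by (rule tc(2)[OF _ that])
  next
    fix Z C
    assume "\<forall>x\<ge>0. sticky_solution M X \<gamma> x (Z x) (C x)"
    then have sol: "sticky_solution M X' \<gamma> x (Z x) (C x)" if "0 \<le> x" for x
      using sol' that by blast
    have "sticky_levy_process M X' (\<lambda>_. M) Z" by (rule sticky_levy_process_Z[OF sol])
    moreover have "same_law M (killed (\<lambda>t \<omega>. x + X t \<omega>)) M (killed (Z x))"
      if "same_law M (killed (\<lambda>t \<omega>. x + X' t \<omega>)) M (killed (Z x))" for x
    proof (rule same_law_AE_cong[OF complete that])
      show "AE \<omega> in M. \<forall>t\<ge>0. killed (\<lambda>t \<omega>. x + X' t \<omega>) t \<omega> = killed (\<lambda>t \<omega>. x + X t \<omega>) t \<omega>"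
        using ae by eventually_elim (simp add: killed_def reaching_time_def)
    qed
    ultimately show "sticky_levy_process M X (\<lambda>_. M) Z"
      unfolding sticky_levy_process_def extension_of_killed_def by blast
  qed
qed

end
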